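(* Let ${\bf N}=(\mathcal L,l_0,l_f,\Gamma,b,k,L,(Y_i)_{0\le i\le L},{\rm Stm}_N)$ be a generalized Turing machine on $\Sigma^\omega$, that is, $Y_i=\Sigma^\omega$ for $0\le i\le L$, where all functions used in the machine (the functions $f$ occurring in its assignments and its tests) are (single-valued) partial functions. (1) If all the functions used in ${\bf N}$ are continuous, then $f_N:\subseteq(\Sigma^\omega)^k\to\Sigma^\omega$ is continuous. (2) If all the functions used in ${\bf N}$ are computable, then $f_N:\subseteq(\Sigma^\omega)^k\to\Sigma^\omega$ is computable.
   Context: **Notation.** $\Sigma$ is a fixed finite alphabet with $0,1\in\Sigma$; $\Sigma^*$ is the set of finite words and $\Sigma^\omega$ the set of infinite sequences over $\Sigma$. $f:\subseteq A\to B$ denotes a partial function. $\Sigma^*$ carries the discrete topology, $\Sigma^\omega$ the Cantor topology with basis $\{u\Sigma^\omega\mid u\in\Sigma^*\}$, products the product topology; a partial function is continuous if it is continuous on its domain with the subspace topology. **Computability.** For $Y_0,\ldots,Y_n\in\{\Sigma^*,\Sigma^\omega\}$, a Type-2 machine of type $(Y_1,\ldots,Y_n\to Y_0)$ is a multi-tape Turing machine with $n$ input tapes, finitely many work tapes and one one-way output tape. It computes $f:\subseteq Y_1\times\cdots\times Y_n\to Y_0$ where: if $Y_0=\Sigma^*$, $f(p)=w$ iff the machine on input $p$ halts with $w$ on the output tape; if $Y_0=\Sigma^\omega$, $f(p)=q$ iff the machine on input $p$ computes forever and writes $q\in\Sigma^\omega$ on the output tape. Functions so computed are called Turing computable; a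 partial function is called computable if it has a Turing computable extension. **Generalized Turing machine (GTM).** A GTM is a tuple $(\mathcal L,l_0,l_f,\Gamma,b,k,L,(Y_i)_{0\le i\le L},{\rm Stm})$ where $\mathcal L$ is a finite set (labels) with $l_0,l_f\in\mathcal L$ (initial, final label); $\Gamma$ is a finite set with $\Sigma\cap\Gamma=\emptyset$ and $b\in\Gamma$ (blank); $k,L\in\mathbb N$, $k\le L$ (tapes $0,\ldots,L$; input tapes $1,\ldots,k$; output tape $0$); each $Y_i$ is a set with $Y_i\cap\Gamma=\emptyset$; and ${\rm Stm}$ assigns to each $l\in\mathcal L\setminus\{l_f\}$ a statement of one of the forms (with $i,i_1,\ldots,i_n\in\{0,\ldots,L\}$, $l',l''\in\mathcal L$, $a\in\Gamma$): (a) $(i,{\rm right},l')$; (b) $(i,{\rm left},l')$; (c) $(i:=a,l')$; (d) $(i,{\rm if}\ a\ {\rm then}\ l',\ {\rm else}\ l'')$; (e) assignment $(i:=f(i_1,\ldots,i_n),l')$ with $f$ a (in general multi-valued, here single-valued partial) function from $Y_{i_1}\times\cdots\times Y_{i_n}$ to $Y_i$; (f) test $({\rm if}\ f(i_1,\ldots,i_n)\ {\rm then}\ l',\ {\rm else}\ l'')$ with $f:\subseteq Y_{i_1}\times\cdots\times Y_{i_n}\to\Sigma^*$, $\mathrm{range}(f)\subseteq\{0,1\}$. **Semantics.** A configuration is $\kappa=(l,(\alpha_0,m_0),\ldots,(\alpha_L,m_L))$ with $l\in\mathcal L$, $\alpha_i:\mathbb Z\to Y_i\cup\Gamma$ (tape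 inscription), $m_i\in\mathbb Z$ (head position). Let $x_j:=\alpha_j(m_j)$. The successor relation $\kappa\vdash\kappa'$ is determined by ${\rm Stm}(l)$ (no successor if $l=l_f$): in case (a)/(b), $\kappa'$ is $\kappa$ with $m_i$ replaced by $m_i+1$ / $m_i-1$ and label $l'$; (c) $\alpha_i(m_i)$ is replaced by $a$, label $l'$; (d) label $l'$ if $x_i=a$, label $l''$ if $x_i\ne a$; (e) $\alpha_i(m_i)$ is replaced by the value $f(x_{i_1},\ldots,x_{i_n})$, label $l'$ (no successor if this value does not exist, in particular if some $x_{i_j}\notin Y_{i_j}$); (f) label $l'$ if $f(x_{i_1},\ldots,x_{i_n})=0$, label $l''$ if $f(x_{i_1},\ldots,x_{i_n})=1$ (no successor otherwise). A computation is a finite or infinite sequence of configurations, each the $\vdash$-predecessor of the next; it is maximal if it is infinite or its last configuration has no successor. A configuration is accepting if $l=l_f$ and $\alpha_0(0)\in Y_0$; an accepting computation is a finite computation whose last configuration is accepting. The initial configuration ${\rm IC}(x_1,\ldots,x_k)$ has label $l_0$, all heads at position $0$, $\alpha_i(0)=x_i$ for $1\le i\le k$, and $b$ in all other cells. The function $f_N$ computed by the machine: $x_0=f_N(x_1,\ldots,x_k)$ iff every maximal computation starting with ${\rm IC}(x_1,\ldots,x_k)$ is accepting and there is an accepting computation starting with it whose last configuration has $\alpha_0(0)=x_0$ (the value is unique as all functions used are single-valued). *)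

theory Defs
  imports "HOL-Analysis.Analysis" "HOL-Library.Omega_Words_Fun"
begin

text \<open>
  The alphabet \<open>\<Sigma>\<close> is a type of class \<open>{finite, zero_neq_one}\<close>; finite words have type
  \<open>'a list\<close>, infinite sequences type \<open>'a word = nat \<Rightarrow> 'a\<close>.
  A tuple in \<open>Y\<^sub>1 \<times> \<dots> \<times> Y\<^sub>n\<close> is an element of \<open>\<Pi>\<^sub>E j\<in>{..<n}. Y\<^sub>j\<close>; components are counted from 0.
  A partial function on such a product is an option-valued function whose domain is
  contained in it.
\<close>

section \<open>Topology and continuity\<close>

definition cantor_topology :: "'a word topology" where
  "cantor_topology = topology_generated_by {{u \<frown> p | p. True} | u. True}"

definition continuous_pfun :: "nat \<Rightarrow> 'b topology \<Rightarrow> ((nat \<Rightarrow> 'a word) \<Rightarrow> 'b option) \<Rightarrow> bool" where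
  "continuous_pfun n T f \<longleftrightarrow>
     continuous_map
       (subtopology (product_topology (\<lambda>_. cantor_topology) {..<n}) (dom f)) T (\<lambda>x. the (f x))"


section \<open>Type-2 machines and computability\<close>

datatype head_move = Left | Stay | Right

fun moved :: "head_move \<Rightarrow> int \<Rightarrow> int" where
  "moved Left z = z - 1"
| "moved Stay z = z"
| "moved Right z = z + 1"

text \<open>
  States and work tape symbols are natural numbers; as both sets are finite, this is only a
  choice of names.  One step reads all input and work tapes (\<open>None\<close> is the blank of an input
  tape) and yields the new state, the moves of the input heads, the symbol written and the
  move for each work tape, and possibly one symbol that is appended to the output tape.
\<close>

record 'a t2m =
  t2_inputs :: nat
  t2_works :: nat
  t2_states :: "nat set"
  t2_start :: nat
  t2_halt :: nat
  t2_symbols :: "nat set"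
  t2_blank :: nat
  t2_delta :: "nat \<Rightarrow> 'a option list \<Rightarrow> nat list \<Rightarrow>
                 nat \<times> head_move list \<times> (nat \<times> head_move) list \<times> 'a option"

definition type2_machine :: "'a t2m \<Rightarrow> bool" where
  "type2_machine M \<longleftrightarrow>
     finite (t2_states M) \<and> t2_start M \<in> t2_states M \<and> t2_halt M \<in> t2_states M \<and>
     finite (t2_symbols M) \<and> t2_blank M \<in> t2_symbols M \<and>
     (\<forall>s \<in> t2_states M - {t2_halt M}. \<forall>ins ws.
        length ins = t2_inputs M \<and> length ws = t2_works M \<and> set ws \<subseteq> t2_symbols M \<longrightarrow>
        (case t2_delta M s ins ws of (s', ms, as, out) \<Rightarrow>
           s' \<in> t2_states M \<and> length ms = t2_inputs M \<and>
           length as = t2_works M \<and> fst ` set as \<subseteq> t2_symbols M))"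

record 'a t2conf =
  c_state :: nat
  c_heads :: "int list"
  c_works :: "((int \<Rightarrow> nat) \<times> int) list"
  c_output :: "'a list"

definition t2_initial :: "'a t2m \<Rightarrow> 'a t2conf" where
  "t2_initial M =
     \<lparr>c_state = t2_start M, c_heads = replicate (t2_inputs M) 0,
      c_works = replicate (t2_works M) (\<lambda>_. t2_blank M, 0), c_output = []\<rparr>"

definition input_cell :: "'a word \<Rightarrow> int \<Rightarrow> 'a option" where
  "input_cell p z = (if z < 0 then None else Some (p (nat z)))"

definition work_action :: "(int \<Rightarrow> nat) \<times> int \<Rightarrow> nat \<times> head_move \<Rightarrow> (int \<Rightarrow> nat) \<times> int" where
  "work_action t act = ((fst t)(snd t := fst act), moved (snd act) (snd t))"

text \<open>The input \<open>x\<close> is a parameter of the step function, as input tapes are read-only.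
  In the halting state the configuration no longer changes.\<close>

definition t2_step :: "'a t2m \<Rightarrow> (nat \<Rightarrow> 'a word) \<Rightarrow> 'a t2conf \<Rightarrow> 'a t2conf" where
  "t2_step M x c =
     (if c_state c = t2_halt M then c
      else case t2_delta M (c_state c)
                  (map (\<lambda>j. input_cell (x j) (c_heads c ! j)) [0..<t2_inputs M])
                  (map (\<lambda>(\<tau>, z). \<tau> z) (c_works c))
           of (s', ms, as, out) \<Rightarrow>
             \<lparr>c_state = s', c_heads = map2 moved ms (c_heads c),
              c_works = map2 work_action (c_works c) as,
              c_output = c_output c @ (case out of None \<Rightarrow> [] | Some a \<Rightarrow> [a])\<rparr>)"

definition t2_run :: "'a t2m \<Rightarrow> (nat \<Rightarrow> 'a word) \<Rightarrow> nat \<Rightarrow> 'a t2conf" where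
  "t2_run M x t = (t2_step M x ^^ t) (t2_initial M)"

definition t2_outputs_word :: "'a t2m \<Rightarrow> (nat \<Rightarrow> 'a word) \<Rightarrow> 'a list \<Rightarrow> bool" where
  "t2_outputs_word M x w \<longleftrightarrow>
     (\<exists>t. c_state (t2_run M x t) = t2_halt M \<and> c_output (t2_run M x t) = w)"

definition t2_outputs_seq :: "'a t2m \<Rightarrow> (nat \<Rightarrow> 'a word) \<Rightarrow> 'a word \<Rightarrow> bool" where
  "t2_outputs_seq M x q \<longleftrightarrow>
     (\<forall>t. c_state (t2_run M x t) \<noteq> t2_halt M) \<and>
     (\<forall>t. c_output (t2_run M x t) = map q [0..<length (c_output (t2_run M x t))]) \<and>
     (\<forall>m. \<exists>t. m \<le> length (c_output (t2_run M x t)))"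

definition turing_computable ::
  "('a t2m \<Rightarrow> (nat \<Rightarrow> 'a word) \<Rightarrow> 'b \<Rightarrow> bool) \<Rightarrow> nat \<Rightarrow> ((nat \<Rightarrow> 'a word) \<Rightarrow> 'b option) \<Rightarrow> bool" where
  "turing_computable outputs n f \<longleftrightarrow>
     dom f \<subseteq> (\<Pi>\<^sub>E j\<in>{..<n}. UNIV) \<and>
     (\<exists>M. type2_machine M \<and> t2_inputs M = n \<and>
       (\<forall>x \<in> (\<Pi>\<^sub>E j\<in>{..<n}. UNIV). \<forall>y. f x = Some y \<longleftrightarrow> outputs M x y))"

text \<open>The first argument fixes the output type: \<open>t2_outputs_word\<close> for functions into \<open>\<Sigma>\<^sup>*\<close>,
  \<open>t2_outputs_seq\<close> for functions into \<open>\<Sigma>\<^sup>\<omega>\<close>.\<close>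

definition computable_pfun ::
  "('a t2m \<Rightarrow> (nat \<Rightarrow> 'a word) \<Rightarrow> 'b \<Rightarrow> bool) \<Rightarrow> nat \<Rightarrow> ((nat \<Rightarrow> 'a word) \<Rightarrow> 'b option) \<Rightarrow> bool" where
  "computable_pfun outputs n f \<longleftrightarrow> (\<exists>g. turing_computable outputs n g \<and> f \<subseteq>\<^sub>m g)"


section \<open>Generalized Turing machines\<close>

text \<open>
  The sets \<open>Y\<^sub>i\<close> are subsets of a common type \<open>'y\<close>.  A cell of tape \<open>i\<close> contains \<open>Inl y\<close>
  with \<open>y \<in> Y\<^sub>i\<close> or \<open>Inr a\<close> with \<open>a \<in> \<Gamma>\<close>, and \<open>\<Gamma>\<close> has a type of its own, which makes it disjoint
  from all \<open>Y\<^sub>i\<close> and from \<open>\<Sigma>\<close>.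
\<close>

datatype ('l, 'g, 'y, 'a) stmt =
    GoRight nat 'l
  | GoLeft nat 'l
  | Write nat 'g 'l
  | IfSymbol nat 'g 'l 'l
  | Assign nat "(nat \<Rightarrow> 'y) \<Rightarrow> 'y option" "nat list" 'l
  | Test "(nat \<Rightarrow> 'y) \<Rightarrow> 'a list option" "nat list" 'l 'l

record ('l, 'g, 'y, 'a) gtm =
  labels :: "'l set"
  initial_label :: 'l
  final_label :: 'l
  gamma :: "'g set"
  blank :: 'g
  arity :: nat
  last_tape :: nat
  cell_set :: "nat \<Rightarrow> 'y set"
  statement :: "'l \<Rightarrow> ('l, 'g, 'y, 'a) stmt"

definition args_set :: "('l, 'g, 'y, 'a) gtm \<Rightarrow> nat list \<Rightarrow> (nat \<Rightarrow> 'y) set" where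
  "args_set N js = (\<Pi>\<^sub>E j\<in>{..<length js}. cell_set N (js ! j))"

definition wf_stmt ::
  "('l, 'g, 'y, 'a::zero_neq_one) gtm \<Rightarrow> ('l, 'g, 'y, 'a) stmt \<Rightarrow> bool" where
  "wf_stmt N s \<longleftrightarrow>
     (case s of
        GoRight i l' \<Rightarrow> i \<le> last_tape N \<and> l' \<in> labels N
      | GoLeft i l' \<Rightarrow> i \<le> last_tape N \<and> l' \<in> labels N
      | Write i a l' \<Rightarrow> i \<le> last_tape N \<and> a \<in> gamma N \<and> l' \<in> labels N
      | IfSymbol i a l' l'' \<Rightarrow>
          i \<le> last_tape N \<and> a \<in> gamma N \<and> l' \<in> labels N \<and> l'' \<in> labels N
      | Assign i f js l' \<Rightarrow>
          i \<le> last_tape N \<and> set js \<subseteq> {..last_tape N} \<and> l' \<in> labels N \<and>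
          dom f \<subseteq> args_set N js \<and> ran f \<subseteq> cell_set N i
      | Test f js l' l'' \<Rightarrow>
          set js \<subseteq> {..last_tape N} \<and> l' \<in> labels N \<and> l'' \<in> labels N \<and>
          dom f \<subseteq> args_set N js \<and> ran f \<subseteq> {[0], [1]})"

definition generalized_TM :: "('l, 'g, 'y, 'a::zero_neq_one) gtm \<Rightarrow> bool" where
  "generalized_TM N \<longleftrightarrow>
     finite (labels N) \<and> initial_label N \<in> labels N \<and> final_label N \<in> labels N \<and>
     finite (gamma N) \<and> blank N \<in> gamma N \<and> arity N \<le> last_tape N \<and>
     (\<forall>l \<in> labels N - {final_label N}. wf_stmt N (statement N l))"

text \<open>A configuration also has tapes beyond the last one; no statement refers to them.\<close>

type_synonym ('l, 'g, 'y) config = "'l \<times> (nat \<Rightarrow> (int \<Rightarrow> 'y + 'g) \<times> int)"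

definition cell :: "(nat \<Rightarrow> (int \<Rightarrow> 'y + 'g) \<times> int) \<Rightarrow> nat \<Rightarrow> 'y + 'g" where
  "cell T i = fst (T i) (snd (T i))"

definition write_cell ::
  "(nat \<Rightarrow> (int \<Rightarrow> 'y + 'g) \<times> int) \<Rightarrow> nat \<Rightarrow> 'y + 'g \<Rightarrow> nat \<Rightarrow> (int \<Rightarrow> 'y + 'g) \<times> int" where
  "write_cell T i c = T(i := ((fst (T i))(snd (T i) := c), snd (T i)))"

definition move_head ::
  "(nat \<Rightarrow> (int \<Rightarrow> 'y + 'g) \<times> int) \<Rightarrow> nat \<Rightarrow> int \<Rightarrow> nat \<Rightarrow> (int \<Rightarrow> 'y + 'g) \<times> int" where
  "move_head T i d = T(i := (fst (T i), snd (T i) + d))"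

text \<open>\<open>apply_fun f js T v\<close>: the scanned cells of the tapes \<open>js\<close> all contain elements
  (not symbols from \<open>\<Gamma>\<close>), and \<open>f\<close> has value \<open>v\<close> on them.\<close>

definition apply_fun ::
  "((nat \<Rightarrow> 'y) \<Rightarrow> 'v option) \<Rightarrow> nat list \<Rightarrow> (nat \<Rightarrow> (int \<Rightarrow> 'y + 'g) \<times> int) \<Rightarrow> 'v \<Rightarrow> bool" where
  "apply_fun f js T v \<longleftrightarrow>
     (\<exists>y \<in> extensional {..<length js}.
        (\<forall>j < length js. cell T (js ! j) = Inl (y j)) \<and> f y = Some v)"

definition gtm_step ::
  "('l, 'g, 'y, 'a::zero_neq_one) gtm \<Rightarrow> ('l, 'g, 'y) config \<Rightarrow> ('l, 'g, 'y) config \<Rightarrow> bool" where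
  "gtm_step N \<kappa> \<kappa>' \<longleftrightarrow>
     (case \<kappa> of (l, T) \<Rightarrow>
        l \<noteq> final_label N \<and>
        (case statement N l of
           GoRight i l' \<Rightarrow> \<kappa>' = (l', move_head T i 1)
         | GoLeft i l' \<Rightarrow> \<kappa>' = (l', move_head T i (- 1))
         | Write i a l' \<Rightarrow> \<kappa>' = (l', write_cell T i (Inr a))
         | IfSymbol i a l' l'' \<Rightarrow> \<kappa>' = (if cell T i = Inr a then l' else l'', T)
         | Assign i f js l' \<Rightarrow> (\<exists>y. apply_fun f js T y \<and> \<kappa>' = (l', write_cell T i (Inl y)))
         | Test f js l' l'' \<Rightarrow>
             (apply_fun f js T [0] \<and> \<kappa>' = (l', T)) \<or> (apply_fun f js T [1] \<and> \<kappa>' = (l'', T))))"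

definition initial_config ::
  "('l, 'g, 'y, 'a) gtm \<Rightarrow> (nat \<Rightarrow> 'y) \<Rightarrow> ('l, 'g, 'y) config" where
  "initial_config N x =
     (initial_label N,
      \<lambda>i. (\<lambda>z. if 1 \<le> i \<and> i \<le> arity N \<and> z = 0 then Inl (x (i - 1)) else Inr (blank N), 0))"

datatype 'c computation = Finite "'c list" | Infinite "nat \<Rightarrow> 'c"

fun is_computation ::
  "('l, 'g, 'y, 'a::zero_neq_one) gtm \<Rightarrow> ('l, 'g, 'y) config computation \<Rightarrow> bool" where
  "is_computation N (Finite \<kappa>s) \<longleftrightarrow>
     \<kappa>s \<noteq> [] \<and> (\<forall>i. Suc i < length \<kappa>s \<longrightarrow> gtm_step N (\<kappa>s ! i) (\<kappa>s ! Suc i))"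
| "is_computation N (Infinite \<kappa>s) \<longleftrightarrow> (\<forall>i. gtm_step N (\<kappa>s i) (\<kappa>s (Suc i)))"

fun first_config :: "'c computation \<Rightarrow> 'c" where
  "first_config (Finite \<kappa>s) = hd \<kappa>s"
| "first_config (Infinite \<kappa>s) = \<kappa>s 0"

fun maximal ::
  "('l, 'g, 'y, 'a::zero_neq_one) gtm \<Rightarrow> ('l, 'g, 'y) config computation \<Rightarrow> bool" where
  "maximal N (Finite \<kappa>s) \<longleftrightarrow> (\<nexists>\<kappa>'. gtm_step N (last \<kappa>s) \<kappa>')"
| "maximal N (Infinite \<kappa>s) \<longleftrightarrow> True"

definition accepting_config ::
  "('l, 'g, 'y, 'a) gtm \<Rightarrow> ('l, 'g, 'y) config \<Rightarrow> 'y \<Rightarrow> bool" where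
  "accepting_config N \<kappa> y \<longleftrightarrow>
     fst \<kappa> = final_label N \<and> y \<in> cell_set N 0 \<and> fst (snd \<kappa> 0) 0 = Inl y"

text \<open>\<open>accepting N c y\<close>: the computation \<open>c\<close> is accepting, with \<open>\<alpha>\<^sub>0(0) = y\<close> at its end.\<close>

fun accepting ::
  "('l, 'g, 'y, 'a) gtm \<Rightarrow> ('l, 'g, 'y) config computation \<Rightarrow> 'y \<Rightarrow> bool" where
  "accepting N (Finite \<kappa>s) y \<longleftrightarrow> accepting_config N (last \<kappa>s) y"
| "accepting N (Infinite \<kappa>s) y \<longleftrightarrow> False"

definition gtm_result ::
  "('l, 'g, 'y, 'a::zero_neq_one) gtm \<Rightarrow> (nat \<Rightarrow> 'y) \<Rightarrow> 'y \<Rightarrow> bool" where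
  "gtm_result N x y \<longleftrightarrow>
     (\<forall>c. is_computation N c \<and> first_config c = initial_config N x \<and> maximal N c \<longrightarrow>
        (\<exists>y'. accepting N c y')) \<and>
     (\<exists>c. is_computation N c \<and> first_config c = initial_config N x \<and> accepting N c y)"

text \<open>\<open>gtm_result N x\<close> holds for at most one value, since the step relation is single-valued.\<close>

definition gtm_fun ::
  "('l, 'g, 'y, 'a::zero_neq_one) gtm \<Rightarrow> (nat \<Rightarrow> 'y) \<Rightarrow> 'y option" where
  "gtm_fun N x =
     (if x \<in> (\<Pi>\<^sub>E j\<in>{..<arity N}. cell_set N (Suc j)) \<and> (\<exists>y. gtm_result N x y)
      then Some (THE y. gtm_result N x y) else None)"

definition all_functions ::
  "('l, 'g, 'y, 'a) gtm \<Rightarrow> (nat \<Rightarrow> ((nat \<Rightarrow> 'y) \<Rightarrow> 'y option) \<Rightarrow> bool) \<Rightarrow>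
     (nat \<Rightarrow> ((nat \<Rightarrow> 'y) \<Rightarrow> 'a list option) \<Rightarrow> bool) \<Rightarrow> bool" where
  "all_functions N P Q \<longleftrightarrow>
     (\<forall>l \<in> labels N - {final_label N}.
        case statement N l of
          Assign i f js l' \<Rightarrow> P (length js) f
        | Test f js l' l'' \<Rightarrow> Q (length js) f
        | _ \<Rightarrow> True)"

end

theory Submission
  imports Defs
begin

text \<open>
  A halting computation makes finitely many steps, and it inspects a sequence in a cell only by
  passing it to a function of the machine.  A test that has a value is decided by finite prefixes
  of its arguments, and so is every finite part of the value of an assignment.  Hence, if the
  sequences in the cells are replaced by objects that are close enough to them, the computation
  goes through the same labels and head positions, and its result is close to the true one.  The
  lemma \<open>lockstep\<close> says this for two machines with the same control whose cells hold objects of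
  different kinds, where ``close'' is a family of relations of growing precision.

  Continuity is the case in which the second computation is that of the same machine on a nearby
  input (\<open>gtm_fun_continuous\<close>).

  For computability the second kind of objects are finite words.  A Type-2 machine for a function
  is cut off after \<open>t\<close> steps, or earlier if it is about to read a symbol that the given words do
  not contain; this makes the function one on words, and the generalized machine \<open>N\<close> a machine
  \<open>truncated t\<close> on words.  Started with prefixes of the input of length \<open>t\<close>, it never contradicts
  the true computation (\<open>truncated_sound\<close>), and for large \<open>t\<close> it reaches the final label with as
  long a prefix of the result as desired (\<open>truncated_progress\<close>, \<open>truncated_close\<close>).  So the
  function of \<open>N\<close> is computed as follows: in stage \<open>t\<close>, run at most \<open>t\<close> steps of \<open>truncated t\<close> on
  the prefixes of length \<open>t\<close>, and if the final label is reached, emit the symbols of the result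
  that have not been emitted yet.

  It remains to perform a stage on a Type-2 machine.  For this a small structured language of
  programs on finitely many stacks is compiled into Type-2 machines, with the continuations of the
  program as states (\<open>stack_program_computable\<close>).  A stage is then a program: sequences are words
  on stacks, a tape is a pair of stacks, \<open>runs_call\<close> simulates a truncated run of a Type-2 machine,
  \<open>runs_statement\<close> a step of \<open>truncated t\<close>, and \<open>exec_stage\<close> puts the parts together.
\<close>

section \<open>Runs of Type-2 machines\<close>

lemma t2_run_Suc: "t2_run M x (Suc t) = t2_step M x (t2_run M x t)"
  by (simp add: t2_run_def)

lemma t2_run_output_mono: "\<exists>v. c_output (t2_run M x (t + d)) = c_output (t2_run M x t) @ v"
proof (induction d)
  case (Suc d)
  then show ?case by (auto simp: t2_run_Suc t2_step_def split: prod.splits)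
qed simp

lemma t2_run_halted: "c_state (t2_run M x t) = t2_halt M \<Longrightarrow> t \<le> s \<Longrightarrow> t2_run M x s = t2_run M x t"
proof -
  assume h: "c_state (t2_run M x t) = t2_halt M" and "t \<le> s"
  have "t2_run M x (t + d) = t2_run M x t" for d
    by (induction d) (simp_all add: t2_run_Suc t2_step_def h)
  from this[of "s - t"] show ?thesis using \<open>t \<le> s\<close> by simp
qed

text \<open>
  The invariant of a run under which \<open>type2_machine\<close> constrains the next transition.
\<close>

definition valid_conf :: "'a t2m \<Rightarrow> 'a t2conf \<Rightarrow> bool" where
  "valid_conf M c \<longleftrightarrow> c_state c \<in> t2_states M \<and> length (c_heads c) = t2_inputs M \<and>
     length (c_works c) = t2_works M \<and> (\<forall>w\<in>set (c_works c). \<forall>z. fst w z \<in> t2_symbols M)"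

lemma valid_conf_initial: "type2_machine M \<Longrightarrow> valid_conf M (t2_initial M)"
  by (auto simp: valid_conf_def t2_initial_def type2_machine_def)

lemma valid_delta:
  assumes M: "type2_machine M" and v: "valid_conf M c" "c_state c \<noteq> t2_halt M"
    and ins: "length ins = t2_inputs M"
    and step: "t2_delta M (c_state c) ins (map (\<lambda>(\<tau>, z). \<tau> z) (c_works c)) = (s', ms, as, out)"
  shows "s' \<in> t2_states M" "length ms = t2_inputs M" "length as = t2_works M" "fst ` set as \<subseteq> t2_symbols M"
proof -
  have "set (map (\<lambda>(\<tau>, z). \<tau> z) (c_works c)) \<subseteq> t2_symbols M"
    using v(1) by (force simp: valid_conf_def)
  then have "case t2_delta M (c_state c) ins (map (\<lambda>(\<tau>, z). \<tau> z) (c_works c)) of (s', ms, as, out) \<Rightarrow>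
           s' \<in> t2_states M \<and> length ms = t2_inputs M \<and>
           length as = t2_works M \<and> fst ` set as \<subseteq> t2_symbols M"
    using M v ins unfolding type2_machine_def valid_conf_def by simp
  then show "s' \<in> t2_states M" "length ms = t2_inputs M" "length as = t2_works M" "fst ` set as \<subseteq> t2_symbols M"
    using step by auto
qed

lemma valid_conf_step:
  assumes M: "type2_machine M" and v: "valid_conf M c"
  shows "valid_conf M (t2_step M x c)"
proof (cases "c_state c = t2_halt M")
  case False
  obtain s' ms as out where d: "t2_delta M (c_state c) (map (\<lambda>j. input_cell (x j) (c_heads c ! j)) [0..<t2_inputs M])
     (map (\<lambda>(\<tau>, z). \<tau> z) (c_works c)) = (s', ms, as, out)"
    by (rule prod_cases4) blast
  note * = valid_delta[OF M v False _ d, simplified]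
  have "fst (work_action w a) z \<in> t2_symbols M" if "(w, a) \<in> set (zip (c_works c) as)" for w a z
  proof -
    have "fst w z' \<in> t2_symbols M" for z' using that v by (auto simp: valid_conf_def dest: set_zip_leftD)
    moreover have "fst a \<in> t2_symbols M" using that *(4) by (auto dest: set_zip_rightD)
    ultimately show ?thesis by (simp add: work_action_def)
  qed
  then have "\<forall>w\<in>set (map2 work_action (c_works c) as). \<forall>z. fst w z \<in> t2_symbols M"
    by auto
  then show ?thesis
    using * v False d unfolding t2_step_def valid_conf_def by simp
qed (use v in \<open>simp add: t2_step_def\<close>)

lemma valid_conf_run: "type2_machine M \<Longrightarrow> valid_conf M (t2_run M x t)"
  by (induction t) (simp_all add: t2_run_Suc valid_conf_step, simp add: t2_run_def valid_conf_initial)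

lemma moved_le: "moved d z \<le> z + 1"
  by (cases d) auto

text \<open>
  A run of \<open>t\<close> steps has inspected only positions below \<open>t\<close> of its inputs; this is why prefixes
  of length \<open>t\<close> determine it.
\<close>

lemma heads_le_time:
  assumes "type2_machine M" "j < t2_inputs M"
  shows "c_heads (t2_run M x t) ! j \<le> int t"
proof (induction t)
  case 0
  then show ?case using assms(2) by (simp add: t2_run_def t2_initial_def)
next
  case (Suc t)
  let ?c = "t2_run M x t"
  show ?case
  proof (cases "c_state ?c = t2_halt M")
    case False
    obtain s' ms as out where d: "t2_delta M (c_state ?c) (map (\<lambda>j. input_cell (x j) (c_heads ?c ! j)) [0..<t2_inputs M])
       (map (\<lambda>(\<tau>, z). \<tau> z) (c_works ?c)) = (s', ms, as, out)"
      by (rule prod_cases4) blast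
    note * = valid_delta[OF assms(1) valid_conf_run[OF assms(1)] False _ d, simplified]
    have "length (c_heads ?c) = t2_inputs M" using valid_conf_run[OF assms(1)] by (simp add: valid_conf_def)
    then have "c_heads (t2_run M x (Suc t)) ! j = moved (ms ! j) (c_heads ?c ! j)"
      using * assms(2) False d by (simp add: t2_run_Suc t2_step_def)
    then show ?thesis using Suc.IH moved_le[of "ms ! j" "c_heads ?c ! j"] by simp
  qed (use Suc in \<open>simp add: t2_run_Suc t2_step_def\<close>)
qed

section \<open>Computations of generalized Turing machines\<close>

lemma apply_fun_unique: "apply_fun f js T v \<Longrightarrow> apply_fun f js T w \<Longrightarrow> v = w"
proof -
  assume "apply_fun f js T v" "apply_fun f js T w"
  then obtain y z where y: "y \<in> extensional {..<length js}" "\<forall>j<length js. cell T (js ! j) = Inl (y j)" "f y = Some v"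
    and z: "z \<in> extensional {..<length js}" "\<forall>j<length js. cell T (js ! j) = Inl (z j)" "f z = Some w"
    unfolding apply_fun_def by blast
  have "y = z"
    by (rule extensionalityI[OF y(1) z(1)]) (use y(2) z(2) in auto)
  then show "v = w" using y z by simp
qed

lemma gtm_step_det:
  assumes "gtm_step N \<kappa> \<kappa>1" "gtm_step N \<kappa> \<kappa>2"
  shows "\<kappa>1 = \<kappa>2"
proof -
  have t: "\<not> (apply_fun f js T [0::'d::zero_neq_one] \<and> apply_fun f js T [1])" for f js and T :: "nat \<Rightarrow> (int \<Rightarrow> 'c + 'b) \<times> int"
    using apply_fun_unique[of f js T "[0]" "[1]"] by auto
  obtain l T where "\<kappa> = (l, T)" by (cases \<kappa>)
  then show ?thesis
    using assms t
    by (cases "statement N l") (auto simp: gtm_step_def dest: apply_fun_unique)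
qed

lemma relpowp_end_unique:
  assumes det: "\<And>a b c. r a b \<Longrightarrow> r a c \<Longrightarrow> b = c"
    and "(r ^^ m) a b" "(r ^^ n) a c" "\<nexists>d. r b d" "\<nexists>d. r c d"
  shows "b = c"
  using assms(2-)
proof (induction m arbitrary: n a)
  case 0
  then have a: "a = b" by simp
  then have "n = 0" using 0 by (metis relpowp_Suc_D2 not0_implies_Suc)
  then show ?case using 0 a by simp
next
  case (Suc m)
  then obtain a' where a': "r a a'" "(r ^^ m) a' b" by (meson relpowp_Suc_D2)
  show ?case
  proof (cases n)
    case 0
    then show ?thesis using Suc.prems a' by auto
  next
    case (Suc n')
    then obtain a'' where "r a a''" "(r ^^ n') a'' c" using Suc.prems(2) by (meson relpowp_Suc_D2)
    then show ?thesis using Suc.IH[of a' n'] a' det Suc.prems by blast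
  qed
qed

lemma no_step_final: "fst \<kappa> = final_label N \<Longrightarrow> \<not> gtm_step N \<kappa> \<kappa>'"
  by (cases \<kappa>) (simp add: gtm_step_def)

lemma finite_computation_relpowp:
  assumes "is_computation N (Finite \<kappa>s)"
  shows "(gtm_step N ^^ (length \<kappa>s - 1)) (hd \<kappa>s) (last \<kappa>s)"
proof -
  have "(gtm_step N ^^ i) (\<kappa>s ! 0) (\<kappa>s ! i)" if "i < length \<kappa>s" for i
    using that assms by (induction i) auto
  moreover have "\<kappa>s \<noteq> []" using assms by simp
  ultimately show ?thesis by (simp add: hd_conv_nth last_conv_nth)
qed

lemma gtm_result_run:
  assumes "gtm_result N x y"
  obtains m \<kappa> where "(gtm_step N ^^ m) (initial_config N x) \<kappa>" "accepting_config N \<kappa> y"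
proof -
  obtain c where c: "is_computation N c" "first_config c = initial_config N x" "accepting N c y"
    using assms unfolding gtm_result_def by blast
  then obtain \<kappa>s where "c = Finite \<kappa>s" by (cases c) auto
  then show thesis using c finite_computation_relpowp[of N \<kappa>s] that by auto
qed

lemma accepting_run_unique:
  assumes "(gtm_step N ^^ m) \<kappa>0 \<kappa>" "accepting_config N \<kappa> y"
    and "(gtm_step N ^^ m') \<kappa>0 \<kappa>'" "accepting_config N \<kappa>' y'"
  shows "y = y'"
proof -
  have "\<kappa> = \<kappa>'"
    by (rule relpowp_end_unique[OF gtm_step_det assms(1,3)])
       (use assms no_step_final[of \<kappa> N] no_step_final[of \<kappa>' N] in \<open>simp_all add: accepting_config_def\<close>)
  then show ?thesis using assms by (simp add: accepting_config_def)
qed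

lemma gtm_fun_run:
  assumes "gtm_fun N x = Some y"
  obtains m \<kappa> where "(gtm_step N ^^ m) (initial_config N x) \<kappa>" "accepting_config N \<kappa> y"
proof -
  obtain y0 where y0: "gtm_result N x y0" and y: "y = (THE y. gtm_result N x y)"
    using assms unfolding gtm_fun_def by (auto split: if_splits)
  have "(THE y. gtm_result N x y) = y0"
    using y0 by (rule the_equality) (metis gtm_result_run accepting_run_unique y0)
  then show thesis using gtm_result_run[OF y0] y that by blast
qed

lemma dom_gtm_fun: "dom (gtm_fun N) \<subseteq> (\<Pi>\<^sub>E j\<in>{..<arity N}. cell_set N (Suc j))"
  unfolding gtm_fun_def dom_def by (auto split: if_splits simp del: PiE_iff)

section \<open>Machines with the same control in lockstep\<close>

text \<open>
  Related configurations look the same to the machine except for the values of its functions: only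
  the elements in corresponding cells may differ, and they differ within \<open>R\<close>.
\<close>

definition related :: "('y \<Rightarrow> 'z \<Rightarrow> bool) \<Rightarrow> ('l, 'g, 'y) config \<Rightarrow> ('l, 'g, 'z) config \<Rightarrow> bool" where
  "related R \<kappa> \<kappa>' \<longleftrightarrow> fst \<kappa> = fst \<kappa>' \<and>
     (\<forall>i. snd (snd \<kappa> i) = snd (snd \<kappa>' i) \<and>
        (\<forall>z. rel_sum R (=) (fst (snd \<kappa> i) z) (fst (snd \<kappa>' i) z)))"

fun with_functions ::
  "((nat \<Rightarrow> 'z) \<Rightarrow> 'z option) \<Rightarrow> ((nat \<Rightarrow> 'z) \<Rightarrow> 'a list option) \<Rightarrow>
     ('l, 'g, 'y, 'a) stmt \<Rightarrow> ('l, 'g, 'z, 'a) stmt" where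
  "with_functions f g (GoRight i l) = GoRight i l"
| "with_functions f g (GoLeft i l) = GoLeft i l"
| "with_functions f g (Write i a l) = Write i a l"
| "with_functions f g (IfSymbol i a l l') = IfSymbol i a l l'"
| "with_functions f g (Assign i _ js l) = Assign i f js l"
| "with_functions f g (Test _ js l l') = Test g js l l'"

text \<open>
  A machine with the control of \<open>N\<close> on cells of another kind.  The functions are given by label,
  since different statements of \<open>N\<close> may use different functions.
\<close>

definition replace_functions ::
  "('l \<Rightarrow> (nat \<Rightarrow> 'z) \<Rightarrow> 'z option) \<Rightarrow> ('l \<Rightarrow> (nat \<Rightarrow> 'z) \<Rightarrow> 'a list option) \<Rightarrow>
     ('l, 'g, 'y, 'a) gtm \<Rightarrow> ('l, 'g, 'z, 'a) gtm" where
  "replace_functions F G N =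
     \<lparr>labels = labels N, initial_label = initial_label N, final_label = final_label N,
      gamma = gamma N, blank = blank N, arity = arity N, last_tape = last_tape N,
      cell_set = (\<lambda>_. UNIV), statement = (\<lambda>l. with_functions (F l) (G l) (statement N l))\<rparr>"

lemma replace_functions_simps [simp]:
  "final_label (replace_functions F G N) = final_label N"
  "initial_label (replace_functions F G N) = initial_label N"
  "blank (replace_functions F G N) = blank N"
  "arity (replace_functions F G N) = arity N"
  "statement (replace_functions F G N) l = with_functions (F l) (G l) (statement N l)"
  by (simp_all add: replace_functions_def)

lemma related_mono: "related R \<kappa> \<kappa>' \<Longrightarrow> (\<And>a b. R a b \<Longrightarrow> R' a b) \<Longrightarrow> related R' \<kappa> \<kappa>'"
  unfolding related_def by (blast intro: sum.rel_mono_strong)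

lemma related_cell: "related R (l, T) (l', T') \<Longrightarrow> rel_sum R (=) (cell T i) (cell T' i)"
  by (simp add: related_def cell_def)

lemma related_Inr: "related R (l, T) (l', T') \<Longrightarrow> cell T i = Inr a \<longleftrightarrow> cell T' i = Inr a"
  using related_cell[of R l T l' T' i] by (cases "cell T i"; cases "cell T' i") auto

lemma related_args:
  assumes "related R (l, T) (l', T')" "apply_fun f js T v" "apply_fun f' js T' v'"
  obtains y y' where "y \<in> extensional {..<length js}" "f y = Some v"
    "\<forall>j<length js. cell T (js ! j) = Inl (y j)"
    "\<And>j. j < length js \<Longrightarrow> R (y j) (y' j)" "f' y' = Some v'"
proof -
  from assms obtain y y' where y: "y \<in> extensional {..<length js}"
    "\<forall>j<length js. cell T (js ! j) = Inl (y j)" "f y = Some v"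
    and y': "\<forall>j<length js. cell T' (js ! j) = Inl (y' j)" "f' y' = Some v'"
    unfolding apply_fun_def by blast
  have "R (y j) (y' j)" if "j < length js" for j
    using related_cell[OF assms(1), of "js ! j"] y y' that by simp
  then show thesis using that y y' by blast
qed

text \<open>
  A step looks at a cell only by comparing it with a symbol or by passing it to a function, so it
  suffices that the function which is called respects the relation.  The relation \<open>R'\<close> after the step
  may be coarser than \<open>R\<close>: to know the value with some precision, one needs the arguments with a
  higher one.
\<close>

lemma related_step:
  assumes rel: "related R \<kappa> \<kappa>'"
    and step: "gtm_step N \<kappa> \<kappa>1" and step': "gtm_step (replace_functions F G N) \<kappa>' \<kappa>1'"
    and mono: "\<And>a b. R a b \<Longrightarrow> R' a b"
    and F: "\<And>i f js l y y' v v'. statement N (fst \<kappa>) = Assign i f js l \<Longrightarrow>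
       y \<in> extensional {..<length js} \<Longrightarrow> f y = Some v \<Longrightarrow> \<forall>j<length js. cell (snd \<kappa>) (js ! j) = Inl (y j) \<Longrightarrow>
       (\<And>j. j < length js \<Longrightarrow> R (y j) (y' j)) \<Longrightarrow> F (fst \<kappa>) y' = Some v' \<Longrightarrow> R' v v'"
    and G: "\<And>f js l l' y y' v v'. statement N (fst \<kappa>) = Test f js l l' \<Longrightarrow>
       y \<in> extensional {..<length js} \<Longrightarrow> f y = Some v \<Longrightarrow> \<forall>j<length js. cell (snd \<kappa>) (js ! j) = Inl (y j) \<Longrightarrow>
       (\<And>j. j < length js \<Longrightarrow> R (y j) (y' j)) \<Longrightarrow> G (fst \<kappa>) y' = Some v' \<Longrightarrow> v = v'"
  shows "related R' \<kappa>1 \<kappa>1'"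
proof -
  obtain l T where \<kappa>: "\<kappa> = (l, T)" by (cases \<kappa>)
  obtain T' where \<kappa>': "\<kappa>' = (l, T')" using rel \<kappa> by (cases \<kappa>') (auto simp: related_def)
  note [simp] = \<kappa> \<kappa>'
  have rel': "related R' (l', T) (l', T')" for l'
    using related_mono[OF rel mono] by (simp add: related_def)
  have wr: "related R' (l', write_cell T i c) (l', write_cell T' i c')" if "rel_sum R' (=) c c'" for l' i c c'
    using rel'[of l'] that by (auto simp: related_def write_cell_def)
  have mv: "related R' (l', move_head T i d) (l', move_head T' i d)" for l' i d
    using rel'[of l'] by (auto simp: related_def move_head_def)
  show ?thesis
  proof (cases "statement N l")
    case (Write i a l')
    then show ?thesis using step step' wr[of "Inr a" "Inr a"] by (auto simp: gtm_step_def)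
  next
    case (IfSymbol i a l' l'')
    then show ?thesis using step step' rel' related_Inr[of R l T l T' i a] rel by (auto simp: gtm_step_def)
  next
    case (Assign i f js l')
    then obtain v v' where v: "apply_fun f js T v" "\<kappa>1 = (l', write_cell T i (Inl v))"
      and v': "apply_fun (F l) js T' v'" "\<kappa>1' = (l', write_cell T' i (Inl v'))"
      using step step' by (auto simp: gtm_step_def)
    obtain y y' where "y \<in> extensional {..<length js}" "f y = Some v"
      "\<forall>j<length js. cell T (js ! j) = Inl (y j)"
      "\<And>j. j < length js \<Longrightarrow> R (y j) (y' j)" "F l y' = Some v'"
      by (rule related_args[OF rel[unfolded \<kappa> \<kappa>'] v(1) v'(1)]) blast
    then have "R' v v'"
      using F[of i f js l' y v y' v'] Assign by simp
    then show ?thesis using v v' wr[of "Inl v" "Inl v'"] by simp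
  next
    case (Test f js l' l'')
    have "v = v'" if v: "apply_fun f js T v" and v': "apply_fun (G l) js T' v'" for v v'
    proof -
      obtain y y' where "y \<in> extensional {..<length js}" "f y = Some v"
        "\<forall>j<length js. cell T (js ! j) = Inl (y j)"
        "\<And>j. j < length js \<Longrightarrow> R (y j) (y' j)" "G l y' = Some v'"
        by (rule related_args[OF rel[unfolded \<kappa> \<kappa>'] v v']) blast
      then show ?thesis using G[of f js l' l'' y v y' v'] Test by simp
    qed
    from this[of "[0]" "[1]"] this[of "[1]" "[0]"] show ?thesis
      using step step' rel' Test by (auto simp: gtm_step_def)
  qed (use step step' mv wr in \<open>auto simp: gtm_step_def\<close>)
qed

lemma gtm_step_labels:
  assumes "generalized_TM N" "fst \<kappa> \<in> labels N" "gtm_step N \<kappa> \<kappa>'"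
  shows "fst \<kappa>' \<in> labels N"
proof -
  obtain l T where \<kappa>: "\<kappa> = (l, T)" by (cases \<kappa>)
  then have "wf_stmt N (statement N l)" using assms by (auto simp: generalized_TM_def gtm_step_def)
  then show ?thesis
    using assms(3) \<kappa> by (cases "statement N l") (auto simp: gtm_step_def wf_stmt_def)
qed

lemma run_labels:
  assumes "generalized_TM N" "(gtm_step N ^^ i) (initial_config N x) \<kappa>"
  shows "fst \<kappa> \<in> labels N"
  using assms(2)
proof (induction i arbitrary: \<kappa>)
  case 0
  then show ?case using assms(1) by (auto simp: generalized_TM_def initial_config_def)
next
  case (Suc i)
  then obtain \<kappa>' where "(gtm_step N ^^ i) (initial_config N x) \<kappa>'" "gtm_step N \<kappa>' \<kappa>" by auto
  then show ?case using gtm_step_labels[OF assms(1) Suc.IH] by blast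
qed

text \<open>
  The index \<open>t\<close> ranges over the second computations, and \<open>C k t\<close> says that the \<open>t\<close>-th one has
  precision at least \<open>k\<close>.  For a prescribed precision \<open>n\<close> of the \<open>i\<close>-th configuration, the
  precision \<open>k\<close> is found by going backwards through the given computation: if its last step
  calls a function, it does so for fixed arguments, which are needed with some precision, and this
  precision is prescribed for the configuration before.  The second computation is not claimed to exist, since for nearby inputs
  that follows from other reasons than for words.
\<close>

lemma lockstep:
  fixes N :: "('l, 'g, 'y, 'a::zero_neq_one) gtm"
    and F :: "'t \<Rightarrow> 'l \<Rightarrow> (nat \<Rightarrow> 'z) \<Rightarrow> 'z option"
    and C :: "nat \<Rightarrow> 't \<Rightarrow> bool" and R :: "nat \<Rightarrow> 'y \<Rightarrow> 'z \<Rightarrow> bool"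
  assumes N: "generalized_TM N"
    and C: "\<And>m n t. m \<le> n \<Longrightarrow> C n t \<Longrightarrow> C m t"
    and R: "\<And>m n a b. m \<le> n \<Longrightarrow> R n a b \<Longrightarrow> R m a b"
    and init: "\<And>n. \<exists>k. \<forall>t. C k t \<longrightarrow> (\<forall>j<arity N. R n (x j) (x' t j))"
    and F: "\<And>l i f js l' y v n. l \<in> labels N - {final_label N} \<Longrightarrow> statement N l = Assign i f js l' \<Longrightarrow>
       y \<in> extensional {..<length js} \<Longrightarrow> f y = Some v \<Longrightarrow>
       \<exists>k. \<forall>t y' v'. C k t \<longrightarrow> (\<forall>j<length js. R k (y j) (y' j)) \<longrightarrow> F t l y' = Some v' \<longrightarrow> R n v v'"
    and G: "\<And>l f js l' l'' y v. l \<in> labels N - {final_label N} \<Longrightarrow> statement N l = Test f js l' l'' \<Longrightarrow>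
       y \<in> extensional {..<length js} \<Longrightarrow> f y = Some v \<Longrightarrow>
       \<exists>k. \<forall>t y' v'. C k t \<longrightarrow> (\<forall>j<length js. R k (y j) (y' j)) \<longrightarrow> G t l y' = Some v' \<longrightarrow> v = v'"
    and run: "(gtm_step N ^^ i) (initial_config N x) \<kappa>"
  shows "\<exists>k. \<forall>t \<kappa>'. C k t \<longrightarrow>
     (gtm_step (replace_functions (F t) (G t) N) ^^ i) (initial_config (replace_functions (F t) (G t) N) (x' t)) \<kappa>' \<longrightarrow>
     related (R n) \<kappa> \<kappa>'"
  using run
proof (induction i arbitrary: n \<kappa>)
  case 0
  obtain k where "\<forall>t. C k t \<longrightarrow> (\<forall>j<arity N. R n (x j) (x' t j))" using init by blast
  then show ?case using 0
    by (intro exI[of _ k]) (auto simp: initial_config_def related_def)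
next
  case (Suc i)
  then obtain \<kappa>0 where run0: "(gtm_step N ^^ i) (initial_config N x) \<kappa>0" and step: "gtm_step N \<kappa>0 \<kappa>" by auto
  have l: "fst \<kappa>0 \<in> labels N - {final_label N}"
    using run_labels[OF N run0] no_step_final[of \<kappa>0 N] step by blast
  obtain l0 T0 where \<kappa>0: "\<kappa>0 = (l0, T0)" by (cases \<kappa>0)
  \<comment> \<open>the precision that the function called in this step demands of its arguments\<close>
  have "\<exists>k. case statement N l0 of
       Assign i f js l' \<Rightarrow> \<forall>t y y' v v'. C k t \<longrightarrow> (\<forall>j<length js. R k (y j) (y' j)) \<longrightarrow>
         y \<in> extensional {..<length js} \<longrightarrow> f y = Some v \<longrightarrow>
         (\<forall>j<length js. cell T0 (js ! j) = Inl (y j)) \<longrightarrow> F t l0 y' = Some v' \<longrightarrow> R n v v'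
     | Test f js l' l'' \<Rightarrow> \<forall>t y y' v v'. C k t \<longrightarrow> (\<forall>j<length js. R k (y j) (y' j)) \<longrightarrow>
         y \<in> extensional {..<length js} \<longrightarrow> f y = Some v \<longrightarrow>
         (\<forall>j<length js. cell T0 (js ! j) = Inl (y j)) \<longrightarrow> G t l0 y' = Some v' \<longrightarrow> v = v'
     | _ \<Rightarrow> True" (is "\<exists>k. ?P k")
  proof (cases "statement N l0")
    case (Assign i f js l')
    then obtain y v where y: "y \<in> extensional {..<length js}" "f y = Some v"
      "\<forall>j<length js. cell T0 (js ! j) = Inl (y j)"
      using step \<kappa>0 by (auto simp: gtm_step_def apply_fun_def)
    have u: "z = y" if "z \<in> extensional {..<length js}" "\<forall>j<length js. cell T0 (js ! j) = Inl (z j)" for z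
      by (rule extensionalityI[OF that(1) y(1)]) (use that(2) y(3) in auto)
    from F[of l0 i f js l' y v n] obtain k where
      "\<forall>t y' v'. C k t \<longrightarrow> (\<forall>j<length js. R k (y j) (y' j)) \<longrightarrow> F t l0 y' = Some v' \<longrightarrow> R n v v'"
      using l \<kappa>0 Assign y by auto
    then have k: "C k t \<Longrightarrow> (\<And>j. j < length js \<Longrightarrow> R k (z j) (y' j)) \<Longrightarrow> z \<in> extensional {..<length js} \<Longrightarrow>
        \<forall>j<length js. cell T0 (js ! j) = Inl (z j) \<Longrightarrow> f z = Some w \<Longrightarrow> F t l0 y' = Some v' \<Longrightarrow> R n w v'" for t z w y' v'
      using u[of z] y(2) by simp blast
    show ?thesis
      by (rule exI[of _ k]) (unfold Assign stmt.case, intro allI impI, rule k, auto)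
  next
    case (Test f js l' l'')
    then obtain y v where y: "y \<in> extensional {..<length js}" "f y = Some v"
      "\<forall>j<length js. cell T0 (js ! j) = Inl (y j)"
      using step \<kappa>0 by (auto simp: gtm_step_def apply_fun_def)
    have u: "z = y" if "z \<in> extensional {..<length js}" "\<forall>j<length js. cell T0 (js ! j) = Inl (z j)" for z
      by (rule extensionalityI[OF that(1) y(1)]) (use that(2) y(3) in auto)
    from G[of l0 f js l' l'' y v] obtain k where
      "\<forall>t y' v'. C k t \<longrightarrow> (\<forall>j<length js. R k (y j) (y' j)) \<longrightarrow> G t l0 y' = Some v' \<longrightarrow> v = v'"
      using l \<kappa>0 Test y by auto
    then have k: "C k t \<Longrightarrow> (\<And>j. j < length js \<Longrightarrow> R k (z j) (y' j)) \<Longrightarrow> z \<in> extensional {..<length js} \<Longrightarrow>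
        \<forall>j<length js. cell T0 (js ! j) = Inl (z j) \<Longrightarrow> f z = Some w \<Longrightarrow> G t l0 y' = Some v' \<Longrightarrow> w = v'" for t z w y' v'
      using u[of z] y(2) by simp blast
    show ?thesis
      by (rule exI[of _ k]) (unfold Test stmt.case, intro allI impI, rule k, auto)
  qed auto
  then obtain k1 where k1: "?P k1" by blast
  obtain k2 where k2: "\<And>t \<kappa>'. C k2 t \<Longrightarrow>
     (gtm_step (replace_functions (F t) (G t) N) ^^ i) (initial_config (replace_functions (F t) (G t) N) (x' t)) \<kappa>' \<Longrightarrow>
     related (R (max k1 n)) \<kappa>0 \<kappa>'" using Suc.IH[OF run0, of "max k1 n"] by blast
  show ?case
  proof (intro exI[of _ "max k1 k2"] allI impI)
    fix t \<kappa>' assume c: "C (max k1 k2) t" and "(gtm_step (replace_functions (F t) (G t) N) ^^ Suc i)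
      (initial_config (replace_functions (F t) (G t) N) (x' t)) \<kappa>'"
    then obtain \<kappa>0' where run0': "(gtm_step (replace_functions (F t) (G t) N) ^^ i)
      (initial_config (replace_functions (F t) (G t) N) (x' t)) \<kappa>0'"
      and step': "gtm_step (replace_functions (F t) (G t) N) \<kappa>0' \<kappa>'" by auto
    have c12: "C k1 t" "C k2 t" using C[OF _ c, of k1] C[OF _ c, of k2] by simp_all
    show "related (R n) \<kappa> \<kappa>'"
    proof (rule related_step[OF k2[OF c12(2) run0'] step step'])
      show "R n a b" if "R (max k1 n) a b" for a b using R[OF _ that] by simp
    next
      fix i f js l' y y' v v'
      assume a: "statement N (fst \<kappa>0) = Assign i f js l'" "y \<in> extensional {..<length js}" "f y = Some v"
        "\<forall>j<length js. cell (snd \<kappa>0) (js ! j) = Inl (y j)"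
        "\<And>j. j < length js \<Longrightarrow> R (max k1 n) (y j) (y' j)" "F t (fst \<kappa>0) y' = Some v'"
      have "R k1 (y j) (y' j)" if "j < length js" for j using R[OF _ a(5)[OF that]] by simp
      then show "R n v v'" using k1 a c12(1) \<kappa>0 by simp blast
    next
      fix f js l' l'' y y' v v'
      assume a: "statement N (fst \<kappa>0) = Test f js l' l''" "y \<in> extensional {..<length js}" "f y = Some v"
        "\<forall>j<length js. cell (snd \<kappa>0) (js ! j) = Inl (y j)"
        "\<And>j. j < length js \<Longrightarrow> R (max k1 n) (y j) (y' j)" "G t (fst \<kappa>0) y' = Some v'"
      have "R k1 (y j) (y' j)" if "j < length js" for j using R[OF _ a(5)[OF that]] by simp
      then show "v = v'" using k1 a c12(1) \<kappa>0 by simp blast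
    qed
  qed
qed

section \<open>Continuity\<close>

definition agree :: "nat \<Rightarrow> 'a word \<Rightarrow> 'a word \<Rightarrow> bool" where
  "agree m p q \<longleftrightarrow> (\<forall>i<m. p i = q i)"

lemma agree_antimono: "m \<le> n \<Longrightarrow> agree n p q \<Longrightarrow> agree m p q"
  by (simp add: agree_def)

lemma topspace_cantor [simp]: "topspace cantor_topology = (UNIV :: 'a word set)"
proof -
  have "(UNIV :: 'a word set) \<in> {{u \<frown> p | p. True} | u. True}"
    by (rule CollectI, rule exI[of _ "[]"]) auto
  then show ?thesis by (auto simp: cantor_topology_def)
qed

lemma openin_cantor_iff:
  "openin cantor_topology U \<longleftrightarrow> (\<forall>p\<in>U. \<exists>m. \<forall>q. agree m p q \<longrightarrow> q \<in> U)"
proof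
  assume "openin cantor_topology U"
  then have "generate_topology_on {{u \<frown> p | p. True} | u. True} U"
    by (simp add: cantor_topology_def openin_topology_generated_by_iff)
  then show "\<forall>p\<in>U. \<exists>m. \<forall>q. agree m p q \<longrightarrow> q \<in> U"
  proof induction
    case (Int A B)
    show ?case
    proof
      fix p assume "p \<in> A \<inter> B"
      then obtain m n where "\<forall>q. agree m p q \<longrightarrow> q \<in> A" "\<forall>q. agree n p q \<longrightarrow> q \<in> B"
        using Int.IH by blast
      then show "\<exists>m. \<forall>q. agree m p q \<longrightarrow> q \<in> A \<inter> B"
        by (intro exI[of _ "max m n"]) (auto simp: agree_def)
    qed
  next
    case (UN K)
    then show ?case by blast
  next
    case (Basis s)
    then obtain u where s: "s = {u \<frown> p | p. True}" by blast
    show ?case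
    proof
      fix p assume p: "p \<in> s"
      have "q \<in> s" if q: "agree (length u) p q" for q
      proof -
        have "q = u \<frown> (\<lambda>i. q (i + length u))"
          using p q by (auto simp: s conc_def agree_def fun_eq_iff)
        then show ?thesis using s by blast
      qed
      then show "\<exists>m. \<forall>q. agree m p q \<longrightarrow> q \<in> s" by blast
    qed
  qed simp
next
  assume *: "\<forall>p\<in>U. \<exists>m. \<forall>q. agree m p q \<longrightarrow> q \<in> U"
  show "openin cantor_topology U"
    unfolding openin_subopen[of _ U]
  proof
    fix p assume "p \<in> U"
    then obtain m where m: "\<forall>q. agree m p q \<longrightarrow> q \<in> U" using * by blast
    let ?T = "{map p [0..<m] \<frown> q | q. True}"
    have "openin cantor_topology ?T"
      unfolding cantor_topology_def by (rule topology_generated_by_Basis) blast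
    moreover have "p = map p [0..<m] \<frown> (\<lambda>i. p (i + m))"
      by (auto simp: conc_def fun_eq_iff)
    then have "p \<in> ?T" by blast
    moreover have "?T \<subseteq> U" using m by (auto simp: conc_def agree_def)
    ultimately show "\<exists>T. openin cantor_topology T \<and> p \<in> T \<and> T \<subseteq> U" by blast
  qed
qed

lemma openin_agree: "openin cantor_topology {q. agree m p q}"
  unfolding openin_cantor_iff by (auto simp: agree_def intro!: exI[of _ m])

text \<open>
  Since the product has finitely many factors, one prefix length can be chosen for all of them.
\<close>

lemma continuous_pfunD:
  fixes f :: "(nat \<Rightarrow> 'a word) \<Rightarrow> 'b option"
  assumes f: "continuous_pfun n T f" "dom f \<subseteq> (\<Pi>\<^sub>E j\<in>{..<n}. UNIV)"
    and x: "f x = Some v" and U: "openin T U" "v \<in> U"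
  shows "\<exists>m. \<forall>x' v'. (\<forall>j<n. agree m (x j) (x' j)) \<longrightarrow> f x' = Some v' \<longrightarrow> v' \<in> U"
proof -
  let ?P = "product_topology (\<lambda>_. cantor_topology) {..<n} :: (nat \<Rightarrow> 'a word) topology"
  have ts: "topspace (subtopology ?P (dom f)) = dom f" using f(2) by auto
  have "openin (subtopology ?P (dom f)) {z \<in> topspace (subtopology ?P (dom f)). the (f z) \<in> U}"
    using f(1) U(1) unfolding continuous_pfun_def by (rule openin_continuous_map_preimage)
  then obtain V where V: "openin ?P V" "{z \<in> dom f. the (f z) \<in> U} = V \<inter> dom f"
    unfolding ts by (auto simp: openin_subtopology)
  have "x \<in> V" using V(2) x U(2) by auto
  then obtain W where W: "\<forall>i\<in>{..<n}. openin cantor_topology (W i)" "x \<in> Pi\<^sub>E {..<n} W" "Pi\<^sub>E {..<n} W \<subseteq> V"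
    using V(1) unfolding openin_product_topology_alt by blast
  have "\<forall>j\<in>{..<n}. \<exists>m. \<forall>q. agree m (x j) q \<longrightarrow> q \<in> W j"
    using W(1,2) unfolding openin_cantor_iff by (auto simp: PiE_iff)
  then obtain m where m: "\<And>j q. j < n \<Longrightarrow> agree (m j) (x j) q \<Longrightarrow> q \<in> W j"
    by (auto simp: Ball_def) metis
  show ?thesis
  proof (intro exI[of _ "Max (insert 0 (m ` {..<n}))"] allI impI)
    fix x' v' assume c: "\<forall>j<n. agree (Max (insert 0 (m ` {..<n}))) (x j) (x' j)" and v': "f x' = Some v'"
    have "x' j \<in> W j" if "j < n" for j
      by (rule m[OF that], rule agree_antimono[of _ "Max (insert 0 (m ` {..<n}))"], rule Max_ge) (use that c in auto)
    moreover have "x' \<in> extensional {..<n}" using f(2) v' by (auto simp: PiE_def)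
    ultimately have "x' \<in> V" using W(3) by (auto simp: PiE_def)
    then have "x' \<in> {z \<in> dom f. the (f z) \<in> U}" using V(2) v' by auto
    then show "v' \<in> U" using v' by simp
  qed
qed

lemma continuous_pfunI:
  fixes f :: "(nat \<Rightarrow> 'a word) \<Rightarrow> 'b word option"
  assumes dom: "dom f \<subseteq> (\<Pi>\<^sub>E j\<in>{..<n}. UNIV)"
    and c: "\<And>x v k. f x = Some v \<Longrightarrow>
      \<exists>m. \<forall>x' v'. (\<forall>j<n. agree m (x j) (x' j)) \<longrightarrow> f x' = Some v' \<longrightarrow> agree k v v'"
  shows "continuous_pfun n cantor_topology f"
proof -
  let ?P = "product_topology (\<lambda>_. cantor_topology) {..<n} :: (nat \<Rightarrow> 'a word) topology"
  have ts: "topspace (subtopology ?P (dom f)) = dom f" using dom by auto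
  have "openin (subtopology ?P (dom f)) {x \<in> dom f. the (f x) \<in> U}" if U: "openin cantor_topology U" for U
    unfolding openin_subopen[of _ "{x \<in> dom f. the (f x) \<in> U}"]
  proof
    fix x assume "x \<in> {x \<in> dom f. the (f x) \<in> U}"
    then obtain v where v: "f x = Some v" "v \<in> U" by auto
    obtain k where k: "\<forall>q. agree k v q \<longrightarrow> q \<in> U" using U v(2) unfolding openin_cantor_iff by blast
    obtain m where m: "\<forall>x' v'. (\<forall>j<n. agree m (x j) (x' j)) \<longrightarrow> f x' = Some v' \<longrightarrow> agree k v v'"
      using c[OF v(1)] by blast
    let ?V = "\<Pi>\<^sub>E j\<in>{..<n}. {q. agree m (x j) q}"
    have V: "openin ?P ?V"
      by (subst openin_PiE) (simp_all add: openin_agree)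
    have "x \<in> ?V" using dom v(1) by (auto simp: PiE_def agree_def)
    moreover have "?V \<inter> dom f \<subseteq> {x \<in> dom f. the (f x) \<in> U}"
      using m k by (auto simp: PiE_def Pi_def)
    ultimately show "\<exists>T. openin (subtopology ?P (dom f)) T \<and> x \<in> T \<and> T \<subseteq> {x \<in> dom f. the (f x) \<in> U}"
      using V v(1) by (intro exI[of _ "?V \<inter> dom f"]) (auto simp: openin_subtopology)
  qed
  then show ?thesis unfolding continuous_pfun_def continuous_map_def ts by simp
qed

lemma args_set_UNIV:
  assumes "\<forall>i \<le> last_tape N. cell_set N i = UNIV" "set js \<subseteq> {..last_tape N}"
  shows "args_set N js = (\<Pi>\<^sub>E j\<in>{..<length js}. UNIV)"
  unfolding args_set_def
proof (rule PiE_cong)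
  fix j assume "j \<in> {..<length js}"
  then have "js ! j \<in> {..last_tape N}" using assms(2) nth_mem by blast
  then show "cell_set N (js ! j) = UNIV" using assms(1) by simp
qed

definition assign_fun :: "('l, 'g, 'y, 'a) stmt \<Rightarrow> (nat \<Rightarrow> 'y) \<Rightarrow> 'y option" where
  "assign_fun s = (case s of Assign i f js l \<Rightarrow> f | _ \<Rightarrow> Map.empty)"

definition test_fun :: "('l, 'g, 'y, 'a) stmt \<Rightarrow> (nat \<Rightarrow> 'y) \<Rightarrow> 'a list option" where
  "test_fun s = (case s of Test f js l l' \<Rightarrow> f | _ \<Rightarrow> Map.empty)"

text \<open>
  With its own functions put back a machine is unchanged, so it can play both roles in \<open>lockstep\<close>.
\<close>

lemma with_functions_self: "with_functions (assign_fun s) (test_fun s) s = s"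
  by (cases s) (simp_all add: assign_fun_def test_fun_def)

lemma relpowp_initial_segment:
  assumes "(r ^^ m) a b" "i \<le> m"
  obtains c where "(r ^^ i) a c" "i < m \<Longrightarrow> \<exists>d. r c d" "i = m \<Longrightarrow> c = b"
proof (cases "i = m")
  case False
  then obtain d where "m = i + Suc d" using assms(2) less_iff_Suc_add[of i m] by auto
  then have "(r ^^ i OO r ^^ Suc d) a b" using assms(1) by (simp only: relpowp_add)
  then show thesis using that False by (metis relcomppE relpowp_Suc_D2)
qed (use assms that in auto)

text \<open>
  The computation for a nearby input might end earlier or later than the one for \<open>x\<close>.  This is
  excluded by choosing one precision for all initial segments of the latter: as long as both go
  on they have the same label, and the label is final exactly at the end of a computation with a
  result.
\<close>

theorem gtm_fun_continuous:
  fixes N :: "('l, 'g, 'a::{finite, zero_neq_one} word, 'a) gtm"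
  assumes N: "generalized_TM N" and UN: "\<forall>i \<le> last_tape N. cell_set N i = UNIV"
    and fs: "all_functions N (\<lambda>n. continuous_pfun n cantor_topology)
                          (\<lambda>n. continuous_pfun n (discrete_topology UNIV))"
  shows "continuous_pfun (arity N) cantor_topology (gtm_fun N)"
proof (rule continuous_pfunI)
  have "arity N \<le> last_tape N" using N by (simp add: generalized_TM_def)
  then have "(\<Pi>\<^sub>E j\<in>{..<arity N}. cell_set N (Suc j)) = (\<Pi>\<^sub>E j\<in>{..<arity N}. UNIV)"
    using UN by (intro PiE_cong) auto
  then show "dom (gtm_fun N) \<subseteq> (\<Pi>\<^sub>E j\<in>{..<arity N}. UNIV)" using dom_gtm_fun[of N] by simp
next
  fix x v k assume v: "gtm_fun N x = Some v"
  obtain m \<kappa> where run: "(gtm_step N ^^ m) (initial_config N x) \<kappa>" and acc: "accepting_config N \<kappa> v"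
    using gtm_fun_run[OF v] .
  define F G where "F = (\<lambda>l. assign_fun (statement N l))" and "G = (\<lambda>l. test_fun (statement N l))"
  let ?N = "replace_functions F G N"
  have N': "gtm_step ?N = gtm_step N" "initial_config ?N = initial_config N"
    by (intro ext; simp add: gtm_step_def initial_config_def F_def G_def with_functions_self)+
  let ?C = "\<lambda>k x'. (\<forall>j<arity N. agree k (x j) (x' j)) "
  have "\<exists>k'. \<forall>x' \<kappa>'. ?C k' x' \<longrightarrow> (gtm_step ?N ^^ i) (initial_config ?N x') \<kappa>' \<longrightarrow> related (agree k) \<kappa>i \<kappa>'"
    if run: "(gtm_step N ^^ i) (initial_config N x) \<kappa>i" for i \<kappa>i
  proof (rule lockstep[where C = ?C and x' = "\<lambda>x. x", OF N _ _ _ _ _ run])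
    fix l i f js l' y v n
    assume l: "l \<in> labels N - {final_label N}" and st: "statement N l = Assign i f js l'" and y: "f y = Some v"
    have wf: "wf_stmt N (statement N l)" using N l by (simp add: generalized_TM_def)
    have c: "continuous_pfun (length js) cantor_topology f" using bspec[OF fs[unfolded all_functions_def] l] st by simp
    obtain k where "\<forall>y' v'. (\<forall>j<length js. agree k (y j) (y' j)) \<longrightarrow> f y' = Some v' \<longrightarrow> v' \<in> {q. agree n v q}"
      using continuous_pfunD[OF c _ y openin_agree[of n v]] wf args_set_UNIV[OF UN] st
      by (auto simp: wf_stmt_def agree_def)
    then show "\<exists>k. \<forall>x' y' v'. ?C k x' \<longrightarrow> (\<forall>j<length js. agree k (y j) (y' j)) \<longrightarrow> F l y' = Some v' \<longrightarrow> agree n v v'"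
      by (intro exI[of _ k]) (auto simp: F_def assign_fun_def st)
  next
    fix l f js l' l'' y v
    assume l: "l \<in> labels N - {final_label N}" and st: "statement N l = Test f js l' l''" and y: "f y = Some v"
    have wf: "wf_stmt N (statement N l)" using N l by (simp add: generalized_TM_def)
    have c: "continuous_pfun (length js) (discrete_topology UNIV) f" using bspec[OF fs[unfolded all_functions_def] l] st by simp
    obtain k where "\<forall>y' v'. (\<forall>j<length js. agree k (y j) (y' j)) \<longrightarrow> f y' = Some v' \<longrightarrow> v' \<in> {v}"
      using continuous_pfunD[OF c _ y, of "{v}"] wf args_set_UNIV[OF UN] st
      by (auto simp: wf_stmt_def)
    then show "\<exists>k. \<forall>x' y' v'. ?C k x' \<longrightarrow> (\<forall>j<length js. agree k (y j) (y' j)) \<longrightarrow> G l y' = Some v' \<longrightarrow> v = v'"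
      by (intro exI[of _ k]) (auto simp: G_def test_fun_def st)
  qed (auto intro: agree_antimono)
  note step_continuous = this[unfolded N']
  have "\<exists>k'. \<forall>x' \<kappa>'. ?C k' x' \<longrightarrow> (gtm_step N ^^ i) (initial_config N x') \<kappa>' \<longrightarrow>
      (\<exists>\<kappa>i. related (agree k) \<kappa>i \<kappa>' \<and> (i < m \<longrightarrow> fst \<kappa>i \<noteq> final_label N) \<and> (i = m \<longrightarrow> \<kappa>i = \<kappa>))"
    (is "\<exists>k'. ?Q i k'") if i: "i \<le> m" for i
  proof -
    obtain \<kappa>i where \<kappa>i: "(gtm_step N ^^ i) (initial_config N x) \<kappa>i" "i < m \<Longrightarrow> \<exists>d. gtm_step N \<kappa>i d" "i = m \<Longrightarrow> \<kappa>i = \<kappa>"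
      by (rule relpowp_initial_segment[OF run i]) blast
    obtain k' where "\<forall>x' \<kappa>'. ?C k' x' \<longrightarrow> (gtm_step N ^^ i) (initial_config N x') \<kappa>' \<longrightarrow> related (agree k) \<kappa>i \<kappa>'"
      using step_continuous[OF \<kappa>i(1)] by blast
    moreover have "i < m \<longrightarrow> fst \<kappa>i \<noteq> final_label N" using \<kappa>i(2) no_step_final by blast
    ultimately show ?thesis using \<kappa>i(3) by blast
  qed
  then have "\<forall>i\<in>{..m}. \<exists>k'. ?Q i k'" by blast
  from bchoice[OF this] obtain K where K0: "\<forall>i\<in>{..m}. ?Q i (K i)" ..
  have K: "\<exists>\<kappa>i. related (agree k) \<kappa>i \<kappa>' \<and> (i < m \<longrightarrow> fst \<kappa>i \<noteq> final_label N) \<and> (i = m \<longrightarrow> \<kappa>i = \<kappa>)"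
    if "i \<le> m" "?C (K i) x'" "(gtm_step N ^^ i) (initial_config N x') \<kappa>'" for i x' \<kappa>'
    by (rule K0[THEN bspec, of i, THEN spec, THEN spec, THEN mp, THEN mp]) (use that in auto)
  show "\<exists>m. \<forall>x' v'. (\<forall>j<arity N. agree m (x j) (x' j)) \<longrightarrow> gtm_fun N x' = Some v' \<longrightarrow> agree k v v'"
  proof (intro exI allI impI)
    fix x' v' assume c: "?C (Max (K ` {..m})) x'" and v': "gtm_fun N x' = Some v'"
    have c': "?C (K i) x'" if "i \<le> m" for i
    proof -
      have "K i \<le> Max (K ` {..m})" using that by simp
      then show ?thesis using c agree_antimono by blast
    qed
    obtain m' \<kappa>' where run': "(gtm_step N ^^ m') (initial_config N x') \<kappa>'" and acc': "accepting_config N \<kappa>' v'"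
      using gtm_fun_run[OF v'] .
    have "m' = m"
    proof (rule linorder_cases[of m' m])
      assume "m' < m"
      then obtain \<kappa>i where "related (agree k) \<kappa>i \<kappa>'" "fst \<kappa>i \<noteq> final_label N"
        using K[OF less_imp_le c'[OF less_imp_le] run'] by blast
      then show ?thesis using acc' by (simp add: related_def accepting_config_def)
    next
      assume "m < m'"
      then obtain \<kappa>1 \<kappa>2 where "(gtm_step N ^^ m) (initial_config N x') \<kappa>1" "gtm_step N \<kappa>1 \<kappa>2"
        by (metis relpowp_initial_segment[OF run' less_imp_le])
      moreover have "related (agree k) \<kappa> \<kappa>1"
        using K[OF order_refl c'[OF order_refl]] \<open>(gtm_step N ^^ m) (initial_config N x') \<kappa>1\<close> by blast
      ultimately show ?thesis
        using acc no_step_final[of \<kappa>1 N \<kappa>2] by (simp add: related_def accepting_config_def)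
    qed
    then have "related (agree k) \<kappa> \<kappa>'" using K[OF order_refl c' ] run' by blast
    then have "rel_sum (agree k) (=) (fst (snd \<kappa> 0) 0) (fst (snd \<kappa>' 0) 0)" by (simp add: related_def)
    then show "agree k v v'" using acc acc' by (simp add: accepting_config_def)
  qed
qed

section \<open>Truncated runs on finite words\<close>

text \<open>
  The padding is a default: a run is suspended before it could read it.
\<close>

definition padded :: "(nat \<Rightarrow> 'a list) \<Rightarrow> nat \<Rightarrow> 'a::zero word" where
  "padded w j = (\<lambda>i. if i < length (w j) then w j ! i else 0)"

text \<open>
  There is no next step, or it would have to read a symbol that the words do not provide.
\<close>

definition suspended :: "'a t2m \<Rightarrow> (nat \<Rightarrow> 'a list) \<Rightarrow> 'a t2conf \<Rightarrow> bool" where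
  "suspended M w c \<longleftrightarrow> c_state c = t2_halt M \<or> (\<exists>j<t2_inputs M. int (length (w j)) \<le> c_heads c ! j)"

primrec trunc_run :: "'a::zero t2m \<Rightarrow> (nat \<Rightarrow> 'a list) \<Rightarrow> nat \<Rightarrow> 'a t2conf \<Rightarrow> 'a t2conf" where
  "trunc_run M w 0 c = c"
| "trunc_run M w (Suc t) c = (if suspended M w c then c else trunc_run M w t (t2_step M (padded w) c))"

definition approximates :: "nat \<Rightarrow> 'a word \<Rightarrow> 'a list \<Rightarrow> bool" where
  "approximates n p w \<longleftrightarrow> n \<le> length w \<and> (\<forall>i<length w. w ! i = p i)"

lemma approximates_antimono: "m \<le> n \<Longrightarrow> approximates n p w \<Longrightarrow> approximates m p w"
  by (auto simp: approximates_def)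

lemma approximates_output:
  assumes "t2_outputs_seq M x q" "n \<le> length (c_output (t2_run M x t))"
  shows "approximates n q (c_output (t2_run M x t))"
proof -
  have "c_output (t2_run M x t) = map q [0..<length (c_output (t2_run M x t))]"
    using assms(1) unfolding t2_outputs_seq_def by blast
  then have "c_output (t2_run M x t) ! i = q i" if "i < length (c_output (t2_run M x t))" for i
    using that by (metis add_0 nth_map_upt diff_zero)
  then show ?thesis using assms(2) by (simp add: approximates_def)
qed

lemma step_padded:
  assumes "\<not> suspended M w c" "\<And>j. j < t2_inputs M \<Longrightarrow> approximates 0 (x j) (w j)"
  shows "t2_step M (padded w) c = t2_step M x c"
proof -
  have "input_cell (padded w j) (c_heads c ! j) = input_cell (x j) (c_heads c ! j)" if "j < t2_inputs M" for j
  proof -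
    have "nat (c_heads c ! j) < length (w j)" if "0 \<le> c_heads c ! j"
      using assms(1) that \<open>j < t2_inputs M\<close> by (auto simp: suspended_def not_le nat_less_iff)
    then show ?thesis
      using assms(2)[OF that] by (auto simp: input_cell_def padded_def approximates_def)
  qed
  then have "map (\<lambda>j. input_cell (padded w j) (c_heads c ! j)) [0..<t2_inputs M] =
      map (\<lambda>j. input_cell (x j) (c_heads c ! j)) [0..<t2_inputs M]" by simp
  then show ?thesis unfolding t2_step_def by (simp only:)
qed

text \<open>
  A truncated run is an initial part of the run on the sequences themselves.  It is cut off before
  time \<open>min n t\<close> only by halting, because a head reaches position \<open>n\<close> at time \<open>n\<close> at the earliest;
  and after halting all later configurations are the same, so \<open>s\<close> can be taken large.
\<close>

lemma trunc_run_correct: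
  assumes M: "type2_machine M" and a: "\<And>j. j < t2_inputs M \<Longrightarrow> approximates n (x j) (w j)"
  shows "\<exists>s\<ge>min n t. trunc_run M w t (t2_initial M) = t2_run M x s"
proof -
  have "\<exists>s'\<ge>min n (s + t). trunc_run M w t (t2_run M x s) = t2_run M x s'" for s
  proof (induction t arbitrary: s)
    case 0
    then show ?case by (intro exI[of _ s]) simp
  next
    case (Suc t)
    show ?case
    proof (cases "suspended M w (t2_run M x s)")
      case True
      show ?thesis
      proof (cases "c_state (t2_run M x s) = t2_halt M")
        case h: True
        show ?thesis
          using True t2_run_halted[OF h, of "s + n"] by (intro exI[of _ "s + n"]) auto
      next
        case False
        then obtain j where j: "j < t2_inputs M" "int (length (w j)) \<le> c_heads (t2_run M x s) ! j"
          using True by (auto simp: suspended_def)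
        then have "n \<le> s" using heads_le_time[OF M j(1), of x s] a[OF j(1)] by (simp add: approximates_def)
        then show ?thesis using True by (intro exI[of _ s]) auto
      qed
    next
      case False
      have "t2_step M (padded w) (t2_run M x s) = t2_run M x (Suc s)"
        using step_padded[OF False, of x] approximates_antimono[OF le0 a] by (simp add: t2_run_Suc)
      then show ?thesis using Suc.IH[of "Suc s"] False by simp
    qed
  qed
  from this[of 0] show ?thesis by (simp add: t2_run_def)
qed

definition trunc_assign :: "'a::zero t2m \<Rightarrow> nat \<Rightarrow> (nat \<Rightarrow> 'a list) \<Rightarrow> 'a list option" where
  "trunc_assign M t w = Some (c_output (trunc_run M w t (t2_initial M)))"

text \<open>
  A test is decided by the last symbol of the output, which a stack holding the output has on top.
  On the outputs \<open>[0]\<close> and \<open>[1]\<close> this is the same as comparing the whole word.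
\<close>

definition trunc_test :: "'a::zero_neq_one t2m \<Rightarrow> nat \<Rightarrow> (nat \<Rightarrow> 'a list) \<Rightarrow> 'a list option" where
  "trunc_test M t w =
     (let c = trunc_run M w t (t2_initial M) in
      if c_state c = t2_halt M \<and> c_output c \<noteq> [] \<and> last (c_output c) \<in> {0, 1}
      then Some [last (c_output c)] else None)"

text \<open>
  If the machine has produced \<open>n\<close> symbols by time \<open>s\<close>, then prefixes of length \<open>s\<close> of the arguments
  and \<open>s\<close> steps are enough.
\<close>

lemma trunc_assign_approximates:
  assumes M: "type2_machine M" and out: "t2_outputs_seq M y v"
  shows "\<exists>k. \<forall>t w v'. k \<le> t \<longrightarrow> (\<forall>j<t2_inputs M. approximates k (y j) (w j)) \<longrightarrow>
     trunc_assign M t w = Some v' \<longrightarrow> approximates n v v'"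
proof -
  obtain s where s: "n \<le> length (c_output (t2_run M y s))" using out unfolding t2_outputs_seq_def by blast
  show ?thesis
  proof (intro exI[of _ s] allI impI)
    fix t w v' assume t: "s \<le> t" and w: "\<forall>j<t2_inputs M. approximates s (y j) (w j)"
      and v': "trunc_assign M t w = Some v'"
    obtain s' where s': "s' \<ge> min s t" "trunc_run M w t (t2_initial M) = t2_run M y s'"
      using trunc_run_correct[OF M, of s y w t] w by blast
    obtain u where "c_output (t2_run M y s') = c_output (t2_run M y s) @ u"
      using t2_run_output_mono[of M y s "s' - s"] s' t by auto
    then have "n \<le> length (c_output (t2_run M y s'))" using s by simp
    then show "approximates n v v'"
      using v' s' approximates_output[OF out, of n s'] by (simp add: trunc_assign_def)
  qed
qed

lemma trunc_assign_sound:
  assumes M: "type2_machine M" and out: "t2_outputs_seq M y v"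
    and "\<forall>j<t2_inputs M. approximates 0 (y j) (w j)" "trunc_assign M t w = Some v'"
  shows "approximates 0 v v'"
proof -
  obtain s' where s': "trunc_run M w t (t2_initial M) = t2_run M y s'"
    using trunc_run_correct[OF M, of 0 y w t] assms(3) by blast
  then show ?thesis using assms(4) approximates_output[OF out, of 0 s'] by (simp add: trunc_assign_def)
qed

text \<open>
  Any two halted configurations in one run are equal.
\<close>

lemma trunc_test_sound:
  assumes M: "type2_machine M" and out: "t2_outputs_word M y v" and v: "v \<in> {[0], [1]}"
    and w: "\<forall>j<t2_inputs M. approximates 0 (y j) (w j)" "trunc_test M t w = Some v'"
  shows "v = v'"
proof -
  obtain s' where s': "trunc_run M w t (t2_initial M) = t2_run M y s'"
    using trunc_run_correct[OF M, of 0 y w t] w by blast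
  obtain s where s: "c_state (t2_run M y s) = t2_halt M" "c_output (t2_run M y s) = v"
    using out by (auto simp: t2_outputs_word_def)
  have h: "c_state (t2_run M y s') = t2_halt M" "v' = [last (c_output (t2_run M y s'))]"
    using w(2) s' by (auto simp: trunc_test_def Let_def split: if_splits)
  have "t2_run M y s' = t2_run M y s"
    using t2_run_halted[OF s(1), of s'] t2_run_halted[OF h(1), of s] by (cases "s \<le> s'") auto
  then show ?thesis using h s v by auto
qed

lemma trunc_test_decides:
  assumes M: "type2_machine M" and out: "t2_outputs_word M y v" and v: "v \<in> {[0], [1]}"
  shows "\<exists>k. \<forall>t w. k \<le> t \<longrightarrow> (\<forall>j<t2_inputs M. approximates k (y j) (w j)) \<longrightarrow> trunc_test M t w = Some v"
proof -
  obtain s where s: "c_state (t2_run M y s) = t2_halt M" "c_output (t2_run M y s) = v"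
    using out by (auto simp: t2_outputs_word_def)
  show ?thesis
  proof (intro exI[of _ s] allI impI)
    fix t w assume t: "s \<le> t" and w: "\<forall>j<t2_inputs M. approximates s (y j) (w j)"
    obtain s' where s': "s' \<ge> min s t" "trunc_run M w t (t2_initial M) = t2_run M y s'"
      using trunc_run_correct[OF M, of s y w t] w by blast
    then have "trunc_run M w t (t2_initial M) = t2_run M y s" using t2_run_halted[OF s(1), of s'] t by simp
    then show "trunc_test M t w = Some v" using s v by (auto simp: trunc_test_def)
  qed
qed

lemma t2_outputs_seq_unique:
  assumes "t2_outputs_seq M x p" "t2_outputs_seq M x q"
  shows "p = q"
proof
  fix i
  obtain t where t: "Suc i \<le> length (c_output (t2_run M x t))"
    using assms(1) unfolding t2_outputs_seq_def by blast
  then show "p i = q i"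
    using approximates_output[OF assms(1) t] approximates_output[OF assms(2) t]
    by (metis approximates_def less_eq_Suc_le)
qed

text \<open>
  A machine may be defined on more inputs than \<open>f\<close>; the function that it computes is the required
  extension.
\<close>

lemma computable_pfunI:
  assumes M: "type2_machine M" "t2_inputs M = n"
    and dom: "dom f \<subseteq> (\<Pi>\<^sub>E j\<in>{..<n}. UNIV)"
    and out: "\<And>x y. f x = Some y \<Longrightarrow> t2_outputs_seq M x y"
  shows "computable_pfun t2_outputs_seq n f"
proof -
  define g where "g = (\<lambda>x. if x \<in> (\<Pi>\<^sub>E j\<in>{..<n}. UNIV) \<and> (\<exists>y. t2_outputs_seq M x y)
     then Some (THE y. t2_outputs_seq M x y) else None)"
  have the: "(THE y. t2_outputs_seq M x y) = y" if "t2_outputs_seq M x y" for x y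
    using that t2_outputs_seq_unique by blast
  have g: "g x = Some y \<longleftrightarrow> t2_outputs_seq M x y" if "x \<in> (\<Pi>\<^sub>E j\<in>{..<n}. UNIV)" for x y
    using that the by (auto simp: g_def simp del: PiE_UNIV_domain)
  have "dom g \<subseteq> (\<Pi>\<^sub>E j\<in>{..<n}. UNIV)" by (auto simp: g_def simp del: PiE_iff split: if_splits)
  then have "turing_computable t2_outputs_seq n g"
    unfolding turing_computable_def using M g by blast
  moreover have "f \<subseteq>\<^sub>m g"
  proof (unfold map_le_def, intro ballI)
    fix x assume "x \<in> dom f"
    then obtain y where y: "f x = Some y" by blast
    then have "x \<in> (\<Pi>\<^sub>E j\<in>{..<n}. UNIV)" using dom by blast
    then show "f x = g x" using g out[OF y] y by metis
  qed
  ultimately show ?thesis unfolding computable_pfun_def by blast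
qed

text \<open>
  The machine \<open>Mc l\<close> computes an extension of the function in the statement of label \<open>l\<close>; outside
  the domain of that function it may do anything.
\<close>

locale simulation =
  fixes N :: "('l, 'g, 'a::{finite, zero_neq_one} word, 'a) gtm" and Mc :: "'l \<Rightarrow> 'a t2m"
  assumes N: "generalized_TM N"
    and machines: "\<And>l. type2_machine (Mc l)"
    and assign: "\<And>l i f js l'. l \<in> labels N - {final_label N} \<Longrightarrow> statement N l = Assign i f js l' \<Longrightarrow>
      t2_inputs (Mc l) = length js \<and>
      (\<forall>y v. y \<in> extensional {..<length js} \<longrightarrow> f y = Some v \<longrightarrow> t2_outputs_seq (Mc l) y v)"
    and test: "\<And>l f js l' l''. l \<in> labels N - {final_label N} \<Longrightarrow> statement N l = Test f js l' l'' \<Longrightarrow>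
      t2_inputs (Mc l) = length js \<and>
      (\<forall>y v. y \<in> extensional {..<length js} \<longrightarrow> f y = Some v \<longrightarrow>
         v \<in> {[0], [1]} \<and> t2_outputs_word (Mc l) y v)"
begin

definition truncated :: "nat \<Rightarrow> ('l, 'g, 'a list, 'a) gtm" where
  "truncated t = replace_functions (\<lambda>l. trunc_assign (Mc l) t) (\<lambda>l. trunc_test (Mc l) t) N"

definition start :: "(nat \<Rightarrow> 'a word) \<Rightarrow> nat \<Rightarrow> ('l, 'g, 'a list) config" where
  "start x t = initial_config (truncated t) (\<lambda>j. map (x j) [0..<t])"

text \<open>
  Being a prefix of the true sequence is preserved whatever \<open>t\<close> is: \<open>lockstep\<close> with a single
  precision.
\<close>

lemma truncated_sound:
  assumes "(gtm_step N ^^ i) (initial_config N x) \<kappa>" "(gtm_step (truncated t) ^^ i) (start x t) \<kappa>'"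
  shows "related (approximates 0) \<kappa> \<kappa>'"
proof -
  have "\<exists>k::nat. \<forall>t \<kappa>'. True \<longrightarrow> (gtm_step (truncated t) ^^ i) (start x t) \<kappa>' \<longrightarrow> related (approximates 0) \<kappa> \<kappa>'"
    unfolding truncated_def start_def
  proof (rule lockstep[where C = "\<lambda>_ _. True" and R = "\<lambda>_. approximates 0", OF N _ _ _ _ _ assms(1)])
    show "\<exists>k. \<forall>t. True \<longrightarrow> (\<forall>j<arity N. approximates 0 (x j) (map (x j) [0..<t]))" for n :: nat
      by (simp add: approximates_def)
  next
    fix l i f js l' y v and n :: nat
    assume "l \<in> labels N - {final_label N}" "statement N l = Assign i f js l'"
      "y \<in> extensional {..<length js}" "f y = Some v"
    then show "\<exists>k. \<forall>t y' v'. True \<longrightarrow> (\<forall>j<length js. approximates 0 (y j) (y' j)) \<longrightarrow>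
         trunc_assign (Mc l) t y' = Some v' \<longrightarrow> approximates 0 v v'"
      using assign[of l i f js l'] trunc_assign_sound[OF machines[of l], of y v] by simp
  next
    fix l f js l' l'' y v
    assume "l \<in> labels N - {final_label N}" "statement N l = Test f js l' l''"
      "y \<in> extensional {..<length js}" "f y = Some v"
    then show "\<exists>k. \<forall>t y' v'. True \<longrightarrow> (\<forall>j<length js. approximates 0 (y j) (y' j)) \<longrightarrow>
         trunc_test (Mc l) t y' = Some v' \<longrightarrow> v = v'"
      using test[of l f js l' l''] trunc_test_sound[OF machines[of l], of y v] by simp
  qed auto
  then show ?thesis using assms(2) by blast
qed

lemma truncated_close:
  assumes "(gtm_step N ^^ i) (initial_config N x) \<kappa>"
  shows "\<exists>k. \<forall>t \<kappa>'. k \<le> t \<longrightarrow> (gtm_step (truncated t) ^^ i) (start x t) \<kappa>' \<longrightarrow> related (approximates n) \<kappa> \<kappa>'"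
  unfolding truncated_def start_def
proof (rule lockstep[where C = "\<lambda>k t. k \<le> t" and R = approximates, OF N _ _ _ _ _ assms])
  show "\<exists>k. \<forall>t\<ge>k. \<forall>j<arity N. approximates n (x j) (map (x j) [0..<t])" for n
    by (auto simp: approximates_def)
next
  fix l i f js l' y v n
  assume "l \<in> labels N - {final_label N}" "statement N l = Assign i f js l'"
    "y \<in> extensional {..<length js}" "f y = Some v"
  then show "\<exists>k. \<forall>t y' v'. k \<le> t \<longrightarrow> (\<forall>j<length js. approximates k (y j) (y' j)) \<longrightarrow>
       trunc_assign (Mc l) t y' = Some v' \<longrightarrow> approximates n v v'"
    using assign[of l i f js l'] trunc_assign_approximates[OF machines[of l], of y v n] by simp
next
  fix l f js l' l'' y v
  assume "l \<in> labels N - {final_label N}" "statement N l = Test f js l' l''"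
    "y \<in> extensional {..<length js}" "f y = Some v"
  then show "\<exists>k. \<forall>t y' v'. k \<le> t \<longrightarrow> (\<forall>j<length js. approximates k (y j) (y' j)) \<longrightarrow>
       trunc_test (Mc l) t y' = Some v' \<longrightarrow> v = v'"
    using test[of l f js l' l''] trunc_test_decides[OF machines[of l], of y v] by (metis option.inject)
qed (auto intro: approximates_antimono)

text \<open>
  A truncated assignment always has a value.  A truncated test has one as soon as \<open>t\<close> and the
  lengths of its arguments reach the time that its machine needs to halt.
\<close>

lemma truncated_progress:
  assumes "(gtm_step N ^^ i) (initial_config N x) \<kappa>"
  shows "\<exists>k. \<forall>t\<ge>k. \<exists>\<kappa>'. (gtm_step (truncated t) ^^ i) (start x t) \<kappa>'"
  using assms
proof (induction i arbitrary: \<kappa>)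
  case 0
  then show ?case by auto
next
  case (Suc i)
  then obtain \<kappa>0 where run: "(gtm_step N ^^ i) (initial_config N x) \<kappa>0" and step: "gtm_step N \<kappa>0 \<kappa>" by auto
  obtain l T where \<kappa>0: "\<kappa>0 = (l, T)" by (cases \<kappa>0)
  have l: "l \<in> labels N - {final_label N}"
    using run_labels[OF N run] no_step_final[of \<kappa>0 N \<kappa>] step \<kappa>0 by auto
  obtain k1 where k1: "\<forall>t\<ge>k1. \<exists>\<kappa>'. (gtm_step (truncated t) ^^ i) (start x t) \<kappa>'" using Suc.IH[OF run] by blast
  have "\<exists>k. \<forall>t\<ge>k. \<forall>\<kappa>'. related (approximates k) \<kappa>0 \<kappa>' \<longrightarrow> (\<exists>\<kappa>1. gtm_step (truncated t) \<kappa>' \<kappa>1)"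
  proof -
    have args: "\<exists>y'\<in>extensional {..<length js}. (\<forall>j<length js. cell T' (js ! j) = Inl (y' j) \<and> R (y j) (y' j))"
      if rel: "related R (l, T) (l', T')" and y: "\<forall>j<length js. cell T (js ! j) = Inl (y j)" for R y js l' and T' :: "nat \<Rightarrow> (int \<Rightarrow> 'a list + 'g) \<times> int"
    proof -
      have "\<exists>w. cell T' (js ! j) = Inl w \<and> R (y j) w" if "j < length js" for j
        using related_cell[OF rel, of "js ! j"] y that
        by (cases "cell T' (js ! j)") auto
      then obtain w where "\<forall>j<length js. cell T' (js ! j) = Inl (w j) \<and> R (y j) (w j)" by metis
      then show ?thesis by (intro bexI[of _ "restrict w {..<length js}"]) auto
    qed
    show ?thesis
    proof (cases "statement N l")
      case (Assign i f js l')
      then obtain y where y: "\<forall>j<length js. cell T (js ! j) = Inl (y j)"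
        using step \<kappa>0 by (auto simp: gtm_step_def apply_fun_def)
      have "\<exists>\<kappa>1. gtm_step (truncated t) \<kappa>' \<kappa>1" if rel: "related (approximates 0) \<kappa>0 \<kappa>'" for t \<kappa>'
      proof -
        obtain T' where \<kappa>': "\<kappa>' = (l, T')" using rel \<kappa>0 by (cases \<kappa>') (auto simp: related_def)
        then obtain y' where "y' \<in> extensional {..<length js}" "\<forall>j<length js. cell T' (js ! j) = Inl (y' j)"
          using args[OF rel[unfolded \<kappa>0 \<kappa>'] y] by blast
        then have "apply_fun (trunc_assign (Mc l) t) js T' (the (trunc_assign (Mc l) t y'))"
          unfolding apply_fun_def by (intro bexI[of _ y']) (auto simp: trunc_assign_def)
        then show ?thesis using \<kappa>' l Assign by (auto simp: gtm_step_def truncated_def)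
      qed
      then show ?thesis by blast
    next
      case (Test f js l' l'')
      then obtain y v where y: "y \<in> extensional {..<length js}" "f y = Some v" "\<forall>j<length js. cell T (js ! j) = Inl (y j)"
        using step \<kappa>0 by (auto simp: gtm_step_def apply_fun_def)
      have v: "v \<in> {[0], [1]}" and inp: "t2_inputs (Mc l) = length js" and out: "t2_outputs_word (Mc l) y v"
        using test[OF l Test] y by auto
      obtain k where k: "\<forall>t w. k \<le> t \<longrightarrow> (\<forall>j<length js. approximates k (y j) (w j)) \<longrightarrow> trunc_test (Mc l) t w = Some v"
        using trunc_test_decides[OF machines out v] inp by auto
      have "\<exists>\<kappa>1. gtm_step (truncated t) \<kappa>' \<kappa>1" if rel: "related (approximates k) \<kappa>0 \<kappa>'" and t: "k \<le> t" for t \<kappa>'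
      proof -
        obtain T' where \<kappa>': "\<kappa>' = (l, T')" using rel \<kappa>0 by (cases \<kappa>') (auto simp: related_def)
        then obtain y' where "y' \<in> extensional {..<length js}"
          "\<forall>j<length js. cell T' (js ! j) = Inl (y' j) \<and> approximates k (y j) (y' j)"
          using args[OF rel[unfolded \<kappa>0 \<kappa>'] y(3)] by blast
        then have "apply_fun (trunc_test (Mc l) t) js T' v"
          unfolding apply_fun_def using k t by (intro bexI[of _ y']) auto
        then show ?thesis using \<kappa>' l Test v by (auto simp: gtm_step_def truncated_def)
      qed
      then show ?thesis by (intro exI[of _ k]) blast
    qed (use l \<kappa>0 in \<open>auto simp: gtm_step_def truncated_def related_def intro!: exI[of _ 0]\<close>)
  qed
  then obtain k2 where k2: "\<forall>t\<ge>k2. \<forall>\<kappa>'. related (approximates k2) \<kappa>0 \<kappa>' \<longrightarrow> (\<exists>\<kappa>1. gtm_step (truncated t) \<kappa>' \<kappa>1)"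
    by blast
  obtain k3 where k3: "\<forall>t \<kappa>'. k3 \<le> t \<longrightarrow> (gtm_step (truncated t) ^^ i) (start x t) \<kappa>' \<longrightarrow> related (approximates k2) \<kappa>0 \<kappa>'"
    using truncated_close[OF run] by blast
  show ?case
  proof (intro exI[of _ "max k1 (max k2 k3)"] allI impI)
    fix t assume t: "max k1 (max k2 k3) \<le> t"
    then obtain \<kappa>' where \<kappa>': "(gtm_step (truncated t) ^^ i) (start x t) \<kappa>'" using k1 by auto
    then obtain \<kappa>1 where "gtm_step (truncated t) \<kappa>' \<kappa>1" using k2 k3 t by (meson max.bounded_iff)
    then show "\<exists>\<kappa>'. (gtm_step (truncated t) ^^ Suc i) (start x t) \<kappa>'"
      using relpowp_Suc_I[OF \<kappa>'] by blast
  qed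
qed

end

section \<open>Stack programs and their compilation\<close>

datatype 's action = Keep | Pop | Push 's

fun act :: "'s action \<Rightarrow> 's list \<Rightarrow> 's list" where
  "act Keep xs = xs"
| "act Pop xs = tl xs"
| "act (Push s) xs = s # xs"

text \<open>
  Programs on stacks named by \<open>'r\<close> with symbols in \<open>'s\<close>.  \<open>Par\<close> acts on all stacks at once.  \<open>Read\<close>
  takes one symbol from every input.  \<open>Case\<close> chooses a program depending on the tops of all stacks,
  so a table of a finite machine can be written down as a function.
\<close>

datatype ('r, 's, 'a) com =
    Par "'r \<Rightarrow> 's action"
  | Read "'a list \<Rightarrow> ('r, 's, 'a) com"
  | Emit 'a
  | Seq "('r, 's, 'a) com" "('r, 's, 'a) com"
  | Case "('r \<Rightarrow> 's option) \<Rightarrow> ('r, 's, 'a) com"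
  | While "('r \<Rightarrow> 's option) \<Rightarrow> bool" "('r, 's, 'a) com"

lemma set_tl_subset: "set (tl xs) \<subseteq> set xs"
  by (cases xs) auto

definition tops :: "('r \<Rightarrow> 's list) \<Rightarrow> 'r \<Rightarrow> 's option" where
  "tops \<sigma> r = (case \<sigma> r of [] \<Rightarrow> None | s # _ \<Rightarrow> Some s)"

lemma tops_eq_None [simp]: "tops \<sigma> r = None \<longleftrightarrow> \<sigma> r = []"
  by (simp add: tops_def split: list.splits)

lemma tops_eq_Some: "tops \<sigma> r = Some s \<longleftrightarrow> (\<exists>xs. \<sigma> r = s # xs)"
  by (auto simp: tops_def split: list.splits)

lemma tops_Cons: "\<sigma> r = s # xs \<Longrightarrow> tops \<sigma> r = Some s"
  by (simp add: tops_def)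

text \<open>
  A store consists of the stacks, the common position of all input heads, and the output.  The
  stacks in \<open>R\<close> and the symbols in \<open>S\<close> are those a compiled machine provides.  The rule for \<open>Par\<close>
  checks this during the execution, so that tables may be arbitrary where they are not used.
\<close>

inductive exec ::
  "'r set \<Rightarrow> 's set \<Rightarrow> nat \<Rightarrow> (nat \<Rightarrow> 'a word) \<Rightarrow> ('r, 's, 'a) com \<Rightarrow>
     ('r \<Rightarrow> 's list) \<times> nat \<times> 'a list \<Rightarrow> ('r \<Rightarrow> 's list) \<times> nat \<times> 'a list \<Rightarrow> bool"
  for R S n x where
  Par: "(\<And>r. r \<notin> R \<Longrightarrow> A r = Keep) \<Longrightarrow> (\<And>r s. A r = Push s \<Longrightarrow> s \<in> S) \<Longrightarrow>
     exec R S n x (Par A) (\<sigma>, h, u) (\<lambda>r. act (A r) (\<sigma> r), h, u)"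
| Read: "exec R S n x (g (map (\<lambda>j. x j h) [0..<n])) (\<sigma>, Suc h, u) st \<Longrightarrow>
     exec R S n x (Read g) (\<sigma>, h, u) st"
| Emit: "exec R S n x (Emit a) (\<sigma>, h, u) (\<sigma>, h, u @ [a])"
| Seq: "exec R S n x c st st' \<Longrightarrow> exec R S n x d st' st'' \<Longrightarrow> exec R S n x (Seq c d) st st''"
| Case: "exec R S n x (g (tops \<sigma>)) (\<sigma>, h, u) st \<Longrightarrow> exec R S n x (Case g) (\<sigma>, h, u) st"
| While_False: "\<not> b (tops \<sigma>) \<Longrightarrow> exec R S n x (While b c) (\<sigma>, h, u) (\<sigma>, h, u)"
| While_True: "b (tops \<sigma>) \<Longrightarrow> exec R S n x c (\<sigma>, h, u) st \<Longrightarrow>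
     exec R S n x (While b c) st st' \<Longrightarrow> exec R S n x (While b c) (\<sigma>, h, u) st'"

text \<open>
  The states of a compiled machine: a list of programs still to be executed, or the second half of
  a \<open>Par\<close>.  A Type-2 machine writes before it moves, whereas a push has to move up to a free cell
  before it writes; so a \<open>Par\<close> takes two steps, and the pushed symbols are written in the second.
\<close>

datatype ('r, 's, 'a) ctl =
    Run "('r, 's, 'a) com list"
  | Put "'r \<Rightarrow> 's action" "('r, 's, 'a) com list"

fun ctl_step ::
  "('r, 's, 'a) ctl \<Rightarrow> ('r \<Rightarrow> 's option) \<Rightarrow> 'a list \<Rightarrow>
     ('r, 's, 'a) ctl \<times> head_move \<times> ('r \<Rightarrow> 's option \<times> head_move) \<times> 'a option" where
  "ctl_step (Run []) tp v = (Run [], Stay, \<lambda>r. (tp r, Stay), None)"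
| "ctl_step (Run (Par A # K)) tp v =
     (Put A K, Stay,
      \<lambda>r. case A r of
            Keep \<Rightarrow> (tp r, Stay)
          | Pop \<Rightarrow> (None, if tp r = None then Stay else Left)
          | Push s \<Rightarrow> (tp r, Right), None)"
| "ctl_step (Put A K) tp v =
     (Run K, Stay, \<lambda>r. (case A r of Push s \<Rightarrow> Some s | _ \<Rightarrow> tp r, Stay), None)"
| "ctl_step (Run (Read g # K)) tp v = (Run (g v # K), Right, \<lambda>r. (tp r, Stay), None)"
| "ctl_step (Run (Emit a # K)) tp v = (Run K, Stay, \<lambda>r. (tp r, Stay), Some a)"
| "ctl_step (Run (Seq c d # K)) tp v = (Run (c # d # K), Stay, \<lambda>r. (tp r, Stay), None)"
| "ctl_step (Run (Case g # K)) tp v = (Run (g tp # K), Stay, \<lambda>r. (tp r, Stay), None)"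
| "ctl_step (Run (While b c # K)) tp v =
     (Run (if b tp then c # While b c # K else K), Stay, \<lambda>r. (tp r, Stay), None)"

locale stack_compiler =
  fixes rs :: "'r list" and S :: "'s set" and n :: nat
    and body :: "('r, 's, 'a::finite) com"
  assumes distinct_rs: "distinct rs" and finite_S: "finite S"
begin

definition top_views :: "('r \<Rightarrow> 's option) set" where
  "top_views = {tp. (\<forall>r. r \<notin> set rs \<longrightarrow> tp r = None) \<and> (\<forall>r s. tp r = Some s \<longrightarrow> s \<in> S)}"

lemma finite_top_views: "finite top_views"
proof (rule finite_subset)
  show "top_views \<subseteq> {f. \<forall>r. (r \<in> set rs \<longrightarrow> f r \<in> insert None (Some ` S)) \<and> (r \<notin> set rs \<longrightarrow> f r = None)}"
  proof
    fix tp assume tp: "tp \<in> top_views"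
    show "tp \<in> {f. \<forall>r. (r \<in> set rs \<longrightarrow> f r \<in> insert None (Some ` S)) \<and> (r \<notin> set rs \<longrightarrow> f r = None)}"
    proof (clarify, intro conjI impI)
      fix r show "tp r \<in> insert None (Some ` S)"
        using tp by (cases "tp r") (auto simp: top_views_def)
    next
      fix r assume "r \<notin> set rs" then show "tp r = None" using tp by (auto simp: top_views_def)
    qed
  qed
  show "finite \<dots>"
    by (rule finite_set_of_finite_funs) (simp_all add: finite_S)
qed

text \<open>
  The states that can occur while \<open>c\<close> is executed and \<open>K\<close> remains to be done.  There are finitely
  many, because a \<open>Case\<close> needs to be considered only for finitely many views of the stacks, and a
  \<open>Read\<close> only for finitely many symbols.
\<close>

primrec conts :: "('r, 's, 'a) com \<Rightarrow> ('r, 's, 'a) com list \<Rightarrow> ('r, 's, 'a) ctl set" where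
  "conts (Par A) K = {Run (Par A # K), Put A K, Run K}"
| "conts (Read g) K = insert (Run (Read g # K)) (\<Union>v\<in>{v. length v = n}. conts (g v) K)"
| "conts (Emit a) K = {Run (Emit a # K), Run K}"
| "conts (Seq c d) K = insert (Run (Seq c d # K)) (conts c (d # K) \<union> conts d K)"
| "conts (Case g) K = insert (Run (Case g # K)) (\<Union>tp\<in>top_views. conts (g tp) K)"
| "conts (While b c) K = {Run (While b c # K), Run K} \<union> conts c (While b c # K)"

lemma conts_head: "Run (c # K) \<in> conts c K"
  by (cases c) auto

lemma finite_conts: "finite (conts c K)"
proof (induction c arbitrary: K)
  case (Read g)
  have "finite {v :: 'a list. length v = n}"
    using finite_lists_length_eq[of "UNIV :: 'a set" n] by simp
  then show ?case using Read by auto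
qed (auto simp: finite_top_views)

definition control :: "('r, 's, 'a) ctl set" where
  "control = conts (While (\<lambda>_. True) body) []"

lemma countable_control: "countable control"
  unfolding control_def by (rule countable_finite[OF finite_conts])

definition ctl_code :: "('r, 's, 'a) ctl \<Rightarrow> nat" where
  "ctl_code k = Suc (to_nat_on control k)"

text \<open>
  The blank 0 is what the machine scans when a stack is empty.
\<close>

definition sym_code :: "'s option \<Rightarrow> nat" where
  "sym_code so = (case so of Some s \<Rightarrow> if s \<in> S then Suc (to_nat_on S s) else 0 | None \<Rightarrow> 0)"

definition sym_decode :: "nat \<Rightarrow> 's option" where
  "sym_decode v = (if v = 0 then None else Some (from_nat_into S (v - 1)))"

text \<open>
  Falling back to the old state \<open>q\<close> when \<open>k\<close> is not in \<open>control\<close> keeps the table within the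
  states of the machine; executing a program never needs it.
\<close>

definition machine :: "'a t2m" where
  "machine =
     \<lparr>t2_inputs = n, t2_works = length rs,
      t2_states = insert 0 (ctl_code ` control),
      t2_start = ctl_code (Run [While (\<lambda>_. True) body]),
      t2_halt = 0,
      t2_symbols = range sym_code,
      t2_blank = 0,
      t2_delta = (\<lambda>q ins ws.
        case ctl_step (from_nat_into control (q - 1))
               (\<lambda>r. case map_of (zip rs ws) r of None \<Rightarrow> None | Some v \<Rightarrow> sym_decode v)
               (map the ins)
        of (k, m, acts, out) \<Rightarrow>
          (if k \<in> control then ctl_code k else q,
           replicate n m,
           map (\<lambda>r. (sym_code (fst (acts r)), snd (acts r))) rs, out))\<rparr>"

lemma range_sym_code: "range sym_code \<subseteq> insert 0 (Suc ` to_nat_on S ` S)"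
  by (auto simp: sym_code_def split: option.splits)

lemma type2_machine_machine: "type2_machine machine"
proof -
  have f: "finite (range sym_code)"
    by (rule finite_subset[OF range_sym_code]) (simp add: finite_S)
  have z: "0 \<in> range sym_code"
    by (rule range_eqI[of _ _ None]) (simp add: sym_code_def)
  have st: "Run [While (\<lambda>_. True) body] \<in> control"
    unfolding control_def by (rule conts_head)
  show ?thesis
    unfolding type2_machine_def using f z st
    by (auto simp: machine_def control_def finite_conts image_iff split: prod.splits)
qed

lemma sym_decode_code: "sym_code so = v \<Longrightarrow> (\<And>s. so = Some s \<Longrightarrow> s \<in> S) \<Longrightarrow> sym_decode v = so"
  by (cases so) (auto simp: sym_code_def sym_decode_def countable_finite finite_S)

lemma ctl_decode: "k \<in> control \<Longrightarrow> from_nat_into control (ctl_code k - 1) = k"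
  by (simp add: ctl_code_def countable_control)

text \<open>
  The bottom of the stack is in cell 1 and the head scans the top.  So the empty stack is the blank
  tape with the head at 0, as at the beginning of a run.
\<close>

definition stack_tape :: "'s list \<Rightarrow> (int \<Rightarrow> nat) \<times> int" where
  "stack_tape xs =
     (\<lambda>z. if 0 < z \<and> z \<le> int (length xs) then sym_code (Some (rev xs ! nat (z - 1))) else 0,
      int (length xs))"

definition good :: "('r \<Rightarrow> 's list) \<Rightarrow> bool" where
  "good \<sigma> \<longleftrightarrow> (\<forall>r. r \<notin> set rs \<longrightarrow> \<sigma> r = []) \<and> (\<forall>r. set (\<sigma> r) \<subseteq> S)"

lemma tops_good: "good \<sigma> \<Longrightarrow> tops \<sigma> \<in> top_views"
  unfolding good_def top_views_def by (auto simp: subset_iff tops_eq_Some) (metis list.set_intros(1))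

definition conf :: "('r, 's, 'a) ctl \<Rightarrow> ('r \<Rightarrow> (int \<Rightarrow> nat) \<times> int) \<Rightarrow> nat \<Rightarrow> 'a list \<Rightarrow> 'a t2conf" where
  "conf k tapes h u =
     \<lparr>c_state = ctl_code k, c_heads = replicate n (int h), c_works = map tapes rs, c_output = u\<rparr>"

text \<open>
  The tapes are arbitrary here, since between the two steps of a \<open>Par\<close> they do not represent
  stacks.
\<close>

lemma machine_step:
  assumes "k \<in> control" "k' \<in> control"
    and tp: "\<And>r. r \<in> set rs \<Longrightarrow> sym_decode (fst (tapes r) (snd (tapes r))) = tp r"
      "\<And>r. r \<notin> set rs \<Longrightarrow> tp r = None"
    and step: "ctl_step k tp (map (\<lambda>j. x j h) [0..<n]) = (k', m, acts, out)"
    and m: "moved m (int h) = int h'"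
  shows "t2_step machine x (conf k tapes h u) =
     conf k' (\<lambda>r. work_action (tapes r) (sym_code (fst (acts r)), snd (acts r))) h'
       (u @ (case out of None \<Rightarrow> [] | Some a \<Rightarrow> [a]))"
proof -
  have ins: "map the (map (\<lambda>j. input_cell (x j) (replicate n (int h) ! j)) [0..<n]) = map (\<lambda>j. x j h) [0..<n]"
    by (simp add: input_cell_def)
  have tps: "(\<lambda>r. case map_of (zip rs (map (\<lambda>(\<tau>, z). \<tau> z) (map tapes rs))) r of
        None \<Rightarrow> None | Some v \<Rightarrow> sym_decode v) = tp"
  proof
    fix r
    have "map (\<lambda>(\<tau>, z). \<tau> z) (map tapes rs) = map (\<lambda>r. fst (tapes r) (snd (tapes r))) rs"
      by (simp add: case_prod_beta)
    then show "(case map_of (zip rs (map (\<lambda>(\<tau>, z). \<tau> z) (map tapes rs))) r of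
        None \<Rightarrow> None | Some v \<Rightarrow> sym_decode v) = tp r"
      using tp[of r] by (simp add: map_of_zip_map del: map_map)
  qed
  have 1: "map2 moved (replicate n m) (replicate n (int h)) = replicate n (int h')"
    by (simp add: m zip_replicate)
  have 2: "map2 work_action (map tapes rs) (map (\<lambda>r. (sym_code (fst (acts r)), snd (acts r))) rs) =
     map (\<lambda>r. work_action (tapes r) (sym_code (fst (acts r)), snd (acts r))) rs"
    by (simp add: zip_map_map zip_same_conv_map case_prod_beta)
  show ?thesis
    unfolding t2_step_def
    using 1 2 assms(1,2) step
    by (simp add: conf_def machine_def ctl_code_def[of k] ins tps ctl_decode del: map_map)
       (simp add: ctl_code_def ctl_decode[unfolded ctl_code_def, simplified] ins[simplified] tps[simplified])
qed

lemma stack_tape_read: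
  "set xs \<subseteq> S \<Longrightarrow> fst (stack_tape xs) (snd (stack_tape xs)) = sym_code (case xs of [] \<Rightarrow> None | s # _ \<Rightarrow> Some s)"
  by (cases xs) (simp_all add: stack_tape_def sym_code_def nth_append)

lemma stack_tape_stay:
  "work_action (stack_tape xs) (fst (stack_tape xs) (snd (stack_tape xs)), Stay) = stack_tape xs"
  by (simp add: work_action_def)

lemma stack_tape_pop: "work_action (stack_tape (s # xs)) (sym_code None, Left) = stack_tape xs"
proof -
  have "(fst (stack_tape (s # xs)))(int (length xs) + 1 := 0) = fst (stack_tape xs)"
  proof
    fix z :: int
    have a: "nat (z - 1) < length xs" if "0 < z" "z \<le> int (length xs)" using that by linarith
    consider "z \<le> 0" | "0 < z" "z \<le> int (length xs)" | "z = int (length xs) + 1" | "int (length xs) + 1 < z"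
      by linarith
    then show "((fst (stack_tape (s # xs)))(int (length xs) + 1 := 0)) z = fst (stack_tape xs) z"
      by cases (simp_all add: stack_tape_def nth_append a)
  qed
  moreover have "sym_code None = 0" "snd (stack_tape (s # xs)) = int (length xs) + 1"
      "stack_tape xs = (fst (stack_tape xs), int (length xs))"
    by (simp_all add: sym_code_def stack_tape_def)
  ultimately show ?thesis by (simp add: work_action_def)
qed

lemma stack_tape_push:
  "work_action (work_action (stack_tape xs) (fst (stack_tape xs) (snd (stack_tape xs)), Right))
     (sym_code (Some s), Stay) = stack_tape (s # xs)"
proof -
  have "(fst (stack_tape xs))(int (length xs) + 1 := sym_code (Some s)) = fst (stack_tape (s # xs))"
  proof
    fix z :: int
    have a: "nat (z - 1) < length xs" if "0 < z" "z \<le> int (length xs)" using that by linarith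
    consider "z \<le> 0" | "0 < z" "z \<le> int (length xs)" | "z = int (length xs) + 1" | "int (length xs) + 1 < z"
      by linarith
    then show "((fst (stack_tape xs))(int (length xs) + 1 := sym_code (Some s))) z = fst (stack_tape (s # xs)) z"
      by cases (simp_all add: stack_tape_def nth_append a)
  qed
  then show ?thesis by (simp add: work_action_def) (simp add: stack_tape_def)
qed

lemma tops_code: "good \<sigma> \<Longrightarrow> sym_code (tops \<sigma> r) = fst (stack_tape (\<sigma> r)) (snd (stack_tape (\<sigma> r)))"
  by (simp add: stack_tape_read good_def tops_def)

lemma tops_decode:
  assumes "good \<sigma>"
  shows "sym_decode (fst (stack_tape (\<sigma> r)) (snd (stack_tape (\<sigma> r)))) = tops \<sigma> r"
  using tops_good[OF assms]
  by (intro sym_decode_code) (auto simp: tops_code[OF assms] top_views_def)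

definition sconf :: "('r, 's, 'a) ctl \<Rightarrow> ('r \<Rightarrow> 's list) \<times> nat \<times> 'a list \<Rightarrow> 'a t2conf" where
  "sconf k st = (case st of (\<sigma>, h, u) \<Rightarrow> conf k (\<lambda>r. stack_tape (\<sigma> r)) h u)"

definition reaches :: "(nat \<Rightarrow> 'a word) \<Rightarrow> 'a t2conf \<Rightarrow> 'a t2conf \<Rightarrow> bool" where
  "reaches x c c' \<longleftrightarrow> (\<exists>t. (t2_step machine x ^^ t) c = c')"

lemma reaches_step: "t2_step machine x c = c' \<Longrightarrow> reaches x c c'"
  unfolding reaches_def by (rule exI[of _ 1]) simp

lemma reaches_trans: "reaches x c d \<Longrightarrow> reaches x d e \<Longrightarrow> reaches x c e"
  unfolding reaches_def by (metis funpow_add comp_apply)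

lemma machine_step_idle:
  assumes "good \<sigma>" "k \<in> control" "k' \<in> control"
    and step: "ctl_step k (tops \<sigma>) (map (\<lambda>j. x j h) [0..<n]) = (k', m, \<lambda>r. (tops \<sigma> r, Stay), out)"
    and m: "moved m (int h) = int h'"
  shows "t2_step machine x (sconf k (\<sigma>, h, u)) =
     sconf k' (\<sigma>, h', u @ (case out of None \<Rightarrow> [] | Some a \<Rightarrow> [a]))"
proof -
  have "t2_step machine x (conf k (\<lambda>r. stack_tape (\<sigma> r)) h u) =
     conf k' (\<lambda>r. work_action (stack_tape (\<sigma> r))
        (sym_code (fst (tops \<sigma> r, Stay)), snd (tops \<sigma> r, Stay))) h'
       (u @ (case out of None \<Rightarrow> [] | Some a \<Rightarrow> [a]))"
    by (rule machine_step[where tp = "tops \<sigma>" and acts = "\<lambda>r. (tops \<sigma> r, Stay)"])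
       (use assms in \<open>simp_all add: tops_decode good_def\<close>)
  then show ?thesis
    by (simp add: sconf_def tops_code[OF assms(1)] stack_tape_stay)
qed

lemma exec_reaches:
  assumes "exec (set rs) S n x c st st'" "good (fst st)" "conts c K \<subseteq> control"
  shows "good (fst st') \<and> reaches x (sconf (Run (c # K)) st) (sconf (Run K) st')"
  using assms
proof (induction arbitrary: K rule: exec.induct)
  case (Par A \<sigma> h u)
  let ?\<tau> = "\<lambda>r. work_action (stack_tape (\<sigma> r))
    (case A r of Keep \<Rightarrow> (sym_code (tops \<sigma> r), Stay)
       | Pop \<Rightarrow> (0, if tops \<sigma> r = None then Stay else Left) | Push s \<Rightarrow> (sym_code (tops \<sigma> r), Right))"
  have g: "good \<sigma>" using Par by simp
  have 1: "t2_step machine x (sconf (Run (Par A # K)) (\<sigma>, h, u)) = conf (Put A K) ?\<tau> h u"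
  proof -
    have "t2_step machine x (conf (Run (Par A # K)) (\<lambda>r. stack_tape (\<sigma> r)) h u) =
      conf (Put A K) (\<lambda>r. work_action (stack_tape (\<sigma> r))
        (sym_code (fst (case A r of
            Keep \<Rightarrow> (tops \<sigma> r, Stay)
          | Pop \<Rightarrow> (None, if tops \<sigma> r = None then Stay else Left)
          | Push s \<Rightarrow> (tops \<sigma> r, Right))), snd (case A r of
            Keep \<Rightarrow> (tops \<sigma> r, Stay)
          | Pop \<Rightarrow> (None, if tops \<sigma> r = None then Stay else Left)
          | Push s \<Rightarrow> (tops \<sigma> r, Right)))) h (u @ (case None of None \<Rightarrow> [] | Some a \<Rightarrow> [a]))"
      by (rule machine_step) (use Par g in \<open>auto simp: tops_decode good_def\<close>)
    also have "\<dots> = conf (Put A K) ?\<tau> h u"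
      by (auto simp: conf_def sym_code_def split: action.splits)
    finally show ?thesis by (simp add: sconf_def)
  qed
  have tau: "?\<tau> r = stack_tape (act (A r) (\<sigma> r))" if "\<forall>s. A r \<noteq> Push s" for r
  proof (cases "A r")
    case Keep then show ?thesis using g by (simp add: tops_code stack_tape_stay)
  next
    case Pop
    show ?thesis
    proof (cases "\<sigma> r")
      case Nil
      then have "tops \<sigma> r = None" by simp
      then show ?thesis using Pop Nil by (auto simp: work_action_def stack_tape_def)
    next
      case (Cons s xs)
      then have "tops \<sigma> r = Some s" by (simp add: tops_def)
      then show ?thesis using Pop Cons stack_tape_pop[of s xs] by (simp add: sym_code_def)
    qed
  qed (use that in auto)
  have g': "good (\<lambda>r. act (A r) (\<sigma> r))"
    unfolding good_def
  proof (intro conjI allI impI)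
    fix r assume "r \<notin> set rs" then show "act (A r) (\<sigma> r) = []" using Par(1) g by (simp add: good_def)
  next
    fix r show "set (act (A r) (\<sigma> r)) \<subseteq> S"
      using Par(2)[of r] g set_tl_subset[of "\<sigma> r"] by (cases "A r") (auto simp: good_def)
  qed
  define tp where "tp = (\<lambda>r. if r \<in> set rs then sym_decode (fst (?\<tau> r) (snd (?\<tau> r))) else None)"
  have 2: "t2_step machine x (conf (Put A K) ?\<tau> h u) =
     conf (Run K) (\<lambda>r. work_action (?\<tau> r) (sym_code (fst (case A r of Push s \<Rightarrow> Some s | _ \<Rightarrow> tp r, Stay)),
        snd (case A r of Push s \<Rightarrow> Some s | _ \<Rightarrow> tp r, Stay))) h (u @ (case None of None \<Rightarrow> [] | Some a \<Rightarrow> [a]))"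
    by (rule machine_step) (use Par in \<open>auto simp: tp_def\<close>)
  have "work_action (?\<tau> r) (sym_code (fst (case A r of Push s \<Rightarrow> Some s | _ \<Rightarrow> tp r, Stay)),
        snd (case A r of Push s \<Rightarrow> Some s | _ \<Rightarrow> tp r, Stay)) = stack_tape (act (A r) (\<sigma> r))"
    if r: "r \<in> set rs" for r
  proof (cases "\<exists>s. A r = Push s")
    case True then show ?thesis using g stack_tape_push by (auto simp: tops_code)
  next
    case False
    then have t: "?\<tau> r = stack_tape (act (A r) (\<sigma> r))" using tau by auto
    have "tp r = tops (\<lambda>r. act (A r) (\<sigma> r)) r"
      using r tops_decode[OF g', of r] unfolding tp_def t by simp
    then show ?thesis
      unfolding t using False tops_code[OF g', of r] by (auto simp: stack_tape_stay split: action.splits)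
  qed
  then have "t2_step machine x (conf (Put A K) ?\<tau> h u) = sconf (Run K) (\<lambda>r. act (A r) (\<sigma> r), h, u)"
    unfolding 2 by (simp add: sconf_def conf_def)
  then show ?case using 1 g' by (auto intro: reaches_trans reaches_step)
next
  case (Read g h \<sigma> u st)
  have "map (\<lambda>j. x j h) [0..<n] \<in> {v. length v = n}" by simp
  then have sub: "conts (g (map (\<lambda>j. x j h) [0..<n])) K \<subseteq> control" and k: "Run (Read g # K) \<in> control"
    using Read.prems(2) by (auto simp del: length_map length_upt)
  have "t2_step machine x (sconf (Run (Read g # K)) (\<sigma>, h, u)) =
     sconf (Run (g (map (\<lambda>j. x j h) [0..<n]) # K)) (\<sigma>, Suc h, u @ (case None of None \<Rightarrow> [] | Some a \<Rightarrow> [a]))"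
    by (rule machine_step_idle) (use Read.prems sub k conts_head in auto)
  then show ?case using Read.IH[of K] Read.prems sub by (auto intro: reaches_trans reaches_step)
next
  case (Emit a \<sigma> h u)
  have "t2_step machine x (sconf (Run (Emit a # K)) (\<sigma>, h, u)) =
     sconf (Run K) (\<sigma>, h, u @ (case Some a of None \<Rightarrow> [] | Some a \<Rightarrow> [a]))"
    by (rule machine_step_idle) (use Emit.prems in auto)
  then show ?case using Emit.prems by (auto intro: reaches_step)
next
  case (Seq c st st' d st'')
  obtain \<sigma> h u where st: "st = (\<sigma>, h, u)" by (cases st)
  have "t2_step machine x (sconf (Run (Seq c d # K)) (\<sigma>, h, u)) =
     sconf (Run (c # d # K)) (\<sigma>, h, u @ (case None of None \<Rightarrow> [] | Some a \<Rightarrow> [a]))"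
    by (rule machine_step_idle) (use Seq.prems conts_head[of c "d # K"] st in auto)
  then show ?case
    using Seq.IH(1)[of "d # K"] Seq.IH(2)[of K] Seq.prems st
    by (auto intro: reaches_trans reaches_step)
next
  case (Case g \<sigma> h u st)
  have sub: "conts (g (tops \<sigma>)) K \<subseteq> control" and k: "Run (Case g # K) \<in> control"
    using Case.prems tops_good by auto
  have "t2_step machine x (sconf (Run (Case g # K)) (\<sigma>, h, u)) =
     sconf (Run (g (tops \<sigma>) # K)) (\<sigma>, h, u @ (case None of None \<Rightarrow> [] | Some a \<Rightarrow> [a]))"
    by (rule machine_step_idle) (use Case.prems sub k conts_head in auto)
  then show ?case using Case.IH[of K] Case.prems sub by (auto intro: reaches_trans reaches_step)
next
  case (While_False b \<sigma> c h u)
  have "t2_step machine x (sconf (Run (While b c # K)) (\<sigma>, h, u)) =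
     sconf (Run K) (\<sigma>, h, u @ (case None of None \<Rightarrow> [] | Some a \<Rightarrow> [a]))"
    by (rule machine_step_idle) (use While_False in auto)
  then show ?case using While_False by (auto intro: reaches_step)
next
  case (While_True b \<sigma> c h u st st')
  have "t2_step machine x (sconf (Run (While b c # K)) (\<sigma>, h, u)) =
     sconf (Run (c # While b c # K)) (\<sigma>, h, u @ (case None of None \<Rightarrow> [] | Some a \<Rightarrow> [a]))"
    by (rule machine_step_idle) (use While_True conts_head[of c "While b c # K"] in auto)
  then show ?case
    using While_True.IH(1)[of "While b c # K"] While_True.IH(2)[of K] While_True.prems
    by (auto intro: reaches_trans reaches_step)
qed

lemma machine_halt: "t2_halt machine = 0"
  by (simp add: machine_def)

lemma stack_tape_Nil: "stack_tape [] = (\<lambda>_. 0, 0)"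
  by (auto simp: stack_tape_def)

text \<open>
  Every round of the loop takes at least one step, so the loop head is reached arbitrarily late.
  There the output is that of \<open>st\<close>, and the machine has not halted.  As output is only appended and
  a halted machine stays halted, both facts carry over to all times in between.
\<close>

lemma machine_output:
  assumes st0: "st 0 = (\<lambda>_. [], 0, [])"
    and ex: "\<And>t. exec (set rs) S n x body (st t) (st (Suc t))"
    and pre: "\<And>t. snd (snd (st t)) = map y [0..<length (snd (snd (st t)))]"
    and unb: "\<And>m. \<exists>t. m \<le> length (snd (snd (st t)))"
  shows "t2_outputs_seq machine x y"
proof -
  let ?W = "While (\<lambda>_. True) body"
  let ?r = "t2_run machine x"
  have W: "Run [?W] \<in> control" "conts body [?W] \<subseteq> control"
    by (auto simp: control_def)
  have *: "\<exists>s\<ge>t. ?r s = sconf (Run [?W]) (st t) \<and> good (fst (st t))" for t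
  proof (induction t)
    case 0
    have "?r 0 = sconf (Run [?W]) (st 0)"
      by (simp add: t2_run_def t2_initial_def st0 sconf_def conf_def machine_def stack_tape_Nil map_replicate_const)
    then show ?case by (auto simp: st0 good_def)
  next
    case (Suc t)
    then obtain s where s: "s \<ge> t" "?r s = sconf (Run [?W]) (st t)" and g: "good (fst (st t))" by auto
    obtain \<sigma> h u where st: "st t = (\<sigma>, h, u)" by (cases "st t")
    have "t2_step machine x (sconf (Run [?W]) (\<sigma>, h, u)) =
       sconf (Run (body # [?W])) (\<sigma>, h, u @ (case None of None \<Rightarrow> [] | Some a \<Rightarrow> [a]))"
      by (rule machine_step_idle) (use g st W conts_head[of body "[?W]"] in auto)
    then have 1: "?r (Suc s) = sconf (Run (body # [?W])) (st t)"
      using s st by (simp add: t2_run_Suc)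
    from exec_reaches[OF ex g W(2)] obtain d where
      "good (fst (st (Suc t)))" and d: "(t2_step machine x ^^ d) (?r (Suc s)) = sconf (Run [?W]) (st (Suc t))"
      unfolding 1 reaches_def by auto
    moreover have "?r (d + Suc s) = (t2_step machine x ^^ d) (?r (Suc s))"
      by (simp only: t2_run_def funpow_add comp_apply)
    ultimately show ?case using s(1) by (intro exI[of _ "d + Suc s"]) auto
  qed
  have sc: "c_state (sconf (Run [?W]) s) \<noteq> 0" "c_output (sconf (Run [?W]) s) = snd (snd s)" for s
    by (auto simp: sconf_def conf_def ctl_code_def split: prod.splits)
  have halt: "c_state (?r t) \<noteq> t2_halt machine" for t
  proof
    assume h: "c_state (?r t) = t2_halt machine"
    obtain s where s: "s \<ge> t" "?r s = sconf (Run [?W]) (st t)" using * by blast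
    then show False using t2_run_halted[OF h s(1)] h sc(1)[of "st t"] by (simp add: machine_halt)
  qed
  have out: "c_output (?r t) = map y [0..<length (c_output (?r t))]" for t
  proof -
    obtain s where s: "s \<ge> t" "?r s = sconf (Run [?W]) (st t)" using * by blast
    obtain v where v: "snd (snd (st t)) = c_output (?r t) @ v"
      using t2_run_output_mono[of machine x t "s - t"] s sc(2)[of "st t"] by auto
    have "c_output (?r t) = take (length (c_output (?r t))) (snd (snd (st t)))" by (simp add: v)
    also have "\<dots> = map y [0..<length (c_output (?r t))]"
      by (subst pre) (simp add: take_map v)
    finally show ?thesis .
  qed
  show ?thesis
    unfolding t2_outputs_seq_def
  proof (intro conjI allI)
    fix m
    obtain t where "m \<le> length (snd (snd (st t)))" using unb by blast
    moreover obtain s where "?r s = sconf (Run [?W]) (st t)" using * by blast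
    ultimately show "\<exists>t. m \<le> length (c_output (?r t))" using sc(2) by (intro exI[of _ s]) simp
  qed (use halt out in auto)
qed

end

theorem stack_program_computable:
  fixes R :: "'r set" and S :: "'s set" and body :: "('r, 's, 'a::finite) com"
  assumes "finite R" "finite S"
  shows "\<exists>M. type2_machine M \<and> t2_inputs M = n \<and>
     (\<forall>x y st. st 0 = (\<lambda>_. [], 0, []) \<and> (\<forall>t. exec R S n x body (st t) (st (Suc t))) \<and>
        (\<forall>t. snd (snd (st t)) = map y [0..<length (snd (snd (st t)))]) \<and>
        (\<forall>m. \<exists>t. m \<le> length (snd (snd (st t)))) \<longrightarrow> t2_outputs_seq M x y)"
proof -
  obtain rs where rs: "set rs = R" "distinct rs" using finite_distinct_list[OF assms(1)] by auto
  interpret stack_compiler rs S n body by unfold_locales (use rs assms in auto)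
  show ?thesis
    using type2_machine_machine machine_output unfolding rs(1)
    by (intro exI[of _ machine]) (auto simp: machine_def)
qed

section \<open>Building blocks of stack programs\<close>

text \<open>
  The dummy \<open>ty\<close> fixes the type of the input symbols, on which \<open>R\<close>, \<open>S\<close> and \<open>n\<close> do not
  depend.
\<close>

locale stack_programs =
  fixes R :: "'r set" and S :: "'s set" and n :: nat and ty :: "'a itself"
  assumes finite_R: "finite R"
begin

text \<open>
  Execution without input and output.
\<close>

definition runs :: "('r, 's, 'a) com \<Rightarrow> ('r \<Rightarrow> 's list) \<Rightarrow> ('r \<Rightarrow> 's list) \<Rightarrow> bool" where
  "runs c \<sigma> \<sigma>' \<longleftrightarrow> (\<forall>x h u. exec R S n x c (\<sigma>, h, u) (\<sigma>', h, u))"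

definition ok :: "('r \<Rightarrow> 's list) \<Rightarrow> bool" where
  "ok \<sigma> \<longleftrightarrow> (\<forall>r. set (\<sigma> r) \<subseteq> S)"

lemma exec_ok: "exec R S n x c st st' \<Longrightarrow> ok (fst st) \<Longrightarrow> ok (fst st')"
proof (induction rule: exec.induct)
  case (Par A \<sigma> h u)
  have "set (act (A r) (\<sigma> r)) \<subseteq> S" for r
    using Par(2)[of r] Par(3) set_tl_subset[of "\<sigma> r"] by (cases "A r") (auto simp: ok_def)
  then show ?case by (simp add: ok_def)
qed auto

lemma runs_ok: "runs c \<sigma> \<sigma>' \<Longrightarrow> ok \<sigma> \<Longrightarrow> ok \<sigma>'"
  using exec_ok[of undefined c "(\<sigma>, 0, [])" "(\<sigma>', 0, [])"] by (simp add: runs_def)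

lemma runs_Par: 
  "(\<And>r. r \<notin> R \<Longrightarrow> A r = Keep) \<Longrightarrow> (\<And>r s. A r = Push s \<Longrightarrow> s \<in> S) \<Longrightarrow>
    (\<And>r. act (A r) (\<sigma> r) = \<sigma>' r) \<Longrightarrow> runs (Par A) \<sigma> \<sigma>'"
proof -
  assume a: "\<And>r. r \<notin> R \<Longrightarrow> A r = Keep" "\<And>r s. A r = Push s \<Longrightarrow> s \<in> S" "\<And>r. act (A r) (\<sigma> r) = \<sigma>' r"
  have "\<sigma>' = (\<lambda>r. act (A r) (\<sigma> r))" using a(3) by auto
  then show ?thesis unfolding runs_def by (simp only:) (intro allI exec.Par a(1,2))
qed

lemma runs_Seq: "runs c \<sigma> \<sigma>1 \<Longrightarrow> runs d \<sigma>1 \<sigma>2 \<Longrightarrow> runs (Seq c d) \<sigma> \<sigma>2"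
  unfolding runs_def by (blast intro: exec.Seq)

lemma runs_Case: "runs (g (tops \<sigma>)) \<sigma> \<sigma>' \<Longrightarrow> runs (Case g) \<sigma> \<sigma>'"
  by (auto simp: runs_def intro: exec.Case)

lemma runs_While_False: "\<not> b (tops \<sigma>) \<Longrightarrow> runs (While b c) \<sigma> \<sigma>"
  by (auto simp: runs_def intro: exec.While_False)

lemma runs_While_True: "b (tops \<sigma>) \<Longrightarrow> runs c \<sigma> \<sigma>1 \<Longrightarrow> runs (While b c) \<sigma>1 \<sigma>2 \<Longrightarrow> runs (While b c) \<sigma> \<sigma>2"
  unfolding runs_def by (meson exec.While_True)

definition skip :: "('r, 's, 'a) com" where "skip = Par (\<lambda>_. Keep)"

lemma runs_skip: "runs skip \<sigma> \<sigma>"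
  unfolding skip_def by (rule runs_Par) auto

definition push :: "'r \<Rightarrow> 's \<Rightarrow> ('r, 's, 'a) com" where "push r s = Par ((\<lambda>_. Keep)(r := Push s))"

lemma runs_push: "r \<in> R \<Longrightarrow> s \<in> S \<Longrightarrow> runs (push r s) \<sigma> (\<sigma>(r := s # \<sigma> r))"
  unfolding push_def by (rule runs_Par) (auto split: if_splits)

definition pop :: "'r \<Rightarrow> ('r, 's, 'a) com" where "pop r = Par ((\<lambda>_. Keep)(r := Pop))"

lemma runs_pop: "r \<in> R \<Longrightarrow> runs (pop r) \<sigma> (\<sigma>(r := tl (\<sigma> r)))"
  unfolding pop_def by (rule runs_Par) (auto split: if_splits)

definition move_while :: "('s \<Rightarrow> bool) \<Rightarrow> 'r \<Rightarrow> 'r \<Rightarrow> ('r, 's, 'a) com" where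
  "move_while P r q =
     While (\<lambda>tp. \<exists>s. tp r = Some s \<and> P s) (Case (\<lambda>tp. Par ((\<lambda>_. Keep)(r := Pop, q := Push (the (tp r))))))"

lemma runs_move_while:
  assumes "r \<in> R" "q \<in> R" "r \<noteq> q" "set xs \<subseteq> S" "\<forall>s\<in>set xs. P s" "ys = [] \<or> \<not> P (hd ys)" "\<sigma> r = xs @ ys"
  shows "runs (move_while P r q) \<sigma> (\<sigma>(r := ys, q := rev xs @ \<sigma> q))"
  using assms(4-)
proof (induction xs arbitrary: \<sigma>)
  case Nil
  then have eq: "\<sigma>(r := ys, q := rev [] @ \<sigma> q) = \<sigma>" by auto
  show ?case
    unfolding move_while_def eq by (rule runs_While_False) (use Nil in \<open>auto simp: tops_eq_Some\<close>)
next
  case (Cons s xs)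
  let ?\<sigma>1 = "\<sigma>(r := xs @ ys, q := s # \<sigma> q)"
  have t: "tops \<sigma> r = Some s" using Cons.prems by (simp add: tops_eq_Some)
  have 1: "runs (Case (\<lambda>tp. Par ((\<lambda>_. Keep)(r := Pop, q := Push (the (tp r)))))) \<sigma> ?\<sigma>1"
    by (rule runs_Case, rule runs_Par) (use Cons.prems assms(1-3) t in \<open>auto split: if_splits\<close>)
  have "runs (move_while P r q) ?\<sigma>1 (?\<sigma>1(r := ys, q := rev xs @ ?\<sigma>1 q))"
    by (rule Cons.IH) (use Cons.prems assms(3) in auto)
  moreover have "?\<sigma>1(r := ys, q := rev xs @ ?\<sigma>1 q) = \<sigma>(r := ys, q := rev (s # xs) @ \<sigma> q)"
    using assms(3) by (auto simp: fun_eq_iff)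
  ultimately have 2: "runs (move_while P r q) ?\<sigma>1 (\<sigma>(r := ys, q := rev (s # xs) @ \<sigma> q))" by simp
  show ?case
    unfolding move_while_def
    by (rule runs_While_True[OF _ 1 2[unfolded move_while_def]]) (use t Cons.prems in simp)
qed

definition move_all :: "'r \<Rightarrow> 'r \<Rightarrow> ('r, 's, 'a) com" where
  "move_all = move_while (\<lambda>_. True)"

lemma runs_move_all:
  assumes "r \<in> R" "q \<in> R" "r \<noteq> q" "set (\<sigma> r) \<subseteq> S"
  shows "runs (move_all r q) \<sigma> (\<sigma>(r := [], q := rev (\<sigma> r) @ \<sigma> q))"
  unfolding move_all_def by (rule runs_move_while) (use assms in auto)

text \<open>
  Reading a stack destroys it, so a copy is made by emptying a stack onto two others.
\<close>

definition fork :: "'r \<Rightarrow> 'r \<Rightarrow> 'r \<Rightarrow> ('r, 's, 'a) com" where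
  "fork r p q =
     While (\<lambda>tp. tp r \<noteq> None)
       (Case (\<lambda>tp. Par ((\<lambda>_. Keep)(r := Pop, p := Push (the (tp r)), q := Push (the (tp r))))))"

lemma runs_fork:
  assumes "r \<in> R" "p \<in> R" "q \<in> R" "r \<noteq> p" "r \<noteq> q" "p \<noteq> q" "set (\<sigma> r) \<subseteq> S"
  shows "runs (fork r p q) \<sigma> (\<sigma>(r := [], p := rev (\<sigma> r) @ \<sigma> p, q := rev (\<sigma> r) @ \<sigma> q))"
  using assms(7)
proof (induction "\<sigma> r" arbitrary: \<sigma>)
  case Nil
  then have eq: "\<sigma>(r := [], p := rev (\<sigma> r) @ \<sigma> p, q := rev (\<sigma> r) @ \<sigma> q) = \<sigma>" by (auto simp: fun_eq_iff)
  show ?case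
    unfolding fork_def eq by (rule runs_While_False) (use Nil in simp)
next
  case (Cons s xs)
  let ?\<sigma>1 = "\<sigma>(r := xs, p := s # \<sigma> p, q := s # \<sigma> q)"
  have r: "\<sigma> r = s # xs" using Cons by simp
  then have t: "tops \<sigma> r = Some s" by (simp add: tops_eq_Some)
  have 1: "runs (Case (\<lambda>tp. Par ((\<lambda>_. Keep)(r := Pop, p := Push (the (tp r)), q := Push (the (tp r)))))) \<sigma> ?\<sigma>1"
    by (rule runs_Case, rule runs_Par) (use Cons.prems assms(1-6) t r in \<open>auto split: if_splits\<close>)
  have "runs (fork r p q) ?\<sigma>1 (?\<sigma>1(r := [], p := rev (?\<sigma>1 r) @ ?\<sigma>1 p, q := rev (?\<sigma>1 r) @ ?\<sigma>1 q))"
    by (rule Cons.hyps(1)) (use Cons.prems r assms(4-6) in auto)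
  moreover have "?\<sigma>1(r := [], p := rev (?\<sigma>1 r) @ ?\<sigma>1 p, q := rev (?\<sigma>1 r) @ ?\<sigma>1 q) =
      \<sigma>(r := [], p := rev (\<sigma> r) @ \<sigma> p, q := rev (\<sigma> r) @ \<sigma> q)"
    using assms(4-6) r by (auto simp: fun_eq_iff)
  ultimately have 2: "runs (fork r p q) ?\<sigma>1 (\<sigma>(r := [], p := rev (\<sigma> r) @ \<sigma> p, q := rev (\<sigma> r) @ \<sigma> q))"
    by simp
  show ?case
    unfolding fork_def by (rule runs_While_True[OF _ 1 2[unfolded fork_def]]) (use t in simp)
qed

definition copy :: "'r \<Rightarrow> 'r \<Rightarrow> 'r \<Rightarrow> ('r, 's, 'a) com" where
  "copy t r q = Seq (move_all r t) (fork t r q)"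

lemma runs_copy:
  assumes "t \<in> R" "r \<in> R" "q \<in> R" "t \<noteq> r" "t \<noteq> q" "r \<noteq> q" "set (\<sigma> r) \<subseteq> S" "\<sigma> t = []"
  shows "runs (copy t r q) \<sigma> (\<sigma>(q := \<sigma> r @ \<sigma> q))"
proof -
  let ?\<sigma>1 = "\<sigma>(r := [], t := rev (\<sigma> r) @ \<sigma> t)"
  have "runs (fork t r q) ?\<sigma>1 (?\<sigma>1(t := [], r := rev (?\<sigma>1 t) @ ?\<sigma>1 r, q := rev (?\<sigma>1 t) @ ?\<sigma>1 q))"
    by (rule runs_fork) (use assms in auto)
  moreover have "?\<sigma>1(t := [], r := rev (?\<sigma>1 t) @ ?\<sigma>1 r, q := rev (?\<sigma>1 t) @ ?\<sigma>1 q) = \<sigma>(q := \<sigma> r @ \<sigma> q)"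
    using assms(4-8) by (auto simp: fun_eq_iff)
  ultimately show ?thesis
    unfolding copy_def using runs_Seq[OF runs_move_all[of r t \<sigma>]] assms by metis
qed

definition copy_rev :: "'r \<Rightarrow> 'r \<Rightarrow> 'r \<Rightarrow> ('r, 's, 'a) com" where
  "copy_rev t r q = Seq (fork r t q) (move_all t r)"

lemma runs_copy_rev:
  assumes "t \<in> R" "r \<in> R" "q \<in> R" "t \<noteq> r" "t \<noteq> q" "r \<noteq> q" "set (\<sigma> r) \<subseteq> S" "\<sigma> t = []"
  shows "runs (copy_rev t r q) \<sigma> (\<sigma>(q := rev (\<sigma> r) @ \<sigma> q))"
proof -
  let ?\<sigma>1 = "\<sigma>(r := [], t := rev (\<sigma> r) @ \<sigma> t, q := rev (\<sigma> r) @ \<sigma> q)"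
  have "runs (move_all t r) ?\<sigma>1 (?\<sigma>1(t := [], r := rev (?\<sigma>1 t) @ ?\<sigma>1 r))"
    by (rule runs_move_all) (use assms in auto)
  moreover have "?\<sigma>1(t := [], r := rev (?\<sigma>1 t) @ ?\<sigma>1 r) = \<sigma>(q := rev (\<sigma> r) @ \<sigma> q)"
    using assms(4-8) by (auto simp: fun_eq_iff)
  moreover have "runs (fork r t q) \<sigma> ?\<sigma>1"
    by (rule runs_fork) (use assms in auto)
  ultimately show ?thesis
    unfolding copy_rev_def using runs_Seq by metis
qed

definition clear :: "'r set \<Rightarrow> ('r, 's, 'a) com" where
  "clear X = While (\<lambda>tp. \<exists>r\<in>X. tp r \<noteq> None) (Par (\<lambda>r. if r \<in> X then Pop else Keep))"

lemma runs_clear: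
  assumes X: "X \<subseteq> R"
  shows "runs (clear X) \<sigma> (\<lambda>r. if r \<in> X then [] else \<sigma> r)"
proof -
  have "runs (clear X) \<sigma> (\<lambda>r. if r \<in> X then [] else \<sigma> r)" if "\<forall>r\<in>X. length (\<sigma> r) \<le> k" for k \<sigma>
    using that
  proof (induction k arbitrary: \<sigma>)
    case 0
    then have e: "\<forall>r\<in>X. \<sigma> r = []" by auto
    then have "(\<lambda>r. if r \<in> X then [] else \<sigma> r) = \<sigma>" by auto
    moreover have "runs (clear X) \<sigma> \<sigma>" unfolding clear_def by (rule runs_While_False) (use e in simp)
    ultimately show ?case by simp
  next
    case (Suc k)
    show ?case
    proof (cases "\<exists>r\<in>X. \<sigma> r \<noteq> []")
      case True
      have 1: "runs (Par (\<lambda>r. if r \<in> X then Pop else Keep)) \<sigma> (\<lambda>r. if r \<in> X then tl (\<sigma> r) else \<sigma> r)"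
        by (rule runs_Par) (use X in \<open>auto split: if_splits\<close>)
      have "runs (clear X) (\<lambda>r. if r \<in> X then tl (\<sigma> r) else \<sigma> r)
          (\<lambda>r. if r \<in> X then [] else (\<lambda>r. if r \<in> X then tl (\<sigma> r) else \<sigma> r) r)"
        by (rule Suc.IH) (use Suc.prems in auto)
      also have "(\<lambda>r. if r \<in> X then [] else (\<lambda>r. if r \<in> X then tl (\<sigma> r) else \<sigma> r) r) = (\<lambda>r. if r \<in> X then [] else \<sigma> r)"
        by auto
      finally have 2: "runs (clear X) (\<lambda>r. if r \<in> X then tl (\<sigma> r) else \<sigma> r) (\<lambda>r. if r \<in> X then [] else \<sigma> r)" .
      show ?thesis
        unfolding clear_def
        by (rule runs_While_True[OF _ 1 2[unfolded clear_def]]) (use True in simp)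
    next
      case False
      then have "(\<lambda>r. if r \<in> X then [] else \<sigma> r) = \<sigma>" by auto
      moreover have "runs (clear X) \<sigma> \<sigma>" unfolding clear_def by (rule runs_While_False) (use False in simp)
      ultimately show ?thesis by simp
    qed
  qed
  moreover have "finite X" using X finite_R finite_subset by blast
  then have "\<forall>r\<in>X. length (\<sigma> r) \<le> Max ((\<lambda>r. length (\<sigma> r)) ` X)" by simp
  ultimately show ?thesis by blast
qed

definition Seqs :: "('r, 's, 'a) com list \<Rightarrow> ('r, 's, 'a) com" where
  "Seqs cs = foldr Seq cs skip"

lemma runs_Seqs_upt:
  assumes step: "\<And>j. j < k \<Longrightarrow> runs (c j) (\<sigma> j) (\<sigma> (Suc j))"
  shows "runs (Seqs (map c [0..<k])) (\<sigma> 0) (\<sigma> k)"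
proof -
  have "runs (Seqs (map c [i..<k])) (\<sigma> i) (\<sigma> k)" if "i \<le> k" for i
    using that
  proof (induction rule: inc_induct)
    case base
    then show ?case by (simp add: Seqs_def runs_skip)
  next
    case (step i)
    then show ?case using runs_Seq[OF assms] by (simp add: upt_conv_Cons Seqs_def)
  qed
  then show ?thesis by simp
qed

end

section \<open>Tapes as pairs of stacks\<close>

text \<open>
  The infinite sequence \<open>f\<close> continues the stack \<open>xs\<close> with the default \<open>d\<close>: one half of a tape.
\<close>

definition half :: "'b \<Rightarrow> (nat \<Rightarrow> 'b) \<Rightarrow> 'b list \<Rightarrow> bool" where
  "half d f xs \<longleftrightarrow> (\<forall>k. (if k < length xs then xs ! k else d) = f k)"

lemma half_Nil: "half d f [] \<longleftrightarrow> (\<forall>k. f k = d)"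
  by (auto simp: half_def)

lemma half_Cons: "half d f (s # xs) \<longleftrightarrow> f 0 = s \<and> half d (\<lambda>k. f (Suc k)) xs"
proof
  assume h: "half d f (s # xs)"
  have "f 0 = s" using h[unfolded half_def, rule_format, of 0] by simp
  moreover have "(if k < length xs then xs ! k else d) = f (Suc k)" for k
    using h[unfolded half_def, rule_format, of "Suc k"] by (simp split: if_splits)
  ultimately show "f 0 = s \<and> half d (\<lambda>k. f (Suc k)) xs" by (simp add: half_def)
next
  assume h: "f 0 = s \<and> half d (\<lambda>k. f (Suc k)) xs"
  then have "(if k < length (s # xs) then (s # xs) ! k else d) = f k" for k
    using h[THEN conjunct2, unfolded half_def, rule_format, of "k - 1"]
    by (cases k) (simp_all split: if_splits)
  then show "half d f (s # xs)" by (simp add: half_def)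
qed

lemma half_tl: "half d f xs \<Longrightarrow> half d (\<lambda>k. f (Suc k)) (tl xs)"
  by (cases xs) (auto simp: half_Nil half_Cons)

lemma half_top: "half d f xs \<Longrightarrow> (case xs of [] \<Rightarrow> d | s # _ \<Rightarrow> s) = f 0"
  by (cases xs) (auto simp: half_Nil half_Cons)

text \<open>
  The tape \<open>\<tau>\<close> with the head at \<open>z\<close>: the scanned cell and those to its right are in \<open>xr\<close>, those to
  its left in \<open>xl\<close>, the nearest on top.
\<close>

definition two_stacks :: "'b \<Rightarrow> 'b \<Rightarrow> (int \<Rightarrow> 'b) \<Rightarrow> int \<Rightarrow> 'b list \<Rightarrow> 'b list \<Rightarrow> bool" where
  "two_stacks d e \<tau> z xl xr \<longleftrightarrow> half d (\<lambda>k. \<tau> (z - 1 - int k)) xl \<and> half e (\<lambda>k. \<tau> (z + int k)) xr"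

lemma half_cong: "half d f xs \<Longrightarrow> (\<And>k. f k = g k) \<Longrightarrow> half d g xs"
  by (simp add: half_def)

context
  fixes d e :: 'b and \<tau> :: "int \<Rightarrow> 'b" and z :: int and xl xr :: "'b list"
  assumes two_stacks: "two_stacks d e \<tau> z xl xr"
begin

lemma two_stacks_halves: "half d (\<lambda>k. \<tau> (z - 1 - int k)) xl" "half e (\<lambda>k. \<tau> (z + int k)) xr"
  using two_stacks by (auto simp: two_stacks_def)

lemma two_stacks_current: "(case xr of [] \<Rightarrow> e | s # _ \<Rightarrow> s) = \<tau> z"
  using half_top[OF two_stacks_halves(2)] by simp

lemma two_stacks_tl: "half e (\<lambda>k. (\<tau>(z := s)) (z + 1 + int k)) (tl xr)"
  by (rule half_cong[OF half_tl[OF two_stacks_halves(2)]]) (simp add: add_ac)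

lemma two_stacks_Right: "two_stacks d e (\<tau>(z := s)) (z + 1) (s # xl) (tl xr)"
  unfolding two_stacks_def half_Cons
  by (intro conjI two_stacks_tl half_cong[OF two_stacks_halves(1)]) (simp_all add: algebra_simps)

lemma two_stacks_Stay: "two_stacks d e (\<tau>(z := s)) z xl (s # tl xr)"
  unfolding two_stacks_def half_Cons
  by (intro conjI half_cong[OF two_stacks_tl[of s]] half_cong[OF two_stacks_halves(1)]) (simp_all add: algebra_simps)

lemma two_stacks_Left:
  "two_stacks d e (\<tau>(z := s)) (z - 1) (tl xl) ((case xl of [] \<Rightarrow> d | s # _ \<Rightarrow> s) # s # tl xr)"
  unfolding two_stacks_def half_Cons half_top[OF two_stacks_halves(1)]
  by (intro conjI half_cong[OF two_stacks_tl[of s]] half_cong[OF half_tl[OF two_stacks_halves(1)]])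
     (simp_all add: algebra_simps)

end

section \<open>Simulating a Type-2 machine\<close>

text \<open>
  The first line holds the tapes of the generalized machine (the scanned cell in \<open>Cur\<close>, the cells on
  either side in \<open>Lft\<close> and \<open>Rgt\<close>) and the prefixes of the inputs; the second line the rest of its
  configuration, the number of the stage, the steps left in it, the number of emitted symbols, and an
  auxiliary stack; the third line a simulated Type-2 machine and the steps left for it.  Numbers are
  in unary.
\<close>

datatype reg =
    Lft nat | Cur nat | Rgt nat | Prefix nat
  | Label | Moves | Clock | Fuel | Emitted | Tmp
  | State | Output | Ticks | TapeL nat | TapeR nat

text \<open>
  \<open>Num\<close> stands for states and work tape symbols of Type-2 machines.  \<open>Tag\<close> distinguishes a cell with
  a word from one with a symbol, \<open>Sep\<close> ends a cell in a stack of cells, and \<open>Mark\<close> is the unary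
  digit.  On simulated input tapes \<open>Mark\<close> is the blank and \<open>Tag\<close> an unknown symbol; on the stack
  \<open>Moves\<close> they are a move to the right and to the left.
\<close>

datatype ('l, 'g, 'a) sym = Letter 'a | Gam 'g | Lab 'l | Num nat | Tag | Sep | Mark

fun reg_index :: "reg \<Rightarrow> nat" where
  "reg_index (Lft i) = i" | "reg_index (Cur i) = i" | "reg_index (Rgt i) = i"
| "reg_index (Prefix i) = i" | "reg_index (TapeL i) = i" | "reg_index (TapeR i) = i"
| "reg_index _ = 0"

fun scratch :: "reg \<Rightarrow> bool" where
  "scratch State = True" | "scratch Output = True" | "scratch (TapeL i) = True" | "scratch (TapeR i) = True"
| "scratch _ = False"

lemma finite_reg_index: "finite {r. reg_index r \<le> k}"
proof (rule finite_subset)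
  show "{r. reg_index r \<le> k} \<subseteq> (\<Union>i\<in>{..k}. {Lft i, Cur i, Rgt i, Prefix i, TapeL i, TapeR i}) \<union>
      {Label, Moves, Clock, Fuel, Emitted, Tmp, State, Output, Ticks}"
  proof
    fix r assume "r \<in> {r. reg_index r \<le> k}"
    then show "r \<in> (\<Union>i\<in>{..k}. {Lft i, Cur i, Rgt i, Prefix i, TapeL i, TapeR i}) \<union>
      {Label, Moves, Clock, Fuel, Emitted, Tmp, State, Output, Ticks}" by (cases r) auto
  qed
qed simp

definition tape_symbol :: "'a list \<Rightarrow> int \<Rightarrow> ('l, 'g, 'a) sym" where
  "tape_symbol w z = (if z < 0 then Mark else if z < int (length w) then Letter (w ! nat z) else Tag)"

definition read_letter :: "('l, 'g, 'a) sym option \<Rightarrow> 'a option" where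
  "read_letter so = (case so of Some (Letter a) \<Rightarrow> Some a | _ \<Rightarrow> None)"

definition read_num :: "nat \<Rightarrow> ('l, 'g, 'a) sym option \<Rightarrow> nat" where
  "read_num d so = (case so of Some (Num v) \<Rightarrow> v | _ \<Rightarrow> d)"

text \<open>
  The condition on the length makes \<open>TapeR j\<close> empty exactly when head \<open>j\<close> has reached the end of its
  word, which is how the program notices that the run is suspended.
\<close>

definition represents :: "'a t2m \<Rightarrow> (nat \<Rightarrow> 'a list) \<Rightarrow> 'a t2conf \<Rightarrow> (reg \<Rightarrow> ('l, 'g, 'a) sym list) \<Rightarrow> bool" where
  "represents M w c \<sigma> \<longleftrightarrow>
     \<sigma> State = [Num (c_state c)] \<and> \<sigma> Output = rev (map Letter (c_output c)) \<and>
     (\<forall>j<t2_inputs M.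
        two_stacks Mark Tag (tape_symbol (w j)) (c_heads c ! j) (\<sigma> (TapeL j)) (\<sigma> (TapeR j)) \<and>
        int (length (\<sigma> (TapeR j))) = int (length (w j)) - c_heads c ! j) \<and>
     (\<forall>k<t2_works M.
        two_stacks (Num (t2_blank M)) (Num (t2_blank M)) (\<lambda>z. Num (fst (c_works c ! k) z))
          (snd (c_works c ! k)) (\<sigma> (TapeL (t2_inputs M + k))) (\<sigma> (TapeR (t2_inputs M + k))))"

definition left_stack :: "head_move \<Rightarrow> 's \<Rightarrow> 's list \<Rightarrow> 's list" where
  "left_stack m s xl = (case m of Right \<Rightarrow> s # xl | Stay \<Rightarrow> xl | Left \<Rightarrow> tl xl)"

definition right_stack :: "head_move \<Rightarrow> 's \<Rightarrow> 's \<Rightarrow> 's list \<Rightarrow> 's list \<Rightarrow> 's list" where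
  "right_stack m s d xl xr =
     (case m of Right \<Rightarrow> tl xr | Stay \<Rightarrow> s # tl xr
      | Left \<Rightarrow> (case xl of [] \<Rightarrow> d | s # _ \<Rightarrow> s) # s # tl xr)"

lemma two_stacks_moved:
  assumes "two_stacks d e \<tau> z xl xr"
  shows "two_stacks d e (\<tau>(z := s)) (moved m z) (left_stack m s xl) (right_stack m s d xl xr)"
  using two_stacks_Right[OF assms] two_stacks_Stay[OF assms] two_stacks_Left[OF assms]
  by (cases m) (simp_all add: left_stack_def right_stack_def)

text \<open>
  For each tape, input tapes first: the symbol to be written, the move of the head, and the symbol in
  the cells to the left of those on the stack.  On an input tape the scanned symbol is written back.
\<close>

definition machine_acts ::
  "'a t2m \<Rightarrow> (reg \<Rightarrow> ('l, 'g, 'a) sym option) \<Rightarrow> head_move list \<Rightarrow> (nat \<times> head_move) list \<Rightarrow> nat \<Rightarrow>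
     ('l, 'g, 'a) sym \<times> head_move \<times> ('l, 'g, 'a) sym" where
  "machine_acts M tp ms as i =
     (if i < t2_inputs M then (the (tp (TapeR i)), ms ! i, Mark)
      else (Num (fst (as ! (i - t2_inputs M))), snd (as ! (i - t2_inputs M)), Num (t2_blank M)))"

text \<open>
  The three actions remove the scanned symbols, put the new ones on the side of the head given by
  the move, and, for a move to the left, bring the next symbol over from the left stack.
\<close>

definition tape_ops ::
  "nat \<Rightarrow> (nat \<Rightarrow> 's \<times> head_move \<times> 's) \<Rightarrow> (reg \<Rightarrow> 's option) \<Rightarrow> 's \<Rightarrow> 's option \<Rightarrow> (reg, 's, 'a) com" where
  "tape_ops k acts tp s' out =
     Seq (Par (\<lambda>r. case r of
              State \<Rightarrow> Pop
            | Output \<Rightarrow> (case out of None \<Rightarrow> Keep | Some a \<Rightarrow> Push a)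
            | TapeR i \<Rightarrow> if i < k then Pop else Keep
            | _ \<Rightarrow> Keep))
    (Seq (Par (\<lambda>r. case r of
              State \<Rightarrow> Push s'
            | TapeL i \<Rightarrow> if i < k \<and> fst (snd (acts i)) = Right then Push (fst (acts i)) else Keep
            | TapeR i \<Rightarrow> if i < k \<and> fst (snd (acts i)) \<noteq> Right then Push (fst (acts i)) else Keep
            | _ \<Rightarrow> Keep))
         (Par (\<lambda>r. case r of
              TapeL i \<Rightarrow> if i < k \<and> fst (snd (acts i)) = Left then Pop else Keep
            | TapeR i \<Rightarrow> if i < k \<and> fst (snd (acts i)) = Left
                then Push (case tp (TapeL i) of None \<Rightarrow> snd (snd (acts i)) | Some s \<Rightarrow> s) else Keep
            | _ \<Rightarrow> Keep)))"

definition machine_step :: "'a t2m \<Rightarrow> (reg, ('l, 'g, 'a) sym, 'a) com" where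
  "machine_step M = Case (\<lambda>tp.
     case t2_delta M (read_num 0 (tp State)) (map (\<lambda>j. read_letter (tp (TapeR j))) [0..<t2_inputs M])
            (map (\<lambda>k. read_num (t2_blank M) (tp (TapeR (t2_inputs M + k)))) [0..<t2_works M])
     of (s', ms, as, out) \<Rightarrow>
       tape_ops (t2_inputs M + t2_works M) (machine_acts M tp ms as) tp (Num s') (map_option Letter out))"

text \<open>
  The programs refer to finitely many registers and symbols only, which depend on \<open>N\<close> and the
  machines \<open>Mc l\<close>.
\<close>

context simulation
begin

definition index_bound :: nat where
  "index_bound = Suc (arity N + last_tape N + (\<Sum>l\<in>labels N. t2_inputs (Mc l) + t2_works (Mc l)))"

definition registers :: "reg set" where "registers = {r. reg_index r \<le> index_bound}"

definition symbols :: "('l, 'g, 'a) sym set" where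
  "symbols = {Tag, Sep, Mark} \<union> range Letter \<union> Gam ` gamma N \<union> Lab ` labels N \<union>
     Num ` (\<Union>l\<in>labels N. t2_states (Mc l) \<union> t2_symbols (Mc l))"

sublocale stack_programs registers symbols "arity N" "TYPE('a)"
  by unfold_locales (simp add: registers_def finite_reg_index)

lemma finite_symbols: "finite symbols"
  using N machines by (simp add: symbols_def generalized_TM_def type2_machine_def)

lemma symbols_simps [simp]:
  "Tag \<in> symbols" "Sep \<in> symbols" "Mark \<in> symbols" "Letter a \<in> symbols"
  "Gam g \<in> symbols \<longleftrightarrow> g \<in> gamma N" "Lab l \<in> symbols \<longleftrightarrow> l \<in> labels N"
  by (auto simp: symbols_def)

lemma Num_symbols: "l \<in> labels N \<Longrightarrow> v \<in> t2_states (Mc l) \<union> t2_symbols (Mc l) \<Longrightarrow> Num v \<in> symbols"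
  by (auto simp: symbols_def)

lemma index_bound_tapes: "i < last_tape N + arity N + 2 \<Longrightarrow> i \<le> index_bound"
  by (simp add: index_bound_def)

lemma index_bound_machine:
  assumes "l \<in> labels N" "i < t2_inputs (Mc l) + t2_works (Mc l)"
  shows "i \<le> index_bound"
proof -
  have "finite (labels N)" using N by (simp add: generalized_TM_def)
  then have "t2_inputs (Mc l) + t2_works (Mc l) \<le> (\<Sum>l\<in>labels N. t2_inputs (Mc l) + t2_works (Mc l))"
    using assms(1) by (intro member_le_sum) auto
  then show ?thesis using assms(2) by (simp add: index_bound_def)
qed

lemma registers_simps [simp]:
  "Label \<in> registers" "Moves \<in> registers" "Clock \<in> registers" "Fuel \<in> registers" "Emitted \<in> registers"
  "Tmp \<in> registers" "State \<in> registers" "Output \<in> registers" "Ticks \<in> registers"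
  "Lft i \<in> registers \<longleftrightarrow> i \<le> index_bound" "Cur i \<in> registers \<longleftrightarrow> i \<le> index_bound"
  "Rgt i \<in> registers \<longleftrightarrow> i \<le> index_bound" "Prefix i \<in> registers \<longleftrightarrow> i \<le> index_bound"
  "TapeL i \<in> registers \<longleftrightarrow> i \<le> index_bound" "TapeR i \<in> registers \<longleftrightarrow> i \<le> index_bound"
  by (simp_all add: registers_def)

lemma runs_tape_ops:
  assumes k: "\<And>i. i < k \<Longrightarrow> i \<le> index_bound"
    and acts: "\<And>i. i < k \<Longrightarrow> fst (acts i) \<in> symbols" "\<And>i. i < k \<Longrightarrow> snd (snd (acts i)) \<in> symbols"
    and s': "s' \<in> symbols" and out: "\<And>s. out = Some s \<Longrightarrow> s \<in> symbols" and ok: "ok \<sigma>"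
    and \<sigma>': "\<And>i. \<sigma>' (TapeL i) = (if i < k then left_stack (fst (snd (acts i))) (fst (acts i)) (\<sigma> (TapeL i)) else \<sigma> (TapeL i))"
      "\<And>i. \<sigma>' (TapeR i) = (if i < k then right_stack (fst (snd (acts i))) (fst (acts i)) (snd (snd (acts i)))
         (\<sigma> (TapeL i)) (\<sigma> (TapeR i)) else \<sigma> (TapeR i))"
      "\<sigma>' State = s' # tl (\<sigma> State)"
      "\<sigma>' Output = (case out of None \<Rightarrow> \<sigma> Output | Some s \<Rightarrow> s # \<sigma> Output)"
      "\<And>r. \<not> scratch r \<Longrightarrow> \<sigma>' r = \<sigma> r"
  shows "runs (tape_ops k acts (tops \<sigma>) s' out) \<sigma> \<sigma>'"
  unfolding tape_ops_def
proof (intro runs_Seq)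
  define A1 where "A1 = (\<lambda>r. case r of
              State \<Rightarrow> Pop
            | Output \<Rightarrow> (case out of None \<Rightarrow> Keep | Some a \<Rightarrow> Push a)
            | TapeR i \<Rightarrow> if i < k then Pop else Keep
            | _ \<Rightarrow> Keep)"
  define A2 where "A2 = (\<lambda>r. case r of
              State \<Rightarrow> Push s'
            | TapeL i \<Rightarrow> if i < k \<and> fst (snd (acts i)) = Right then Push (fst (acts i)) else Keep
            | TapeR i \<Rightarrow> if i < k \<and> fst (snd (acts i)) \<noteq> Right then Push (fst (acts i)) else Keep
            | _ \<Rightarrow> Keep)"
  define A3 where "A3 = (\<lambda>r. case r of
              TapeL i \<Rightarrow> if i < k \<and> fst (snd (acts i)) = Left then Pop else Keep
            | TapeR i \<Rightarrow> if i < k \<and> fst (snd (acts i)) = Left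
                then Push (case tops \<sigma> (TapeL i) of None \<Rightarrow> snd (snd (acts i)) | Some s \<Rightarrow> s) else Keep
            | _ \<Rightarrow> Keep)"
  show "runs (Par A1) \<sigma> (\<lambda>r. act (A1 r) (\<sigma> r))"
    by (rule runs_Par) (use k out in \<open>auto simp: A1_def split: reg.splits option.splits if_splits\<close>)
  show "runs (Par A2) (\<lambda>r. act (A1 r) (\<sigma> r)) (\<lambda>r. act (A2 r) (act (A1 r) (\<sigma> r)))"
    by (rule runs_Par) (use k s' acts in \<open>auto simp: A2_def split: reg.splits if_splits\<close>)
  show "runs (Par A3) (\<lambda>r. act (A2 r) (act (A1 r) (\<sigma> r))) \<sigma>'"
  proof (rule runs_Par)
    show "A3 r = Keep" if "r \<notin> registers" for r
      using that k by (auto simp: A3_def split: reg.splits if_splits)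
    have "s \<in> symbols" if "tops \<sigma> r = Some s" for r s
      using that ok by (auto simp: tops_eq_Some ok_def subset_iff) (metis list.set_intros(1))
    then show "s \<in> symbols" if "A3 r = Push s" for r s
      using that acts by (auto simp: A3_def split: reg.splits if_splits option.splits)
    show "act (A3 r) (act (A2 r) (act (A1 r) (\<sigma> r))) = \<sigma>' r" for r
    proof (cases r)
      case (TapeL i)
      then show ?thesis
        by (cases "fst (snd (acts i))") (auto simp: \<sigma>' A1_def A2_def A3_def left_stack_def)
    next
      case (TapeR i)
      then show ?thesis
        by (cases "fst (snd (acts i))"; cases "\<sigma> (TapeL i)")
          (auto simp: \<sigma>' A1_def A2_def A3_def right_stack_def tops_def)
    qed (use \<sigma>'(5)[of r] in \<open>auto simp: \<sigma>'(3,4) A1_def A2_def A3_def split: option.splits\<close>)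
  qed
qed

lemma runs_machine_step:
  assumes l: "l \<in> labels N" and rep: "represents (Mc l) w c \<sigma>" and v: "valid_conf (Mc l) c"
    and go: "\<not> suspended (Mc l) w c" and ok: "ok \<sigma>"
  obtains \<sigma>' where "runs (machine_step (Mc l)) \<sigma> \<sigma>'"
    "represents (Mc l) w (t2_step (Mc l) (padded w) c) \<sigma>'"
    "\<And>r. \<not> scratch r \<Longrightarrow> \<sigma>' r = \<sigma> r"
proof -
  let ?M = "Mc l" let ?n = "t2_inputs (Mc l)" let ?m = "t2_works (Mc l)"
  have M: "type2_machine ?M" by (rule machines)
  have nh: "c_state c \<noteq> t2_halt ?M" and h: "\<And>j. j < ?n \<Longrightarrow> c_heads c ! j < int (length (w j))"
    using go by (auto simp: suspended_def not_le)
  have lens: "length (c_heads c) = ?n" "length (c_works c) = ?m" using v by (auto simp: valid_conf_def)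
  have inp: "two_stacks Mark Tag (tape_symbol (w j)) (c_heads c ! j) (\<sigma> (TapeL j)) (\<sigma> (TapeR j))"
    "int (length (\<sigma> (TapeR j))) = int (length (w j)) - c_heads c ! j" if "j < ?n" for j
    using rep that by (auto simp: represents_def)
  have wrk: "two_stacks (Num (t2_blank ?M)) (Num (t2_blank ?M)) (\<lambda>z. Num (fst (c_works c ! k) z))
          (snd (c_works c ! k)) (\<sigma> (TapeL (?n + k))) (\<sigma> (TapeR (?n + k)))" if "k < ?m" for k
    using rep that by (auto simp: represents_def)
  have top: "tops \<sigma> (TapeR j) = Some (tape_symbol (w j) (c_heads c ! j))" "\<sigma> (TapeR j) \<noteq> []" if "j < ?n" for j
    using two_stacks_current[OF inp(1)[OF that]] inp(2)[OF that] h[OF that]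
    by (auto simp: tops_def split: list.splits)
  have ins: "map (\<lambda>j. read_letter (tops \<sigma> (TapeR j))) [0..<?n] =
      map (\<lambda>j. input_cell (padded w j) (c_heads c ! j)) [0..<?n]"
    using top h by (auto simp: read_letter_def tape_symbol_def input_cell_def padded_def nat_less_iff)
  have ws: "map (\<lambda>k. read_num (t2_blank ?M) (tops \<sigma> (TapeR (?n + k)))) [0..<?m] = map (\<lambda>(\<tau>, z). \<tau> z) (c_works c)"
  proof (rule nth_equalityI)
    fix k assume "k < length (map (\<lambda>k. read_num (t2_blank ?M) (tops \<sigma> (TapeR (?n + k)))) [0..<?m])"
    then have k: "k < ?m" by simp
    show "map (\<lambda>k. read_num (t2_blank ?M) (tops \<sigma> (TapeR (?n + k)))) [0..<?m] ! k = map (\<lambda>(\<tau>, z). \<tau> z) (c_works c) ! k"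
      using two_stacks_current[OF wrk[OF k]] k lens
      by (auto simp: read_num_def tops_def case_prod_beta split: list.splits)
  qed (simp add: lens)
  have st: "read_num 0 (tops \<sigma> State) = c_state c"
    using rep by (simp add: represents_def read_num_def tops_def)
  obtain s' ms as out where d: "t2_delta ?M (c_state c) (map (\<lambda>j. input_cell (padded w j) (c_heads c ! j)) [0..<?n])
     (map (\<lambda>(\<tau>, z). \<tau> z) (c_works c)) = (s', ms, as, out)"
    by (rule prod_cases4) blast
  have len: "length (map (\<lambda>j. input_cell (padded w j) (c_heads c ! j)) [0..<?n]) = ?n" by simp
  note vd = valid_delta[OF M v nh len d]
  let ?acts = "machine_acts ?M (tops \<sigma>) ms as"
  define \<sigma>' where "\<sigma>' = (\<lambda>r. case r of
      TapeL i \<Rightarrow> if i < ?n + ?m then left_stack (fst (snd (?acts i))) (fst (?acts i)) (\<sigma> (TapeL i)) else \<sigma> (TapeL i)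
    | TapeR i \<Rightarrow> if i < ?n + ?m then right_stack (fst (snd (?acts i))) (fst (?acts i)) (snd (snd (?acts i)))
         (\<sigma> (TapeL i)) (\<sigma> (TapeR i)) else \<sigma> (TapeR i)
    | State \<Rightarrow> Num s' # tl (\<sigma> State)
    | Output \<Rightarrow> (case map_option Letter out of None \<Rightarrow> \<sigma> Output | Some s \<Rightarrow> s # \<sigma> Output)
    | _ \<Rightarrow> \<sigma> r)"
  have "runs (tape_ops (?n + ?m) ?acts (tops \<sigma>) (Num s') (map_option Letter out)) \<sigma> \<sigma>'"
  proof (rule runs_tape_ops)
    fix i assume i: "i < ?n + ?m"
    show "i \<le> index_bound" by (rule index_bound_machine[OF l i])
    show "fst (?acts i) \<in> symbols"
    proof (cases "i < ?n")
      case True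
      then show ?thesis using top[OF True] by (simp add: machine_acts_def tape_symbol_def)
    next
      case False
      then have "as ! (i - ?n) \<in> set as" using i vd(3) by simp
      then have "fst (as ! (i - ?n)) \<in> t2_symbols ?M" using vd(4) by auto
      then show ?thesis using False Num_symbols[OF l] by (simp add: machine_acts_def)
    qed
    have "t2_blank ?M \<in> t2_symbols ?M" using M by (simp add: type2_machine_def)
    then show "snd (snd (?acts i)) \<in> symbols" using Num_symbols[OF l] by (simp add: machine_acts_def)
  next
    show "Num s' \<in> symbols" using Num_symbols[OF l] vd(1) by simp
    show "\<sigma>' r = \<sigma> r" if "\<not> scratch r" for r
      using that by (cases r) (auto simp: \<sigma>'_def)
  qed (auto simp: \<sigma>'_def ok)
  then have "runs (machine_step ?M) \<sigma> \<sigma>'"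
    unfolding machine_step_def by (intro runs_Case) (simp only: ins ws st d prod.case)
  moreover have "\<sigma>' r = \<sigma> r" if "\<not> scratch r" for r
      using that by (cases r) (auto simp: \<sigma>'_def)
  moreover have "represents ?M w (t2_step ?M (padded w) c) \<sigma>'"
    unfolding represents_def
  proof (intro conjI allI impI)
    have step: "t2_step ?M (padded w) c = \<lparr>c_state = s', c_heads = map2 moved ms (c_heads c),
              c_works = map2 work_action (c_works c) as,
              c_output = c_output c @ (case out of None \<Rightarrow> [] | Some a \<Rightarrow> [a])\<rparr>"
      unfolding t2_step_def d using nh by simp
    note [simp] = step
    show "\<sigma>' State = [Num (c_state (t2_step ?M (padded w) c))]"
      using rep by (simp add: \<sigma>'_def represents_def)
    show "\<sigma>' Output = rev (map Letter (c_output (t2_step ?M (padded w) c)))"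
      using rep by (cases out) (simp_all add: \<sigma>'_def represents_def)
    {
      fix j assume j: "j < ?n"
      have hd: "c_heads (t2_step ?M (padded w) c) ! j = moved (ms ! j) (c_heads c ! j)"
        using j lens vd(2) by simp
      have upd: "(tape_symbol (w j))(c_heads c ! j := tape_symbol (w j) (c_heads c ! j)) = tape_symbol (w j)" by simp
      show "two_stacks Mark Tag (tape_symbol (w j)) (c_heads (t2_step ?M (padded w) c) ! j) (\<sigma>' (TapeL j)) (\<sigma>' (TapeR j))"
        unfolding hd
        using two_stacks_moved[OF inp(1)[OF j], of "tape_symbol (w j) (c_heads c ! j)" "ms ! j"] j top(1)[OF j]
        unfolding upd by (simp add: \<sigma>'_def machine_acts_def)
      show "int (length (\<sigma>' (TapeR j))) = int (length (w j)) - c_heads (t2_step ?M (padded w) c) ! j"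
        unfolding hd using inp(2)[OF j] top(2)[OF j] j
        by (cases "ms ! j"; cases "\<sigma> (TapeR j)") (auto simp: \<sigma>'_def machine_acts_def right_stack_def)
    next
      fix k assume k: "k < ?m"
      have wk: "c_works (t2_step ?M (padded w) c) ! k = work_action (c_works c ! k) (as ! k)"
        using k lens vd(3) by simp
      have eq: "(\<lambda>z. Num (fst (c_works c ! k) z))(snd (c_works c ! k) := Num (fst (as ! k))) =
         (\<lambda>z. Num (fst (work_action (c_works c ! k) (as ! k)) z))"
        by (auto simp: work_action_def)
      have hd: "snd (work_action (c_works c ! k) (as ! k)) = moved (snd (as ! k)) (snd (c_works c ! k))"
        by (simp add: work_action_def)
      show "two_stacks (Num (t2_blank ?M)) (Num (t2_blank ?M))
          (\<lambda>z. Num (fst (c_works (t2_step ?M (padded w) c) ! k) z))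
          (snd (c_works (t2_step ?M (padded w) c) ! k)) (\<sigma>' (TapeL (?n + k))) (\<sigma>' (TapeR (?n + k)))"
        unfolding wk hd
        using two_stacks_moved[OF wrk[OF k], of "Num (fst (as ! k))" "snd (as ! k)"] k
        unfolding eq by (simp add: \<sigma>'_def machine_acts_def)
    }
  qed
  ultimately show thesis using that by blast
qed

text \<open>
  The guard is the negation of \<open>suspended\<close>, together with the bound on the number of steps.
\<close>

definition machine_loop :: "'a t2m \<Rightarrow> (reg, ('l, 'g, 'a) sym, 'a) com" where
  "machine_loop M =
     While (\<lambda>tp. tp Ticks \<noteq> None \<and> tp State \<noteq> Some (Num (t2_halt M)) \<and> (\<forall>j<t2_inputs M. tp (TapeR j) \<noteq> None))
       (Seq (pop Ticks) (machine_step M))"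

lemma runs_machine_loop:
  assumes l: "l \<in> labels N" and "represents (Mc l) w c \<sigma>" "valid_conf (Mc l) c" "ok \<sigma>" "length (\<sigma> Ticks) = t"
  shows "\<exists>\<sigma>'. runs (machine_loop (Mc l)) \<sigma> \<sigma>' \<and> represents (Mc l) w (trunc_run (Mc l) w t c) \<sigma>' \<and>
     (\<forall>r. \<not> scratch r \<longrightarrow> r \<noteq> Ticks \<longrightarrow> \<sigma>' r = \<sigma> r)"
  using assms(2-)
proof (induction t arbitrary: c \<sigma>)
  case 0
  have "runs (machine_loop (Mc l)) \<sigma> \<sigma>"
    unfolding machine_loop_def by (rule runs_While_False) (use 0 in simp)
  then show ?case using 0 by auto
next
  case (Suc t)
  let ?M = "Mc l"
  let ?b = "\<lambda>tp. tp Ticks \<noteq> None \<and> tp State \<noteq> Some (Num (t2_halt ?M)) \<and> (\<forall>j<t2_inputs ?M. tp (TapeR j) \<noteq> None)"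
  have st: "\<sigma> State = [Num (c_state c)]" and
    len: "\<And>j. j < t2_inputs ?M \<Longrightarrow> int (length (\<sigma> (TapeR j))) = int (length (w j)) - c_heads c ! j"
    using Suc.prems(1) by (auto simp: represents_def)
  have "(\<sigma> (TapeR j) = []) = (int (length (w j)) \<le> c_heads c ! j)" if "j < t2_inputs ?M" for j
    using len[OF that] by (cases "\<sigma> (TapeR j)") auto
  moreover have "\<sigma> Ticks \<noteq> []" using Suc.prems(4) by auto
  ultimately have b: "?b (tops \<sigma>) = (\<not> suspended ?M w c)"
    using st by (auto simp: suspended_def tops_Cons)
  show ?case
  proof (cases "suspended ?M w c")
    case True
    have "runs (machine_loop ?M) \<sigma> \<sigma>"
      unfolding machine_loop_def by (rule runs_While_False) (use b True in simp)
    then show ?thesis using Suc.prems True by auto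
  next
    case False
    let ?\<sigma>1 = "\<sigma>(Ticks := tl (\<sigma> Ticks))"
    have 1: "runs (pop Ticks) \<sigma> ?\<sigma>1" by (rule runs_pop) simp
    have rep1: "represents ?M w c ?\<sigma>1" using Suc.prems(1) by (simp add: represents_def)
    obtain \<sigma>2 where 2: "runs (machine_step ?M) ?\<sigma>1 \<sigma>2"
      and rep2: "represents ?M w (t2_step ?M (padded w) c) \<sigma>2"
      and eq2: "\<And>r. \<not> scratch r \<Longrightarrow> \<sigma>2 r = ?\<sigma>1 r"
      using runs_machine_step[OF l rep1 Suc.prems(2) False runs_ok[OF 1 Suc.prems(3)]] by blast
    have ok2: "ok \<sigma>2" using runs_ok[OF 2 runs_ok[OF 1 Suc.prems(3)]] .
    have t2: "length (\<sigma>2 Ticks) = t" using eq2[of Ticks] Suc.prems(4) by simp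
    obtain \<sigma>3 where 3: "runs (machine_loop ?M) \<sigma>2 \<sigma>3"
      and rep3: "represents ?M w (trunc_run ?M w t (t2_step ?M (padded w) c)) \<sigma>3"
      and eq3: "\<forall>r. \<not> scratch r \<longrightarrow> r \<noteq> Ticks \<longrightarrow> \<sigma>3 r = \<sigma>2 r"
      using Suc.IH[OF rep2 valid_conf_step[OF machines Suc.prems(2)] ok2 t2] by blast
    have "runs (machine_loop ?M) \<sigma> \<sigma>3"
      unfolding machine_loop_def
      by (rule runs_While_True[OF _ runs_Seq[OF 1 2] 3[unfolded machine_loop_def]]) (use b False in simp)
    then show ?thesis using rep3 eq2 eq3 False by auto
  qed
qed

text \<open>
  The scratch registers still contain the remains of the previous call, hence the \<open>clear\<close>.  The
  \<open>pop\<close> removes the tag of the copied cell.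
\<close>

definition call :: "'a t2m \<Rightarrow> nat list \<Rightarrow> (reg, ('l, 'g, 'a) sym, 'a) com" where
  "call M js =
     Seq (clear {r \<in> registers. scratch r \<or> r = Ticks})
    (Seq (Seqs (map (\<lambda>j. Seq (copy Tmp (Cur (js ! j)) (TapeR j)) (pop (TapeR j))) [0..<length js]))
    (Seq (copy Tmp Clock Ticks)
    (Seq (push State (Num (t2_start M)))
         (machine_loop M))))"

lemma runs_call:
  assumes l: "l \<in> labels N" and n: "t2_inputs (Mc l) = length js" and js: "\<And>j. j < length js \<Longrightarrow> js ! j \<le> last_tape N"
    and ok: "ok \<sigma>" and tmp: "\<sigma> Tmp = []"
    and args: "\<And>j. j < length js \<Longrightarrow> \<sigma> (Cur (js ! j)) = Tag # map Letter (w j)" and t: "length (\<sigma> Clock) = t"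
  obtains \<sigma>' where "runs (call (Mc l) js) \<sigma> \<sigma>'"
    "represents (Mc l) w (trunc_run (Mc l) w t (t2_initial (Mc l))) \<sigma>'"
    "\<And>r. \<not> scratch r \<Longrightarrow> r \<noteq> Ticks \<Longrightarrow> \<sigma>' r = \<sigma> r"
proof -
  let ?M = "Mc l" let ?n = "length js" let ?m = "t2_works (Mc l)"
  let ?X = "{r \<in> registers. scratch r \<or> r = Ticks}"
  define \<sigma>1 where "\<sigma>1 = (\<lambda>r. if r \<in> ?X then [] else \<sigma> r)"
  have 1: "runs (clear ?X) \<sigma> \<sigma>1" unfolding \<sigma>1_def by (rule runs_clear) auto
  \<comment> \<open>the store after the first \<open>j\<close> arguments have been copied\<close>
  define \<rho> where "\<rho> = (\<lambda>j r. case r of TapeR i \<Rightarrow> if i < j then map Letter (w i) else \<sigma>1 r | _ \<Rightarrow> \<sigma>1 r)"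
  have b: "i \<le> index_bound" if "i < ?n + ?m" for i using index_bound_machine[OF l] n that by simp
  have bj: "js ! j \<le> index_bound" if "j < ?n" for j using index_bound_tapes[of "js ! j"] js[OF that] by simp
  have ok1: "ok \<sigma>1" using runs_ok[OF 1 ok] .
  have S: "set (\<sigma> r) \<subseteq> symbols" for r using ok by (simp add: ok_def)
  have \<rho>0: "\<rho> 0 = \<sigma>1" by (auto simp: \<rho>_def fun_eq_iff split: reg.splits)
  have 2: "runs (Seqs (map (\<lambda>j. Seq (copy Tmp (Cur (js ! j)) (TapeR j)) (pop (TapeR j))) [0..<?n])) (\<rho> 0) (\<rho> ?n)"
  proof (rule runs_Seqs_upt)
    fix j assume j: "j < ?n"
    have e: "\<rho> j (TapeR j) = []" using j b[of j] by (simp add: \<rho>_def \<sigma>1_def)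
    have c: "\<rho> j (Cur (js ! j)) = Tag # map Letter (w j)" using args[OF j] by (simp add: \<rho>_def \<sigma>1_def)
    let ?\<rho>1 = "(\<rho> j)(TapeR j := \<rho> j (Cur (js ! j)) @ \<rho> j (TapeR j))"
    have "runs (copy Tmp (Cur (js ! j)) (TapeR j)) (\<rho> j) ?\<rho>1"
      by (rule runs_copy) (use j b[of j] bj[of j] c tmp in \<open>auto simp: \<rho>_def \<sigma>1_def\<close>)
    moreover have "runs (pop (TapeR j)) ?\<rho>1 (?\<rho>1(TapeR j := tl (?\<rho>1 (TapeR j))))"
      by (rule runs_pop) (use j b[of j] in auto)
    moreover have "?\<rho>1(TapeR j := tl (?\<rho>1 (TapeR j))) = \<rho> (Suc j)"
      using c e by (auto simp: fun_eq_iff \<rho>_def less_Suc_eq split: reg.splits)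
    ultimately show "runs (Seq (copy Tmp (Cur (js ! j)) (TapeR j)) (pop (TapeR j))) (\<rho> j) (\<rho> (Suc j))"
      using runs_Seq by metis
  qed
  let ?\<sigma>3 = "(\<rho> ?n)(Ticks := \<rho> ?n Clock @ \<rho> ?n Ticks)"
  have 3: "runs (copy Tmp Clock Ticks) (\<rho> ?n) ?\<sigma>3"
    by (rule runs_copy) (use tmp S in \<open>auto simp: \<rho>_def \<sigma>1_def\<close>)
  let ?\<sigma>4 = "?\<sigma>3(State := Num (t2_start ?M) # ?\<sigma>3 State)"
  have "t2_start ?M \<in> t2_states ?M" using machines[of l] by (simp add: type2_machine_def)
  then have 4: "runs (push State (Num (t2_start ?M))) ?\<sigma>3 ?\<sigma>4"
    by (intro runs_push) (use Num_symbols[OF l] in auto)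
  have ok4: "ok ?\<sigma>4" using runs_ok[OF 4 runs_ok[OF 3 runs_ok[OF 2[unfolded \<rho>0] ok1]]] .
  have rep: "represents ?M w (t2_initial ?M) ?\<sigma>4"
    unfolding represents_def
  proof (intro conjI allI impI)
    fix j assume "j < t2_inputs ?M"
    then have j: "j < ?n" using n by simp
    then have R: "?\<sigma>4 (TapeR j) = map Letter (w j)" and L: "?\<sigma>4 (TapeL j) = []"
      using b[of j] by (simp_all add: \<rho>_def \<sigma>1_def)
    show "two_stacks Mark Tag (tape_symbol (w j)) (c_heads (t2_initial ?M) ! j) (?\<sigma>4 (TapeL j)) (?\<sigma>4 (TapeR j))"
      unfolding R L using j n by (auto simp: two_stacks_def half_def t2_initial_def tape_symbol_def)
    show "int (length (?\<sigma>4 (TapeR j))) = int (length (w j)) - c_heads (t2_initial ?M) ! j"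
      unfolding R using j n by (simp add: t2_initial_def)
  next
    fix k assume k: "k < ?m"
    then have R: "?\<sigma>4 (TapeR (t2_inputs ?M + k)) = []" and L: "?\<sigma>4 (TapeL (t2_inputs ?M + k)) = []"
      using b[of "?n + k"] n by (simp_all add: \<rho>_def \<sigma>1_def)
    show "two_stacks (Num (t2_blank ?M)) (Num (t2_blank ?M)) (\<lambda>z. Num (fst (c_works (t2_initial ?M) ! k) z))
      (snd (c_works (t2_initial ?M) ! k)) (?\<sigma>4 (TapeL (t2_inputs ?M + k))) (?\<sigma>4 (TapeR (t2_inputs ?M + k)))"
      unfolding R L using k by (auto simp: two_stacks_def half_def t2_initial_def)
  qed (simp_all add: \<rho>_def \<sigma>1_def t2_initial_def)
  have t4: "length (?\<sigma>4 Ticks) = t" using t by (simp add: \<rho>_def \<sigma>1_def)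
  obtain \<sigma>5 where 5: "runs (machine_loop ?M) ?\<sigma>4 \<sigma>5"
    and rep5: "represents ?M w (trunc_run ?M w t (t2_initial ?M)) \<sigma>5"
    and eq5: "\<forall>r. \<not> scratch r \<longrightarrow> r \<noteq> Ticks \<longrightarrow> \<sigma>5 r = ?\<sigma>4 r"
    using runs_machine_loop[OF l rep valid_conf_initial[OF machines] ok4 t4] by blast
  have "\<sigma>5 r = \<sigma> r" if "\<not> scratch r" "r \<noteq> Ticks" for r
    using eq5 that by (cases r) (auto simp: \<rho>_def \<sigma>1_def)
  moreover have "runs (call ?M js) \<sigma> \<sigma>5"
    unfolding call_def using 1 2[unfolded \<rho>0] 3 4 5 by (intro runs_Seq)
  ultimately show thesis using that rep5 by blast
qed

end

section \<open>Simulating a generalized Turing machine\<close>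

fun encode_cell :: "'a list + 'g \<Rightarrow> ('l, 'g, 'a) sym list" where
  "encode_cell (Inl w) = Tag # map Letter w"
| "encode_cell (Inr g) = [Gam g]"

text \<open>
  Words are reversed here because moving a word symbol by symbol from one stack to another reverses
  it; when a cell comes back under the head, its word is in the right order again.
\<close>

definition encode_cells :: "('a list + 'g) list \<Rightarrow> ('l, 'g, 'a) sym list" where
  "encode_cells cs = concat (map (\<lambda>c. rev (encode_cell c) @ [Sep]) cs)"

lemma encode_cells_simps [simp]:
  "encode_cells [] = []" "encode_cells (c # cs) = rev (encode_cell c) @ Sep # encode_cells cs"
  by (simp_all add: encode_cells_def)

lemma Sep_encode_cell: "Sep \<notin> set (encode_cell c)"
  by (cases c) auto

text \<open>
  The head position of tape 0, from the recorded moves.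
\<close>

definition displacement :: "('l, 'g, 'a) sym list \<Rightarrow> int" where
  "displacement ss = (\<Sum>s\<leftarrow>ss. if s = Mark then 1 else - 1)"

lemma displacement_simps [simp]:
  "displacement [] = 0" "displacement (s # ss) = (if s = Mark then 1 else - 1) + displacement ss"
  by (simp_all add: displacement_def)

text \<open>
  The registers that survive a stage.
\<close>

fun persistent :: "reg \<Rightarrow> bool" where
  "persistent (Prefix i) = True" | "persistent Clock = True" | "persistent Emitted = True"
| "persistent _ = False"

lemma persistent_not_scratch: "persistent r \<Longrightarrow> \<not> scratch r \<and> r \<noteq> Ticks"
  by (cases r) auto

context simulation
begin

definition holds_tape :: "nat \<Rightarrow> (int \<Rightarrow> 'a list + 'g) \<times> int \<Rightarrow> (reg \<Rightarrow> ('l, 'g, 'a) sym list) \<Rightarrow> bool" where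
  "holds_tape i tape \<sigma> \<longleftrightarrow> (case tape of (\<alpha>, m) \<Rightarrow>
     \<sigma> (Cur i) = encode_cell (\<alpha> m) \<and>
     (\<exists>cl cr. \<sigma> (Lft i) = encode_cells cl \<and> \<sigma> (Rgt i) = encode_cells cr \<and>
        half (Inr (blank N)) (\<lambda>k. \<alpha> (m - 1 - int k)) cl \<and>
        half (Inr (blank N)) (\<lambda>k. \<alpha> (m + 1 + int k)) cr))"

lemma holds_tape_cong:
  "holds_tape i tape \<sigma> \<Longrightarrow> \<sigma>' (Cur i) = \<sigma> (Cur i) \<Longrightarrow> \<sigma>' (Lft i) = \<sigma> (Lft i) \<Longrightarrow> \<sigma>' (Rgt i) = \<sigma> (Rgt i) \<Longrightarrow>
   holds_tape i tape \<sigma>'"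
  by (auto simp: holds_tape_def)

lemma holds_tapeI:
  "\<sigma> (Cur i) = encode_cell (\<alpha> m) \<Longrightarrow> \<sigma> (Lft i) = encode_cells cl \<Longrightarrow> \<sigma> (Rgt i) = encode_cells cr \<Longrightarrow>
   half (Inr (blank N)) (\<lambda>k. \<alpha> (m - 1 - int k)) cl \<Longrightarrow> half (Inr (blank N)) (\<lambda>k. \<alpha> (m + 1 + int k)) cr \<Longrightarrow>
   holds_tape i (\<alpha>, m) \<sigma>"
  unfolding holds_tape_def by blast

text \<open>
  The scanned cell goes to stack \<open>q\<close> and the next one comes from stack \<open>p\<close>; if \<open>p\<close> is empty, that is
  a blank cell.
\<close>

definition shift :: "nat \<Rightarrow> reg \<Rightarrow> reg \<Rightarrow> (reg, ('l, 'g, 'a) sym, 'a) com" where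
  "shift i p q =
     Seq (push q Sep)
    (Seq (move_all (Cur i) q)
    (Seq (Case (\<lambda>tp. if tp p = None then push (Cur i) (Gam (blank N)) else skip))
    (Seq (move_while (\<lambda>s. s \<noteq> Sep) p (Cur i))
         (pop p))))"

lemma blank_gamma: "blank N \<in> gamma N"
  using N by (simp add: generalized_TM_def)

lemma runs_shift:
  assumes regs: "Cur i \<in> registers" "p \<in> registers" "q \<in> registers" "p \<noteq> q" "p \<noteq> Cur i" "q \<noteq> Cur i"
    and ok: "ok \<sigma>" and c: "\<sigma> (Cur i) = encode_cell c"
    and p: "\<sigma> p = encode_cells cp" and q: "\<sigma> q = encode_cells cq"
  shows "runs (shift i p q) \<sigma>
     (\<sigma>(Cur i := encode_cell (case cp of [] \<Rightarrow> Inr (blank N) | d # _ \<Rightarrow> d),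
        p := encode_cells (tl cp), q := encode_cells (c # cq)))"
proof -
  have S: "set (\<sigma> r) \<subseteq> symbols" for r using ok by (simp add: ok_def)
  let ?\<sigma>1 = "\<sigma>(q := Sep # \<sigma> q)"
  have 1: "runs (push q Sep) \<sigma> ?\<sigma>1" by (rule runs_push) (use regs in auto)
  let ?\<sigma>2 = "?\<sigma>1(Cur i := [], q := rev (?\<sigma>1 (Cur i)) @ ?\<sigma>1 q)"
  have 2: "runs (move_all (Cur i) q) ?\<sigma>1 ?\<sigma>2" by (rule runs_move_all) (use regs S in auto)
  let ?\<sigma>3 = "?\<sigma>2(Cur i := if cp = [] then [Gam (blank N)] else [])"
  have pe: "\<sigma> p = [] \<longleftrightarrow> cp = []" unfolding p by (cases cp) auto
  have 3: "runs (Case (\<lambda>tp. if tp p = None then push (Cur i) (Gam (blank N)) else skip)) ?\<sigma>2 ?\<sigma>3"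
  proof (rule runs_Case)
    have "runs (push (Cur i) (Gam (blank N))) ?\<sigma>2 (?\<sigma>2(Cur i := Gam (blank N) # ?\<sigma>2 (Cur i)))"
      by (rule runs_push) (use regs blank_gamma in auto)
    moreover have "?\<sigma>2 (Cur i) = []" using regs by simp
    moreover have "runs skip ?\<sigma>2 ?\<sigma>2" by (rule runs_skip)
    moreover have "?\<sigma>2(Cur i := []) = ?\<sigma>2" using regs by (auto simp: fun_eq_iff)
    moreover have "tops ?\<sigma>2 p = None \<longleftrightarrow> cp = []" using regs pe by simp
    ultimately show "runs (if tops ?\<sigma>2 p = None then push (Cur i) (Gam (blank N)) else skip) ?\<sigma>2 ?\<sigma>3"
      by (cases "cp = []") (simp_all only: if_True if_False simp_thms)
  qed
  \<comment> \<open>the next cell on \<open>p\<close>, up to its separator, and what is below it\<close>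
  define xs ys :: "('l, 'g, 'a) sym list" where "xs = (case cp of [] \<Rightarrow> [] | d # _ \<Rightarrow> rev (encode_cell d))"
    and "ys = (case cp of [] \<Rightarrow> [] | _ # ds \<Rightarrow> Sep # encode_cells ds)"
  have xy: "?\<sigma>3 p = xs @ ys" using p regs by (cases cp) (auto simp: xs_def ys_def)
  have sx: "set xs \<subseteq> symbols" using S[of p] p by (cases cp) (auto simp: xs_def)
  let ?\<sigma>4 = "?\<sigma>3(p := ys, Cur i := rev xs @ ?\<sigma>3 (Cur i))"
  have 4: "runs (move_while (\<lambda>s. s \<noteq> Sep) p (Cur i)) ?\<sigma>3 ?\<sigma>4"
  proof (rule runs_move_while)
    show "\<forall>s\<in>set xs. s \<noteq> Sep" using Sep_encode_cell by (cases cp) (auto simp: xs_def)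
    show "ys = [] \<or> \<not> hd ys \<noteq> Sep" by (cases cp) (auto simp: ys_def)
  qed (use regs sx xy in auto)
  let ?\<sigma>5 = "?\<sigma>4(p := tl (?\<sigma>4 p))"
  have 5: "runs (pop p) ?\<sigma>4 ?\<sigma>5" by (rule runs_pop) (use regs in auto)
  have eq: "?\<sigma>5 = \<sigma>(Cur i := encode_cell (case cp of [] \<Rightarrow> Inr (blank N) | d # _ \<Rightarrow> d),
        p := encode_cells (tl cp), q := encode_cells (c # cq))"
    using regs c q by (cases cp) (auto simp: fun_eq_iff xs_def ys_def)
  show ?thesis unfolding shift_def eq[symmetric] using 1 2 3 4 5 by (intro runs_Seq)
qed

lemma shift_right_tape:
  assumes i: "i \<le> last_tape N" and ok: "ok \<sigma>" and h: "holds_tape i (\<alpha>, m) \<sigma>"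
  obtains \<sigma>' where "runs (shift i (Rgt i) (Lft i)) \<sigma> \<sigma>'" "holds_tape i (\<alpha>, m + 1) \<sigma>'"
    "\<And>r. r \<notin> {Cur i, Lft i, Rgt i} \<Longrightarrow> \<sigma>' r = \<sigma> r"
proof -
  have b: "i \<le> index_bound" using i by (intro index_bound_tapes) simp
  obtain cl cr where c: "\<sigma> (Cur i) = encode_cell (\<alpha> m)" "\<sigma> (Lft i) = encode_cells cl" "\<sigma> (Rgt i) = encode_cells cr"
    and l: "half (Inr (blank N)) (\<lambda>k. \<alpha> (m - 1 - int k)) cl" and r: "half (Inr (blank N)) (\<lambda>k. \<alpha> (m + 1 + int k)) cr"
    using h by (auto simp: holds_tape_def)
  let ?\<sigma>' = "\<sigma>(Cur i := encode_cell (case cr of [] \<Rightarrow> Inr (blank N) | d # _ \<Rightarrow> d),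
        Rgt i := encode_cells (tl cr), Lft i := encode_cells (\<alpha> m # cl))"
  have "runs (shift i (Rgt i) (Lft i)) \<sigma> ?\<sigma>'"
    by (rule runs_shift) (use b ok c in auto)
  moreover have "holds_tape i (\<alpha>, m + 1) ?\<sigma>'"
  proof (rule holds_tapeI)
    show "half (Inr (blank N)) (\<lambda>k. \<alpha> (m + 1 - 1 - int k)) (\<alpha> m # cl)"
      unfolding half_Cons by (intro conjI half_cong[OF l]) (simp_all add: algebra_simps)
    show "half (Inr (blank N)) (\<lambda>k. \<alpha> (m + 1 + 1 + int k)) (tl cr)"
      by (rule half_cong[OF half_tl[OF r]]) (simp add: algebra_simps)
  qed (use half_top[OF r] in simp_all)
  ultimately show thesis using that[of ?\<sigma>'] by simp
qed

lemma shift_left_tape: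
  assumes i: "i \<le> last_tape N" and ok: "ok \<sigma>" and h: "holds_tape i (\<alpha>, m) \<sigma>"
  obtains \<sigma>' where "runs (shift i (Lft i) (Rgt i)) \<sigma> \<sigma>'" "holds_tape i (\<alpha>, m - 1) \<sigma>'"
    "\<And>r. r \<notin> {Cur i, Lft i, Rgt i} \<Longrightarrow> \<sigma>' r = \<sigma> r"
proof -
  have b: "i \<le> index_bound" using i by (intro index_bound_tapes) simp
  obtain cl cr where c: "\<sigma> (Cur i) = encode_cell (\<alpha> m)" "\<sigma> (Lft i) = encode_cells cl" "\<sigma> (Rgt i) = encode_cells cr"
    and l: "half (Inr (blank N)) (\<lambda>k. \<alpha> (m - 1 - int k)) cl" and r: "half (Inr (blank N)) (\<lambda>k. \<alpha> (m + 1 + int k)) cr"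
    using h by (auto simp: holds_tape_def)
  let ?\<sigma>' = "\<sigma>(Cur i := encode_cell (case cl of [] \<Rightarrow> Inr (blank N) | d # _ \<Rightarrow> d),
        Lft i := encode_cells (tl cl), Rgt i := encode_cells (\<alpha> m # cr))"
  have "runs (shift i (Lft i) (Rgt i)) \<sigma> ?\<sigma>'"
    by (rule runs_shift) (use b ok c in auto)
  moreover have "holds_tape i (\<alpha>, m - 1) ?\<sigma>'"
  proof (rule holds_tapeI)
    show "half (Inr (blank N)) (\<lambda>k. \<alpha> (m - 1 + 1 + int k)) (\<alpha> m # cr)"
      unfolding half_Cons by (intro conjI half_cong[OF r]) (simp_all add: algebra_simps)
    show "half (Inr (blank N)) (\<lambda>k. \<alpha> (m - 1 - 1 - int k)) (tl cl)"
      by (rule half_cong[OF half_tl[OF l]]) (simp add: algebra_simps)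
  qed (use half_top[OF l] in simp_all)
  ultimately show thesis using that[of ?\<sigma>'] by simp
qed

definition holds :: "nat \<Rightarrow> ('l, 'g, 'a list) config \<Rightarrow> (reg \<Rightarrow> ('l, 'g, 'a) sym list) \<Rightarrow> bool" where
  "holds t \<kappa> \<sigma> \<longleftrightarrow> ok \<sigma> \<and> \<sigma> Tmp = [] \<and> length (\<sigma> Clock) = t \<and> \<sigma> Label = [Lab (fst \<kappa>)] \<and>
     displacement (\<sigma> Moves) = snd (snd \<kappa> 0) \<and> (\<forall>i\<le>last_tape N. holds_tape i (snd \<kappa> i) \<sigma>)"

definition goto :: "'l \<Rightarrow> (reg, ('l, 'g, 'a) sym, 'a) com" where
  "goto l = Seq (pop Label) (push Label (Lab l))"

lemma runs_goto:
  assumes "\<sigma> Label = [k]" "l \<in> labels N"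
  shows "runs (goto l) \<sigma> (\<sigma>(Label := [Lab l]))"
proof -
  have "runs (pop Label) \<sigma> (\<sigma>(Label := tl (\<sigma> Label)))" by (rule runs_pop) simp
  moreover have "runs (push Label (Lab l)) (\<sigma>(Label := tl (\<sigma> Label)))
      ((\<sigma>(Label := tl (\<sigma> Label)))(Label := Lab l # (\<sigma>(Label := tl (\<sigma> Label))) Label))"
    by (rule runs_push) (use assms in auto)
  ultimately show ?thesis unfolding goto_def using runs_Seq assms by fastforce
qed

lemma holds_goto:
  assumes h: "holds t (l, T) \<sigma>" and l': "l' \<in> labels N"
  shows "\<exists>\<sigma>'. runs (goto l') \<sigma> \<sigma>' \<and> holds t (l', T) \<sigma>' \<and> (\<forall>r. r \<noteq> Label \<longrightarrow> \<sigma>' r = \<sigma> r)"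
proof -
  have r: "runs (goto l') \<sigma> (\<sigma>(Label := [Lab l']))"
    by (rule runs_goto) (use assms in \<open>auto simp: holds_def\<close>)
  have "ok (\<sigma>(Label := [Lab l']))" using runs_ok[OF r] h by (simp add: holds_def)
  moreover have "holds_tape i (T i) (\<sigma>(Label := [Lab l']))" if "i \<le> last_tape N" for i
    by (rule holds_tape_cong[of i "T i" \<sigma>]) (use h that in \<open>simp_all add: holds_def\<close>)
  ultimately show ?thesis using r h
    by (intro exI[of _ "\<sigma>(Label := [Lab l'])"]) (simp add: holds_def)
qed

definition move_right :: "nat \<Rightarrow> (reg, ('l, 'g, 'a) sym, 'a) com" where
  "move_right i = Seq (shift i (Rgt i) (Lft i)) (if i = 0 then push Moves Mark else skip)"

definition move_left :: "nat \<Rightarrow> (reg, ('l, 'g, 'a) sym, 'a) com" where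
  "move_left i = Seq (shift i (Lft i) (Rgt i)) (if i = 0 then push Moves Tag else skip)"

lemma holds_after_shift:
  assumes h: "holds t (l, T) \<sigma>" and i: "i \<le> last_tape N"
    and sh: "runs c \<sigma> \<sigma>1" "holds_tape i (fst (T i), snd (T i) + d) \<sigma>1"
      "\<And>r. r \<notin> {Cur i, Lft i, Rgt i} \<Longrightarrow> \<sigma>1 r = \<sigma> r"
    and s: "s \<in> symbols" "(if s = Mark then 1 else - 1) = d"
  shows "\<exists>\<sigma>'. runs (Seq c (if i = 0 then push Moves s else skip)) \<sigma> \<sigma>' \<and> holds t (l, move_head T i d) \<sigma>' \<and>
     (\<forall>r. r \<notin> {Cur i, Lft i, Rgt i, Moves} \<longrightarrow> \<sigma>' r = \<sigma> r)"
proof -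
  define \<sigma>' where "\<sigma>' = (if i = 0 then \<sigma>1(Moves := s # \<sigma>1 Moves) else \<sigma>1)"
  have "runs (if i = 0 then push Moves s else skip) \<sigma>1 \<sigma>'"
    using runs_push[of Moves s \<sigma>1] runs_skip[of \<sigma>1] s(1) by (auto simp: \<sigma>'_def)
  then have r: "runs (Seq c (if i = 0 then push Moves s else skip)) \<sigma> \<sigma>'" by (rule runs_Seq[OF sh(1)])
  have ok: "ok \<sigma>'" using runs_ok[OF r] h by (simp add: holds_def)
  have "holds_tape i' (move_head T i d i') \<sigma>'" if "i' \<le> last_tape N" for i'
  proof (cases "i' = i")
    case True
    have "holds_tape i (fst (T i), snd (T i) + d) \<sigma>'"
      by (rule holds_tape_cong[OF sh(2)]) (simp_all add: \<sigma>'_def)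
    then show ?thesis using True by (simp add: move_head_def)
  next
    case False
    have h': "holds_tape i' (T i') \<sigma>" using h that by (simp add: holds_def)
    have "holds_tape i' (T i') \<sigma>'" by (rule holds_tape_cong[OF h']) (use False sh(3) in \<open>simp_all add: \<sigma>'_def\<close>)
    then show ?thesis using False by (simp add: move_head_def)
  qed
  moreover have "displacement (\<sigma>' Moves) = snd (move_head T i d 0)"
    using h sh(3)[of Moves] s(2) by (auto simp: \<sigma>'_def move_head_def holds_def)
  moreover have "\<sigma>' r = \<sigma> r" if "r \<notin> {Cur i, Lft i, Rgt i, Moves}" for r
    using sh(3)[of r] that by (simp add: \<sigma>'_def)
  ultimately show ?thesis using r ok h by (intro exI[of _ \<sigma>']) (auto simp: holds_def)
qed

lemma holds_move_right:
  assumes h: "holds t (l, T) \<sigma>" and i: "i \<le> last_tape N"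
  shows "\<exists>\<sigma>'. runs (move_right i) \<sigma> \<sigma>' \<and> holds t (l, move_head T i 1) \<sigma>' \<and>
     (\<forall>r. r \<notin> {Cur i, Lft i, Rgt i, Moves} \<longrightarrow> \<sigma>' r = \<sigma> r)"
proof -
  have "ok \<sigma>" "holds_tape i (fst (T i), snd (T i)) \<sigma>" using h i by (auto simp: holds_def)
  then obtain \<sigma>1 where 1: "runs (shift i (Rgt i) (Lft i)) \<sigma> \<sigma>1" "holds_tape i (fst (T i), snd (T i) + 1) \<sigma>1"
    "\<And>r. r \<notin> {Cur i, Lft i, Rgt i} \<Longrightarrow> \<sigma>1 r = \<sigma> r"
    using shift_right_tape[OF i] by blast
  show ?thesis
    unfolding move_right_def by (rule holds_after_shift[OF h i 1(1) _ 1(3)]) (use 1(2) in simp_all)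
qed

lemma holds_move_left:
  assumes h: "holds t (l, T) \<sigma>" and i: "i \<le> last_tape N"
  shows "\<exists>\<sigma>'. runs (move_left i) \<sigma> \<sigma>' \<and> holds t (l, move_head T i (- 1)) \<sigma>' \<and>
     (\<forall>r. r \<notin> {Cur i, Lft i, Rgt i, Moves} \<longrightarrow> \<sigma>' r = \<sigma> r)"
proof -
  have "ok \<sigma>" "holds_tape i (fst (T i), snd (T i)) \<sigma>" using h i by (auto simp: holds_def)
  then obtain \<sigma>1 where 1: "runs (shift i (Lft i) (Rgt i)) \<sigma> \<sigma>1" "holds_tape i (fst (T i), snd (T i) - 1) \<sigma>1"
    "\<And>r. r \<notin> {Cur i, Lft i, Rgt i} \<Longrightarrow> \<sigma>1 r = \<sigma> r"
    using shift_left_tape[OF i] by blast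
  show ?thesis
    unfolding move_left_def by (rule holds_after_shift[OF h i 1(1) _ 1(3)]) (use 1(2) in simp_all)
qed

lemma holds_write_cell:
  assumes h: "holds t (l, T) \<sigma>" and i: "i \<le> last_tape N" and c: "set (encode_cell c) \<subseteq> symbols"
  shows "holds t (l, write_cell T i c) (\<sigma>(Cur i := encode_cell c))"
proof -
  have "holds_tape i' (write_cell T i c i') (\<sigma>(Cur i := encode_cell c))" if "i' \<le> last_tape N" for i'
  proof -
    have h': "holds_tape i' (T i') \<sigma>" using h that by (simp add: holds_def)
    show ?thesis
    proof (cases "i' = i")
      case True
      obtain \<alpha> m where T: "T i = (\<alpha>, m)" by (cases "T i")
      then obtain cl cr where lr: "\<sigma> (Lft i) = encode_cells cl" "\<sigma> (Rgt i) = encode_cells cr"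
        "half (Inr (blank N)) (\<lambda>k. \<alpha> (m - 1 - int k)) cl" "half (Inr (blank N)) (\<lambda>k. \<alpha> (m + 1 + int k)) cr"
        using h' True by (auto simp: holds_tape_def)
      have "holds_tape i (\<alpha>(m := c), m) (\<sigma>(Cur i := encode_cell c))"
        by (rule holds_tapeI[of _ _ _ _ cl cr])
          (use lr in \<open>auto elim!: half_cong\<close>)
      then show ?thesis using True T by (simp add: write_cell_def)
    next
      case False
      have "holds_tape i' (T i') (\<sigma>(Cur i := encode_cell c))"
        by (rule holds_tape_cong[OF h']) (use False in simp_all)
      then show ?thesis using False by (simp add: write_cell_def)
    qed
  qed
  then show ?thesis using h c by (auto simp: holds_def ok_def write_cell_def)
qed

text \<open>
  A test that is undecided leaves the register \<open>Label\<close> empty, which ends the loop of the stage.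
\<close>

definition statement_program :: "'l \<Rightarrow> (reg, ('l, 'g, 'a) sym, 'a) com" where
  "statement_program l = (case statement N l of
       GoRight i l' \<Rightarrow> Seq (move_right i) (goto l')
     | GoLeft i l' \<Rightarrow> Seq (move_left i) (goto l')
     | Write i a l' \<Rightarrow> Seq (Seq (clear {Cur i}) (push (Cur i) (Gam a))) (goto l')
     | IfSymbol i a l' l'' \<Rightarrow> Case (\<lambda>tp. goto (if tp (Cur i) = Some (Gam a) then l' else l''))
     | Assign i f js l' \<Rightarrow>
         Seq (Seq (call (Mc l) js) (Seq (clear {Cur i}) (Seq (move_all Output (Cur i)) (push (Cur i) Tag))))
             (goto l')
     | Test f js l' l'' \<Rightarrow>
         Seq (call (Mc l) js)
          (Case (\<lambda>tp.
             if tp State = Some (Num (t2_halt (Mc l))) \<and> tp Output = Some (Letter 0) then goto l'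
             else if tp State = Some (Num (t2_halt (Mc l))) \<and> tp Output = Some (Letter 1) then goto l''
             else pop Label)))"

text \<open>
  In a computation that follows one of \<open>N\<close> no function is ever called on a cell with a symbol, so the
  programs do not check this.
\<close>

definition args_available :: "('l, 'g, 'a list) config \<Rightarrow> bool" where
  "args_available \<kappa> \<longleftrightarrow> (case statement N (fst \<kappa>) of
       Assign i f js l' \<Rightarrow> \<forall>j<length js. \<exists>w. cell (snd \<kappa>) (js ! j) = Inl w
     | Test f js l' l'' \<Rightarrow> \<forall>j<length js. \<exists>w. cell (snd \<kappa>) (js ! j) = Inl w
     | _ \<Rightarrow> True)"

lemma holds_cong:
  assumes "holds t \<kappa> \<sigma>" "ok \<sigma>'" "\<And>r. \<not> scratch r \<Longrightarrow> r \<noteq> Ticks \<Longrightarrow> \<sigma>' r = \<sigma> r"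
  shows "holds t \<kappa> \<sigma>'"
proof -
  have "holds_tape i (snd \<kappa> i) \<sigma>'" if "i \<le> last_tape N" for i
    by (rule holds_tape_cong[of i "snd \<kappa> i" \<sigma>]) (use assms that in \<open>simp_all add: holds_def\<close>)
  then show ?thesis using assms by (simp add: holds_def)
qed

lemma holds_call:
  assumes l: "l \<in> labels N" and h: "holds t (l, T) \<sigma>" and n: "t2_inputs (Mc l) = length js"
    and js: "set js \<subseteq> {..last_tape N}" and args: "\<forall>j<length js. \<exists>w. cell T (js ! j) = Inl w"
  obtains \<sigma>' w where "runs (call (Mc l) js) \<sigma> \<sigma>'" "holds t (l, T) \<sigma>'"
    "represents (Mc l) w (trunc_run (Mc l) w t (t2_initial (Mc l))) \<sigma>'"
    "\<And>r. \<not> scratch r \<Longrightarrow> r \<noteq> Ticks \<Longrightarrow> \<sigma>' r = \<sigma> r"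
    "w \<in> extensional {..<length js}" "\<And>j. j < length js \<Longrightarrow> cell T (js ! j) = Inl (w j)"
proof -
  obtain w0 where w0: "\<And>j. j < length js \<Longrightarrow> cell T (js ! j) = Inl (w0 j)" using args by metis
  define w where "w = restrict w0 {..<length js}"
  have w: "cell T (js ! j) = Inl (w j)" if "j < length js" for j using w0 that by (simp add: w_def)
  have js': "js ! j \<le> last_tape N" if "j < length js" for j using js nth_mem[OF that] by blast
  have "\<sigma> (Cur (js ! j)) = Tag # map Letter (w j)" if j: "j < length js" for j
  proof -
    have "holds_tape (js ! j) (T (js ! j)) \<sigma>" using h js'[OF j] by (simp add: holds_def)
    then show ?thesis using w[OF j] by (auto simp: holds_tape_def cell_def split: prod.splits)
  qed
  then obtain \<sigma>' where \<sigma>': "runs (call (Mc l) js) \<sigma> \<sigma>'"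
    "represents (Mc l) w (trunc_run (Mc l) w t (t2_initial (Mc l))) \<sigma>'"
    "\<And>r. \<not> scratch r \<Longrightarrow> r \<noteq> Ticks \<Longrightarrow> \<sigma>' r = \<sigma> r"
    using runs_call[OF l n js', of \<sigma> w t] h by (auto simp: holds_def)
  moreover have "holds t (l, T) \<sigma>'"
    by (rule holds_cong[OF h]) (use runs_ok[OF \<sigma>'(1)] h \<sigma>'(3) in \<open>auto simp: holds_def\<close>)
  ultimately show thesis using that w by (auto simp: w_def)
qed

definition transition :: "nat \<Rightarrow> ('l, 'g, 'a list) config \<Rightarrow> (reg \<Rightarrow> ('l, 'g, 'a) sym list) \<Rightarrow> bool" where
  "transition t \<kappa> \<sigma>' \<longleftrightarrow> (\<exists>\<kappa>'. gtm_step (truncated t) \<kappa> \<kappa>' \<and> holds t \<kappa>' \<sigma>') \<or>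
     \<sigma>' Label = [] \<and> (\<nexists>\<kappa>'. gtm_step (truncated t) \<kappa> \<kappa>')"

text \<open>
  After \<open>call\<close> the register \<open>Output\<close> contains the value of \<open>trunc_assign\<close>, and the symbol on its top
  decides \<open>trunc_test\<close>; the other statements only rearrange the stacks of one tape.
\<close>

lemma runs_statement:
  assumes l: "l \<in> labels N - {final_label N}" and h: "holds t (l, T) \<sigma>" and args: "args_available (l, T)"
  shows "\<exists>\<sigma>'. runs (statement_program l) \<sigma> \<sigma>' \<and> transition t (l, T) \<sigma>' \<and>
     (\<forall>r. persistent r \<or> r = Fuel \<longrightarrow> \<sigma>' r = \<sigma> r)"
proof -
  have wf: "wf_stmt N (statement N l)" using N l by (simp add: generalized_TM_def)
  have b: "i \<le> index_bound" if "i \<le> last_tape N" for i using that by (intro index_bound_tapes) simp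
  have fr: "r \<notin> {Cur i, Lft i, Rgt i, Moves, Label}" if "persistent r \<or> r = Fuel" for r i
    using that by (cases r) auto
  have fs: "\<not> scratch r \<and> r \<noteq> Ticks" if "persistent r \<or> r = Fuel" for r
    using that persistent_not_scratch by auto
  have finish: ?thesis
    if p: "statement_program l = Seq c (goto l')" and c: "runs c \<sigma> \<sigma>1" and h1: "holds t (l, T') \<sigma>1" and l': "l' \<in> labels N"
      and fr1: "\<And>r. persistent r \<or> r = Fuel \<Longrightarrow> \<sigma>1 r = \<sigma> r" and step: "gtm_step (truncated t) (l, T) (l', T')"
    for c \<sigma>1 l' T'
  proof -
    obtain \<sigma>2 where 2: "runs (goto l') \<sigma>1 \<sigma>2" "holds t (l', T') \<sigma>2" "\<forall>r. r \<noteq> Label \<longrightarrow> \<sigma>2 r = \<sigma>1 r"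
      using holds_goto[OF h1 l'] by blast
    have "\<sigma>2 r = \<sigma> r" if "persistent r \<or> r = Fuel" for r
      using 2(3) fr1[OF that] fr[OF that] by auto
    then show ?thesis
      unfolding p using runs_Seq[OF c 2(1)] 2(2) step by (auto simp: transition_def)
  qed
  show ?thesis
  proof (cases "statement N l")
    case (GoRight i l')
    then have il: "i \<le> last_tape N" "l' \<in> labels N" using wf by (auto simp: wf_stmt_def)
    obtain \<sigma>1 where 1: "runs (move_right i) \<sigma> \<sigma>1" "holds t (l, move_head T i 1) \<sigma>1"
      "\<forall>r. r \<notin> {Cur i, Lft i, Rgt i, Moves} \<longrightarrow> \<sigma>1 r = \<sigma> r" using holds_move_right[OF h il(1)] by blast
    show ?thesis
      by (rule finish[OF _ 1(1,2) il(2)])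
        (use l GoRight 1(3) fr[of _ i] in \<open>auto simp: statement_program_def gtm_step_def truncated_def\<close>)
  next
    case (GoLeft i l')
    then have il: "i \<le> last_tape N" "l' \<in> labels N" using wf by (auto simp: wf_stmt_def)
    obtain \<sigma>1 where 1: "runs (move_left i) \<sigma> \<sigma>1" "holds t (l, move_head T i (- 1)) \<sigma>1"
      "\<forall>r. r \<notin> {Cur i, Lft i, Rgt i, Moves} \<longrightarrow> \<sigma>1 r = \<sigma> r" using holds_move_left[OF h il(1)] by blast
    show ?thesis
      by (rule finish[OF _ 1(1,2) il(2)])
        (use l GoLeft 1(3) fr[of _ i] in \<open>auto simp: statement_program_def gtm_step_def truncated_def\<close>)
  next
    case (Write i a l')
    then have il: "i \<le> last_tape N" "l' \<in> labels N" "a \<in> gamma N" using wf by (auto simp: wf_stmt_def)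
    let ?\<sigma>1 = "\<lambda>r. if r \<in> {Cur i} then [] else \<sigma> r"
    let ?\<sigma>2 = "\<sigma>(Cur i := encode_cell (Inr a))"
    have 1: "runs (clear {Cur i}) \<sigma> ?\<sigma>1" by (rule runs_clear) (use b[OF il(1)] in simp)
    have "runs (push (Cur i) (Gam a)) ?\<sigma>1 (?\<sigma>1(Cur i := Gam a # ?\<sigma>1 (Cur i)))"
      by (rule runs_push) (use b[OF il(1)] il(3) in auto)
    moreover have "?\<sigma>1(Cur i := Gam a # ?\<sigma>1 (Cur i)) = ?\<sigma>2" by auto
    ultimately have 2: "runs (push (Cur i) (Gam a)) ?\<sigma>1 ?\<sigma>2" by simp
    have h2: "holds t (l, write_cell T i (Inr a)) ?\<sigma>2"
      by (rule holds_write_cell[OF h il(1)]) (use il(3) in simp)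
    show ?thesis
      by (rule finish[OF _ runs_Seq[OF 1 2] h2 il(2)])
        (use l Write fr[of _ i] in \<open>auto simp: statement_program_def gtm_step_def truncated_def\<close>)
  next
    case (IfSymbol i a l' l'')
    then have il: "i \<le> last_tape N" "l' \<in> labels N" "l'' \<in> labels N" using wf by (auto simp: wf_stmt_def)
    have "holds_tape i (T i) \<sigma>" using h il(1) by (simp add: holds_def)
    then have "\<sigma> (Cur i) = encode_cell (cell T i)" by (auto simp: holds_tape_def cell_def split: prod.splits)
    then have top: "tops \<sigma> (Cur i) = Some (Gam a) \<longleftrightarrow> cell T i = Inr a"
      by (cases "cell T i") (auto simp: tops_def)
    let ?l = "if cell T i = Inr a then l' else l''"
    have lab: "?l \<in> labels N" using il by simp
    obtain \<sigma>1 where 1: "runs (goto ?l) \<sigma> \<sigma>1" "holds t (?l, T) \<sigma>1" "\<forall>r. r \<noteq> Label \<longrightarrow> \<sigma>1 r = \<sigma> r"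
      using holds_goto[OF h lab] by blast
    have "gtm_step (truncated t) (l, T) (?l, T)"
      using l IfSymbol by (simp add: gtm_step_def truncated_def)
    moreover have "runs (statement_program l) \<sigma> \<sigma>1"
      unfolding statement_program_def IfSymbol stmt.case by (rule runs_Case) (use 1(1) top in simp)
    ultimately show ?thesis
      using 1(2,3) fr by (intro exI[of _ \<sigma>1]) (auto simp: transition_def)
  next
    case (Assign i f js l')
    then have il: "i \<le> last_tape N" "l' \<in> labels N" "set js \<subseteq> {..last_tape N}" using wf by (auto simp: wf_stmt_def)
    have n: "t2_inputs (Mc l) = length js" using assign[OF l Assign] by simp
    have av: "\<forall>j<length js. \<exists>w. cell T (js ! j) = Inl w" using args Assign by (simp add: args_available_def)
    obtain \<sigma>1 w where 1: "runs (call (Mc l) js) \<sigma> \<sigma>1" "holds t (l, T) \<sigma>1"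
      "represents (Mc l) w (trunc_run (Mc l) w t (t2_initial (Mc l))) \<sigma>1"
      "\<And>r. \<not> scratch r \<Longrightarrow> r \<noteq> Ticks \<Longrightarrow> \<sigma>1 r = \<sigma> r"
      "w \<in> extensional {..<length js}" "\<And>j. j < length js \<Longrightarrow> cell T (js ! j) = Inl (w j)"
      using holds_call[OF _ h n il(3) av] l by blast
    let ?u = "c_output (trunc_run (Mc l) w t (t2_initial (Mc l)))"
    have out: "\<sigma>1 Output = rev (map Letter ?u)" using 1(3) by (simp add: represents_def)
    let ?\<sigma>2 = "\<lambda>r. if r \<in> {Cur i} then [] else \<sigma>1 r"
    have 2: "runs (clear {Cur i}) \<sigma>1 ?\<sigma>2" by (rule runs_clear) (use b[OF il(1)] in simp)
    let ?\<sigma>3 = "?\<sigma>2(Output := [], Cur i := rev (?\<sigma>2 Output) @ ?\<sigma>2 (Cur i))"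
    have 3: "runs (move_all Output (Cur i)) ?\<sigma>2 ?\<sigma>3"
      by (rule runs_move_all) (use b[OF il(1)] out in auto)
    let ?\<sigma>1' = "\<sigma>1(Output := [])"
    let ?\<sigma>4 = "?\<sigma>1'(Cur i := encode_cell (Inl ?u))"
    have "runs (push (Cur i) Tag) ?\<sigma>3 (?\<sigma>3(Cur i := Tag # ?\<sigma>3 (Cur i)))"
      by (rule runs_push) (use b[OF il(1)] in auto)
    moreover have "?\<sigma>3(Cur i := Tag # ?\<sigma>3 (Cur i)) = ?\<sigma>4" using out by (auto simp: fun_eq_iff)
    ultimately have 4: "runs (push (Cur i) Tag) ?\<sigma>3 ?\<sigma>4" by simp
    have h1: "holds t (l, T) ?\<sigma>1'" by (rule holds_cong[OF 1(2)]) (use 1(2) in \<open>auto simp: holds_def ok_def\<close>)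
    have h4: "holds t (l, write_cell T i (Inl ?u)) ?\<sigma>4"
      by (rule holds_write_cell[OF h1 il(1)]) auto
    have "apply_fun (trunc_assign (Mc l) t) js T ?u"
      unfolding apply_fun_def using 1(5,6) by (intro bexI[of _ w]) (auto simp: trunc_assign_def)
    then have step: "gtm_step (truncated t) (l, T) (l', write_cell T i (Inl ?u))"
      using l Assign by (auto simp: gtm_step_def truncated_def)
    have fr4: "?\<sigma>4 r = \<sigma> r" if "persistent r \<or> r = Fuel" for r
      using 1(4)[of r] fs[OF that] fr[OF that, of i] by auto
    show ?thesis
      by (rule finish[OF _ runs_Seq[OF 1(1) runs_Seq[OF 2 runs_Seq[OF 3 4]]] h4 il(2) fr4 step])
        (simp add: statement_program_def Assign)
  next
    case (Test f js l' l'')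
    then have il: "l' \<in> labels N" "l'' \<in> labels N" "set js \<subseteq> {..last_tape N}" using wf by (auto simp: wf_stmt_def)
    have n: "t2_inputs (Mc l) = length js" using test[OF l Test] by simp
    have av: "\<forall>j<length js. \<exists>w. cell T (js ! j) = Inl w" using args Test by (simp add: args_available_def)
    obtain \<sigma>1 w where 1: "runs (call (Mc l) js) \<sigma> \<sigma>1" "holds t (l, T) \<sigma>1"
      "represents (Mc l) w (trunc_run (Mc l) w t (t2_initial (Mc l))) \<sigma>1"
      "\<And>r. \<not> scratch r \<Longrightarrow> r \<noteq> Ticks \<Longrightarrow> \<sigma>1 r = \<sigma> r"
      "w \<in> extensional {..<length js}" "\<And>j. j < length js \<Longrightarrow> cell T (js ! j) = Inl (w j)"
      using holds_call[OF _ h n il(3) av] l by blast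
    let ?c = "trunc_run (Mc l) w t (t2_initial (Mc l))"
    have st: "tops \<sigma>1 State = Some (Num (t2_halt (Mc l))) \<longleftrightarrow> c_state ?c = t2_halt (Mc l)"
      using 1(3) by (simp add: represents_def tops_def)
    have "\<sigma>1 Output = rev (map Letter (c_output ?c))" using 1(3) by (simp add: represents_def)
    then have out: "tops \<sigma>1 Output = Some (Letter a) \<longleftrightarrow> c_output ?c \<noteq> [] \<and> last (c_output ?c) = a" for a
      by (cases "c_output ?c" rule: rev_cases) (auto simp: tops_def)
    have app: "apply_fun (trunc_test (Mc l) t) js T v \<longleftrightarrow> trunc_test (Mc l) t w = Some v" for v
    proof
      assume "apply_fun (trunc_test (Mc l) t) js T v"
      moreover have "apply_fun (\<lambda>y. Some y) js T w" unfolding apply_fun_def using 1(5,6) by auto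
      ultimately show "trunc_test (Mc l) t w = Some v"
        using apply_fun_unique[of "\<lambda>y. Some y" js T w] by (auto simp: apply_fun_def)
    next
      assume "trunc_test (Mc l) t w = Some v"
      then show "apply_fun (trunc_test (Mc l) t) js T v" unfolding apply_fun_def using 1(5,6) by auto
    qed
    let ?p = "if tops \<sigma>1 State = Some (Num (t2_halt (Mc l))) \<and> tops \<sigma>1 Output = Some (Letter 0) then goto l'
             else if tops \<sigma>1 State = Some (Num (t2_halt (Mc l))) \<and> tops \<sigma>1 Output = Some (Letter 1) then goto l''
             else pop Label"
    have "\<exists>\<sigma>2. runs ?p \<sigma>1 \<sigma>2 \<and> transition t (l, T) \<sigma>2 \<and> (\<forall>r. r \<noteq> Label \<longrightarrow> \<sigma>2 r = \<sigma>1 r)"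
    proof -
      have "trunc_test (Mc l) t w = None \<or>
          c_state ?c = t2_halt (Mc l) \<and> c_output ?c \<noteq> [] \<and> (last (c_output ?c) = 0 \<or> last (c_output ?c) = 1)"
        by (simp add: trunc_test_def Let_def)
      then consider (zero) "c_state ?c = t2_halt (Mc l)" "c_output ?c \<noteq> []" "last (c_output ?c) = 0"
        | (one) "c_state ?c = t2_halt (Mc l)" "c_output ?c \<noteq> []" "last (c_output ?c) = 1"
        | (undecided) "trunc_test (Mc l) t w = None"
        by auto
      then show ?thesis
      proof cases
        case zero
        then have "gtm_step (truncated t) (l, T) (l', T)"
          using l Test app[of "[0]"] by (simp add: gtm_step_def truncated_def trunc_test_def)
        then show ?thesis
          using holds_goto[OF 1(2) il(1)] zero st out by (auto simp: transition_def)
      next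
        case one
        then have "gtm_step (truncated t) (l, T) (l'', T)"
          using l Test app[of "[1]"] by (simp add: gtm_step_def truncated_def trunc_test_def)
        then show ?thesis
          using holds_goto[OF 1(2) il(2)] one st out by (auto simp: transition_def)
      next
        case undecided
        then have "\<not> gtm_step (truncated t) (l, T) \<kappa>'" for \<kappa>'
          using l Test app by (simp add: gtm_step_def truncated_def)
        moreover have "runs ?p \<sigma>1 (\<sigma>1(Label := tl (\<sigma>1 Label)))"
          using runs_pop[of Label \<sigma>1] undecided st out by (auto simp: trunc_test_def Let_def split: if_splits)
        moreover have "\<sigma>1 Label = [Lab l]" using 1(2) by (simp add: holds_def)
        ultimately show ?thesis
          by (intro exI[of _ "\<sigma>1(Label := tl (\<sigma>1 Label))"]) (simp add: transition_def)
      qed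
    qed
    then obtain \<sigma>2 where 2: "runs ?p \<sigma>1 \<sigma>2" "transition t (l, T) \<sigma>2" "\<forall>r. r \<noteq> Label \<longrightarrow> \<sigma>2 r = \<sigma>1 r" by blast
    have "runs (statement_program l) \<sigma> \<sigma>2"
      unfolding statement_program_def Test stmt.case by (rule runs_Seq[OF 1(1)], rule runs_Case, rule 2(1))
    moreover have "\<sigma>2 r = \<sigma> r" if "persistent r \<or> r = Fuel" for r
      using 2(3) 1(4)[of r] fs[OF that] fr[OF that] by auto
    ultimately show ?thesis using 2(2) by blast
  qed
qed

end

section \<open>Stages of growing precision\<close>

context simulation
begin

definition run_program :: "(reg, ('l, 'g, 'a) sym, 'a) com" where
  "run_program =
     While (\<lambda>tp. tp Fuel \<noteq> None \<and> (\<exists>l. tp Label = Some (Lab l) \<and> l \<noteq> final_label N))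
       (Seq (pop Fuel) (Case (\<lambda>tp. case tp Label of Some (Lab l) \<Rightarrow> statement_program l | _ \<Rightarrow> skip)))"

text \<open>
  The result of a stage with \<open>f\<close> steps: it ends at the final label, or the final label is not within
  \<open>f\<close> steps.
\<close>

definition outcome :: "nat \<Rightarrow> nat \<Rightarrow> ('l, 'g, 'a list) config \<Rightarrow> (reg \<Rightarrow> ('l, 'g, 'a) sym list) \<Rightarrow> bool" where
  "outcome t f \<kappa> \<sigma>' \<longleftrightarrow>
     (\<exists>d \<kappa>'. (gtm_step (truncated t) ^^ d) \<kappa> \<kappa>' \<and> fst \<kappa>' = final_label N \<and> holds t \<kappa>' \<sigma>') \<or>
     tops \<sigma>' Label \<noteq> Some (Lab (final_label N)) \<and>
       (\<nexists>d \<kappa>'. d \<le> f \<and> (gtm_step (truncated t) ^^ d) \<kappa> \<kappa>' \<and> fst \<kappa>' = final_label N)"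

lemma no_truncated_step_final: "fst \<kappa> = final_label N \<Longrightarrow> \<not> gtm_step (truncated t) \<kappa> \<kappa>'"
  by (rule no_step_final) (simp add: truncated_def)

lemma runs_run_program:
  assumes avail: "\<And>d \<kappa>'. (gtm_step (truncated t) ^^ d) \<kappa> \<kappa>' \<Longrightarrow> fst \<kappa>' \<noteq> final_label N \<Longrightarrow>
      fst \<kappa>' \<in> labels N \<and> args_available \<kappa>'"
    and h: "holds t \<kappa> \<sigma>" and f: "length (\<sigma> Fuel) = f"
  shows "\<exists>\<sigma>'. runs run_program \<sigma> \<sigma>' \<and> outcome t f \<kappa> \<sigma>' \<and> (\<forall>r. persistent r \<longrightarrow> \<sigma>' r = \<sigma> r)"
  using assms
proof (induction f arbitrary: \<kappa> \<sigma>)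
  case 0
  have "runs run_program \<sigma> \<sigma>"
    unfolding run_program_def by (rule runs_While_False) (use 0 in simp)
  moreover have "outcome t 0 \<kappa> \<sigma>"
  proof (cases "fst \<kappa> = final_label N")
    case True
    then show ?thesis using 0 unfolding outcome_def by (metis relpowp_0_I)
  next
    case False
    then show ?thesis using 0 by (auto simp: outcome_def holds_def tops_Cons)
  qed
  ultimately show ?case by blast
next
  case (Suc f)
  obtain l T where \<kappa>: "\<kappa> = (l, T)" by (cases \<kappa>)
  have lab: "\<sigma> Label = [Lab l]" using Suc.prems(2) \<kappa> by (simp add: holds_def)
  show ?case
  proof (cases "l = final_label N")
    case True
    have "runs run_program \<sigma> \<sigma>"
      unfolding run_program_def by (rule runs_While_False) (use lab True in \<open>auto simp: tops_Cons\<close>)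
    moreover have "outcome t (Suc f) \<kappa> \<sigma>"
      using Suc.prems(2) \<kappa> True unfolding outcome_def by (metis fst_conv relpowp_0_I)
    ultimately show ?thesis by blast
  next
    case False
    have l: "l \<in> labels N - {final_label N}" "args_available (l, T)"
      using Suc.prems(1)[of 0 \<kappa>] False \<kappa> by auto
    let ?\<sigma>1 = "\<sigma>(Fuel := tl (\<sigma> Fuel))"
    have 1: "runs (pop Fuel) \<sigma> ?\<sigma>1" by (rule runs_pop) simp
    have ok1: "ok ?\<sigma>1" using runs_ok[OF 1] Suc.prems(2) by (simp add: holds_def)
    have tape1: "holds_tape i (T i) ?\<sigma>1" if "i \<le> last_tape N" for i
      by (rule holds_tape_cong[of i "T i" \<sigma>]) (use Suc.prems(2) \<kappa> that in \<open>simp_all add: holds_def\<close>)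
    have h1: "holds t (l, T) ?\<sigma>1"
      using Suc.prems(2) \<kappa> ok1 tape1 by (simp add: holds_def)
    obtain \<sigma>2 where 2: "runs (statement_program l) ?\<sigma>1 \<sigma>2" "transition t (l, T) \<sigma>2"
      "\<forall>r. persistent r \<or> r = Fuel \<longrightarrow> \<sigma>2 r = ?\<sigma>1 r"
      using runs_statement[OF l(1) h1 l(2)] by blast
    have "runs (Case (\<lambda>tp. case tp Label of Some (Lab l) \<Rightarrow> statement_program l | _ \<Rightarrow> skip)) ?\<sigma>1 \<sigma>2"
      by (rule runs_Case) (use lab 2(1) in \<open>simp add: tops_Cons\<close>)
    note body = runs_Seq[OF 1 this]
    have pers: "\<forall>r. persistent r \<longrightarrow> \<sigma>2 r = \<sigma> r"
    proof (intro allI impI)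
      fix r assume "persistent r"
      then show "\<sigma>2 r = \<sigma> r" using 2(3) by (cases r) auto
    qed
    have f2: "length (\<sigma>2 Fuel) = f" using 2(3) Suc.prems(3) by simp
    have "\<exists>\<sigma>'. runs run_program \<sigma>2 \<sigma>' \<and> outcome t (Suc f) \<kappa> \<sigma>' \<and> (\<forall>r. persistent r \<longrightarrow> \<sigma>' r = \<sigma>2 r)"
    proof (cases "\<exists>\<kappa>'. gtm_step (truncated t) (l, T) \<kappa>'")
      case True
      then obtain \<kappa>' where \<kappa>': "gtm_step (truncated t) \<kappa> \<kappa>'" "holds t \<kappa>' \<sigma>2"
        using 2(2) \<kappa> by (auto simp: transition_def)
      have avail': "fst \<kappa>'' \<in> labels N \<and> args_available \<kappa>''"
        if "(gtm_step (truncated t) ^^ d) \<kappa>' \<kappa>''" "fst \<kappa>'' \<noteq> final_label N" for d \<kappa>''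
        using Suc.prems(1)[OF relpowp_Suc_I2[of "gtm_step (truncated t)", OF \<kappa>'(1) that(1)] that(2)] .
      obtain \<sigma>3 where
        3: "runs run_program \<sigma>2 \<sigma>3" "outcome t f \<kappa>' \<sigma>3" "\<forall>r. persistent r \<longrightarrow> \<sigma>3 r = \<sigma>2 r"
        using Suc.IH[of \<kappa>' \<sigma>2] avail' \<kappa>'(2) f2 by blast
      have "outcome t (Suc f) \<kappa> \<sigma>3"
      proof (cases "\<exists>d \<kappa>''. (gtm_step (truncated t) ^^ d) \<kappa>' \<kappa>'' \<and> fst \<kappa>'' = final_label N \<and> holds t \<kappa>'' \<sigma>3")
        case True
        then show ?thesis
          using relpowp_Suc_I2[of "gtm_step (truncated t)", OF \<kappa>'(1)] unfolding outcome_def by blast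
      next
        case unfinished: False
        then have n: "tops \<sigma>3 Label \<noteq> Some (Lab (final_label N))"
          "\<nexists>d \<kappa>''. d \<le> f \<and> (gtm_step (truncated t) ^^ d) \<kappa>' \<kappa>'' \<and> fst \<kappa>'' = final_label N"
          using 3(2) unfolding outcome_def by blast+
        have "\<not> (d \<le> Suc f \<and> (gtm_step (truncated t) ^^ d) \<kappa> \<kappa>'' \<and> fst \<kappa>'' = final_label N)" for d \<kappa>''
        proof
          assume d: "d \<le> Suc f \<and> (gtm_step (truncated t) ^^ d) \<kappa> \<kappa>'' \<and> fst \<kappa>'' = final_label N"
          show False
          proof (cases d)
            case 0
            then show False using d \<kappa> False by auto
          next
            case (Suc d')
            then obtain \<kappa>1 where "gtm_step (truncated t) \<kappa> \<kappa>1" "(gtm_step (truncated t) ^^ d') \<kappa>1 \<kappa>''"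
              using d relpowp_Suc_D2 by metis
            moreover have "\<kappa>1 = \<kappa>'" using gtm_step_det calculation(1) \<kappa>'(1) by blast
            moreover have "d' \<le> f" using d Suc by simp
            ultimately show False using n(2) d by blast
          qed
        qed
        then show ?thesis using n(1) unfolding outcome_def by blast
      qed
      then show ?thesis using 3 by blast
    next
      case stuck: False
      then have "\<sigma>2 Label = []" using 2(2) by (auto simp: transition_def)
      have "\<not> (gtm_step (truncated t) ^^ d) \<kappa> \<kappa>' \<or> fst \<kappa>' \<noteq> final_label N" for d \<kappa>'
      proof (cases d)
        case 0
        then show ?thesis using \<kappa> False by auto
      next
        case (Suc d')
        then show ?thesis using stuck \<kappa> relpowp_Suc_D2[of d' "gtm_step (truncated t)" \<kappa> \<kappa>'] by blast
      qed
      moreover have "tops \<sigma>2 Label \<noteq> Some (Lab (final_label N))"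
        using \<open>\<sigma>2 Label = []\<close> by (simp add: tops_def)
      ultimately have "outcome t (Suc f) \<kappa> \<sigma>2" unfolding outcome_def by blast
      moreover have "runs run_program \<sigma>2 \<sigma>2"
        unfolding run_program_def
        by (rule runs_While_False) (use \<open>\<sigma>2 Label = []\<close> in \<open>auto simp: tops_def\<close>)
      ultimately show ?thesis by blast
    qed
    then obtain \<sigma>3 where 3: "runs run_program \<sigma>2 \<sigma>3" "outcome t (Suc f) \<kappa> \<sigma>3"
      "\<forall>r. persistent r \<longrightarrow> \<sigma>3 r = \<sigma>2 r" by blast
    have "runs run_program \<sigma> \<sigma>3"
      unfolding run_program_def
      by (rule runs_While_True[OF _ body 3(1)[unfolded run_program_def]])
        (use lab False Suc.prems(3) in \<open>auto simp: tops_Cons\<close>)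
    then show ?thesis using 3 pers by auto
  qed
qed

text \<open>
  The result is in cell 0 of tape 0, wherever the head is; so the recorded moves are undone.
\<close>

definition unwind :: "(reg, ('l, 'g, 'a) sym, 'a) com" where
  "unwind = While (\<lambda>tp. tp Moves \<noteq> None)
     (Case (\<lambda>tp. Seq (pop Moves)
        (if tp Moves = Some Mark then shift 0 (Lft 0) (Rgt 0) else shift 0 (Rgt 0) (Lft 0))))"

lemma runs_unwind:
  assumes "ok \<sigma>" "holds_tape 0 (\<alpha>, displacement (\<sigma> Moves)) \<sigma>"
  shows "\<exists>\<sigma>'. runs unwind \<sigma> \<sigma>' \<and> \<sigma>' (Cur 0) = encode_cell (\<alpha> 0) \<and>
     (\<forall>r. r \<notin> {Moves, Cur 0, Lft 0, Rgt 0} \<longrightarrow> \<sigma>' r = \<sigma> r)"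
  using assms
proof (induction "\<sigma> Moves" arbitrary: \<sigma>)
  case Nil
  then have "runs unwind \<sigma> \<sigma>" unfolding unwind_def by (intro runs_While_False) simp
  moreover have "\<sigma> (Cur 0) = encode_cell (\<alpha> 0)" using Nil by (auto simp: holds_tape_def)
  ultimately show ?case by blast
next
  case (Cons s ms)
  have m: "\<sigma> Moves = s # ms" using Cons by simp
  let ?\<sigma>1 = "\<sigma>(Moves := tl (\<sigma> Moves))"
  have 1: "runs (pop Moves) \<sigma> ?\<sigma>1" by (rule runs_pop) simp
  have ok1: "ok ?\<sigma>1" using runs_ok[OF 1 Cons.prems(1)] .
  have h1: "holds_tape 0 (\<alpha>, displacement (\<sigma> Moves)) ?\<sigma>1"
    by (rule holds_tape_cong[OF Cons.prems(2)]) simp_all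
  have "\<exists>\<sigma>2. runs (if s = Mark then shift 0 (Lft 0) (Rgt 0) else shift 0 (Rgt 0) (Lft 0)) ?\<sigma>1 \<sigma>2 \<and>
      holds_tape 0 (\<alpha>, displacement ms) \<sigma>2 \<and> (\<forall>r. r \<notin> {Cur 0, Lft 0, Rgt 0} \<longrightarrow> \<sigma>2 r = ?\<sigma>1 r)"
  proof (cases "s = Mark")
    case True
    have d: "displacement (\<sigma> Moves) - 1 = displacement ms" using m True by simp
    obtain \<sigma>2 where "runs (shift 0 (Lft 0) (Rgt 0)) ?\<sigma>1 \<sigma>2" "holds_tape 0 (\<alpha>, displacement (\<sigma> Moves) - 1) \<sigma>2"
      "\<And>r. r \<notin> {Cur 0, Lft 0, Rgt 0} \<Longrightarrow> \<sigma>2 r = ?\<sigma>1 r"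
      using shift_left_tape[OF _ ok1 h1] by blast
    then show ?thesis using True d by auto
  next
    case False
    have d: "displacement (\<sigma> Moves) + 1 = displacement ms" using m False by simp
    obtain \<sigma>2 where "runs (shift 0 (Rgt 0) (Lft 0)) ?\<sigma>1 \<sigma>2" "holds_tape 0 (\<alpha>, displacement (\<sigma> Moves) + 1) \<sigma>2"
      "\<And>r. r \<notin> {Cur 0, Lft 0, Rgt 0} \<Longrightarrow> \<sigma>2 r = ?\<sigma>1 r"
      using shift_right_tape[OF _ ok1 h1] by blast
    then show ?thesis using False d by auto
  qed
  then obtain \<sigma>2 where 2: "runs (if s = Mark then shift 0 (Lft 0) (Rgt 0) else shift 0 (Rgt 0) (Lft 0)) ?\<sigma>1 \<sigma>2"
    "holds_tape 0 (\<alpha>, displacement ms) \<sigma>2" "\<forall>r. r \<notin> {Cur 0, Lft 0, Rgt 0} \<longrightarrow> \<sigma>2 r = ?\<sigma>1 r" by blast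
  have m2: "\<sigma>2 Moves = ms" using 2(3) m by simp
  have body: "runs (Case (\<lambda>tp. Seq (pop Moves)
        (if tp Moves = Some Mark then shift 0 (Lft 0) (Rgt 0) else shift 0 (Rgt 0) (Lft 0)))) \<sigma> \<sigma>2"
    by (rule runs_Case) (use runs_Seq[OF 1 2(1)] m in \<open>simp add: tops_Cons\<close>)
  obtain \<sigma>3 where 3: "runs unwind \<sigma>2 \<sigma>3" "\<sigma>3 (Cur 0) = encode_cell (\<alpha> 0)"
    "\<forall>r. r \<notin> {Moves, Cur 0, Lft 0, Rgt 0} \<longrightarrow> \<sigma>3 r = \<sigma>2 r"
    using Cons.hyps(1)[OF m2[symmetric] runs_ok[OF 2(1) ok1]] 2(2) m2 by blast
  have "runs unwind \<sigma> \<sigma>3"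
    unfolding unwind_def
    by (rule runs_While_True[OF _ body 3(1)[unfolded unwind_def]]) (use m in simp)
  then show ?case using 2(3) 3 by auto
qed

definition emit_rest :: "(reg, ('l, 'g, 'a) sym, 'a) com" where
  "emit_rest = While (\<lambda>tp. tp (Cur 0) \<noteq> None)
     (Case (\<lambda>tp. case tp (Cur 0) of
         Some (Letter a) \<Rightarrow> Seq (Emit a) (Par ((\<lambda>_. Keep)(Cur 0 := Pop, Tmp := Push Mark)))
       | _ \<Rightarrow> skip))"

abbreviation exc where "exc \<equiv> exec registers symbols (arity N)"

lemma runs_exec: "runs c \<sigma> \<sigma>' \<Longrightarrow> exc x c (\<sigma>, h, u) (\<sigma>', h, u)"
  by (simp add: runs_def)

lemma exec_emit_rest:
  "\<sigma> (Cur 0) = map Letter w \<Longrightarrow>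
   exc x emit_rest (\<sigma>, h, u) (\<sigma>(Cur 0 := [], Tmp := replicate (length w) Mark @ \<sigma> Tmp), h, u @ w)"
proof (induction w arbitrary: \<sigma> u)
  case Nil
  then have eq: "\<sigma>(Cur 0 := [], Tmp := replicate (length ([] :: 'a list)) Mark @ \<sigma> Tmp) = \<sigma>"
    by (auto simp: fun_eq_iff)
  show ?case
    unfolding emit_rest_def eq append_Nil2 by (rule exec.While_False) (use Nil in simp)
next
  case (Cons a w)
  let ?\<sigma>1 = "\<sigma>(Cur 0 := map Letter w, Tmp := Mark # \<sigma> Tmp)"
  have "runs (Par ((\<lambda>_. Keep)(Cur 0 := Pop, Tmp := Push Mark))) \<sigma> ?\<sigma>1"
    by (rule runs_Par) (use Cons.prems in \<open>auto split: if_splits\<close>)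
  then have body: "exc x (Case (\<lambda>tp. case tp (Cur 0) of
         Some (Letter a) \<Rightarrow> Seq (Emit a) (Par ((\<lambda>_. Keep)(Cur 0 := Pop, Tmp := Push Mark)))
       | _ \<Rightarrow> skip)) (\<sigma>, h, u) (?\<sigma>1, h, u @ [a])"
    using Cons.prems by (intro exec.Case) (auto simp: tops_Cons intro: exec.Seq exec.Emit runs_exec)
  have "exc x emit_rest (?\<sigma>1, h, u @ [a])
     (?\<sigma>1(Cur 0 := [], Tmp := replicate (length w) Mark @ ?\<sigma>1 Tmp), h, (u @ [a]) @ w)"
    by (rule Cons.IH) simp
  moreover have "?\<sigma>1(Cur 0 := [], Tmp := replicate (length w) Mark @ ?\<sigma>1 Tmp) =
     \<sigma>(Cur 0 := [], Tmp := replicate (length (a # w)) Mark @ \<sigma> Tmp)"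
    by (auto simp: fun_eq_iff replicate_app_Cons_same)
  ultimately have rest: "exc x emit_rest (?\<sigma>1, h, u @ [a])
     (\<sigma>(Cur 0 := [], Tmp := replicate (length (a # w)) Mark @ \<sigma> Tmp), h, u @ a # w)" by simp
  show ?case
    unfolding emit_rest_def
    by (rule exec.While_True[OF _ body rest[unfolded emit_rest_def]]) (use Cons.prems in simp)
qed

definition skip_emitted :: "(reg, ('l, 'g, 'a) sym, 'a) com" where
  "skip_emitted = While (\<lambda>tp. tp Emitted \<noteq> None \<and> tp (Cur 0) \<noteq> None)
     (Par ((\<lambda>_. Keep)(Emitted := Pop, Cur 0 := Pop, Tmp := Push Mark)))"

lemma runs_skip_emitted:
  "runs skip_emitted \<sigma> (\<sigma>(Emitted := drop (length (\<sigma> (Cur 0))) (\<sigma> Emitted),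
     Cur 0 := drop (length (\<sigma> Emitted)) (\<sigma> (Cur 0)),
     Tmp := replicate (min (length (\<sigma> Emitted)) (length (\<sigma> (Cur 0)))) Mark @ \<sigma> Tmp))"
  (is "runs _ _ (?F \<sigma>)")
proof (induction "\<sigma> Emitted" arbitrary: \<sigma>)
  case Nil
  have eq: "?F \<sigma> = \<sigma>" using Nil by (auto simp: fun_eq_iff)
  show ?case
    unfolding skip_emitted_def eq by (rule runs_While_False) (use Nil in simp)
next
  case (Cons s e)
  have e: "\<sigma> Emitted = s # e" using Cons by simp
  show ?case
  proof (cases "\<sigma> (Cur 0)")
    case Nil
    have eq: "?F \<sigma> = \<sigma>" using Nil by (auto simp: fun_eq_iff)
    show ?thesis
      unfolding skip_emitted_def eq by (rule runs_While_False) (use Nil in simp)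
  next
    case c: (Cons a w)
    let ?\<sigma>1 = "\<sigma>(Emitted := e, Cur 0 := w, Tmp := Mark # \<sigma> Tmp)"
    have 1: "runs (Par ((\<lambda>_. Keep)(Emitted := Pop, Cur 0 := Pop, Tmp := Push Mark))) \<sigma> ?\<sigma>1"
      by (rule runs_Par) (use c e in \<open>auto split: if_splits\<close>)
    have "runs skip_emitted ?\<sigma>1 (?F ?\<sigma>1)"
      by (rule Cons.hyps) simp
    moreover have "?F ?\<sigma>1 = ?F \<sigma>"
      using c e by (auto simp: fun_eq_iff replicate_app_Cons_same)
    ultimately have 2: "runs skip_emitted ?\<sigma>1 (?F \<sigma>)" by (simp only:)
    show ?thesis
      unfolding skip_emitted_def
      by (rule runs_While_True[OF _ 1 2[unfolded skip_emitted_def]]) (use c e in simp)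
  qed
qed

text \<open>
  Since all results are prefixes of one sequence, it is enough to skip as many symbols as have been
  emitted and to emit the rest; \<open>Tmp\<close> counts both kinds.
\<close>

definition emit_new :: "(reg, ('l, 'g, 'a) sym, 'a) com" where
  "emit_new = Seq (pop (Cur 0)) (Seq skip_emitted (Seq emit_rest (move_all Tmp Emitted)))"

lemma exec_emit_new:
  assumes ok: "ok \<sigma>" and c: "\<sigma> (Cur 0) = Tag # map Letter w" and tmp: "\<sigma> Tmp = []" and e: "length (\<sigma> Emitted) = length u"
  shows "\<exists>\<sigma>'. exc x emit_new (\<sigma>, h, u) (\<sigma>', h, u @ drop (length u) w) \<and>
     length (\<sigma>' Emitted) = length (u @ drop (length u) w) \<and> (\<forall>r. r \<notin> {Cur 0, Tmp, Emitted} \<longrightarrow> \<sigma>' r = \<sigma> r)"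
proof -
  let ?\<sigma>1 = "\<sigma>(Cur 0 := tl (\<sigma> (Cur 0)))"
  have 1: "runs (pop (Cur 0)) \<sigma> ?\<sigma>1" by (rule runs_pop) simp
  let ?\<sigma>2 = "?\<sigma>1(Emitted := drop (length (?\<sigma>1 (Cur 0))) (?\<sigma>1 Emitted),
     Cur 0 := drop (length (?\<sigma>1 Emitted)) (?\<sigma>1 (Cur 0)),
     Tmp := replicate (min (length (?\<sigma>1 Emitted)) (length (?\<sigma>1 (Cur 0)))) Mark @ ?\<sigma>1 Tmp)"
  have 2: "runs skip_emitted ?\<sigma>1 ?\<sigma>2" by (rule runs_skip_emitted)
  let ?w = "drop (length u) w"
  let ?\<sigma>3 = "?\<sigma>2(Cur 0 := [], Tmp := replicate (length ?w) Mark @ ?\<sigma>2 Tmp)"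
  have 3: "exc x emit_rest (?\<sigma>2, h, u) (?\<sigma>3, h, u @ ?w)"
    by (rule exec_emit_rest) (use c e in \<open>simp add: drop_map\<close>)
  let ?\<sigma>4 = "?\<sigma>3(Tmp := [], Emitted := rev (?\<sigma>3 Tmp) @ ?\<sigma>3 Emitted)"
  have 4: "runs (move_all Tmp Emitted) ?\<sigma>3 ?\<sigma>4"
    by (rule runs_move_all) (use tmp in auto)
  have "exc x emit_new (\<sigma>, h, u) (?\<sigma>4, h, u @ ?w)"
    unfolding emit_new_def using runs_exec[OF 1] runs_exec[OF 2] 3 runs_exec[OF 4] by (blast intro: exec.Seq)
  moreover have "length (?\<sigma>4 Emitted) = length (u @ ?w)"
    using c e tmp by simp
  ultimately show ?thesis by (intro exI[of _ ?\<sigma>4]) auto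
qed

definition read_program :: "(reg, ('l, 'g, 'a) sym, 'a) com" where
  "read_program = Read (\<lambda>v. Par (\<lambda>r. case r of
       Prefix j \<Rightarrow> if j < arity N then Push (Letter (v ! j)) else Keep
     | Clock \<Rightarrow> Push Mark
     | _ \<Rightarrow> Keep))"

definition load_program :: "(reg, ('l, 'g, 'a) sym, 'a) com" where
  "load_program =
     Seq (clear {r \<in> registers. \<not> persistent r})
    (Seq (Par (\<lambda>r. case r of
            Cur i \<Rightarrow> if i \<le> last_tape N \<and> i \<notin> {1..arity N} then Push (Gam (blank N)) else Keep
          | Label \<Rightarrow> Push (Lab (initial_label N))
          | _ \<Rightarrow> Keep))
    (Seq (Seqs (map (\<lambda>j. Seq (copy_rev Tmp (Prefix j) (Cur (Suc j))) (push (Cur (Suc j)) Tag)) [0..<arity N]))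
         (copy Tmp Clock Fuel)))"

definition finish_program :: "(reg, ('l, 'g, 'a) sym, 'a) com" where
  "finish_program = Case (\<lambda>tp. if tp Label = Some (Lab (final_label N)) then Seq unwind emit_new else skip)"

text \<open>
  Every stage starts afresh from the input prefixes, now one symbol longer.
\<close>

definition stage :: "(reg, ('l, 'g, 'a) sym, 'a) com" where
  "stage = Seq read_program (Seq load_program (Seq run_program finish_program))"

definition stage_inv :: "(nat \<Rightarrow> 'a word) \<Rightarrow> nat \<Rightarrow> 'a list \<Rightarrow> (reg \<Rightarrow> ('l, 'g, 'a) sym list) \<Rightarrow> bool" where
  "stage_inv x t u \<sigma> \<longleftrightarrow> ok \<sigma> \<and> length (\<sigma> Clock) = t \<and> length (\<sigma> Emitted) = length u \<and>
     (\<forall>j<arity N. \<sigma> (Prefix j) = rev (map Letter (map (x j) [0..<t])))"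

text \<open>
  Nothing is left to be emitted from a result reached within \<open>t\<close> steps of \<open>truncated t\<close>.
\<close>

definition caught_up :: "(nat \<Rightarrow> 'a word) \<Rightarrow> nat \<Rightarrow> 'a list \<Rightarrow> bool" where
  "caught_up x t u \<longleftrightarrow> (\<forall>d \<kappa> w. d \<le> t \<longrightarrow> (gtm_step (truncated t) ^^ d) (start x t) \<kappa> \<longrightarrow>
     fst \<kappa> = final_label N \<longrightarrow> fst (snd \<kappa> 0) 0 = Inl w \<longrightarrow> length w \<le> length u)"

lemma arity_bound: "arity N \<le> last_tape N"
  using N by (simp add: generalized_TM_def)

lemma exec_read_program:
  assumes "stage_inv x t u \<sigma>"
  shows "\<exists>\<sigma>'. exc x read_program (\<sigma>, t, u) (\<sigma>', Suc t, u) \<and> stage_inv x (Suc t) u \<sigma>'"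
proof -
  let ?v = "map (\<lambda>j. x j t) [0..<arity N]"
  let ?A = "\<lambda>r. case r of Prefix j \<Rightarrow> if j < arity N then Push (Letter (?v ! j)) else Keep
     | Clock \<Rightarrow> Push Mark | _ \<Rightarrow> Keep"
  have r: "runs (Par ?A) \<sigma> (\<lambda>r. act (?A r) (\<sigma> r))"
    by (rule runs_Par) (use index_bound_tapes in \<open>auto split: reg.splits if_splits\<close>)
  have "exc x read_program (\<sigma>, t, u) (\<lambda>r. act (?A r) (\<sigma> r), Suc t, u)"
    unfolding read_program_def by (rule exec.Read) (rule runs_exec[OF r])
  moreover have "stage_inv x (Suc t) u (\<lambda>r. act (?A r) (\<sigma> r))"
    using assms runs_ok[OF r] by (simp add: stage_inv_def)
  ultimately show ?thesis by blast
qed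

lemma runs_load_program:
  assumes "stage_inv x t u \<sigma>"
  shows "\<exists>\<sigma>'. runs load_program \<sigma> \<sigma>' \<and> holds t (start x t) \<sigma>' \<and> length (\<sigma>' Fuel) = t \<and>
     (\<forall>r. persistent r \<longrightarrow> \<sigma>' r = \<sigma> r)"
proof -
  let ?X = "{r \<in> registers. \<not> persistent r}"
  have ok: "ok \<sigma>" and S: "\<And>r. set (\<sigma> r) \<subseteq> symbols" using assms by (auto simp: stage_inv_def ok_def)
  let ?\<sigma>1 = "\<lambda>r. if r \<in> ?X then [] else \<sigma> r"
  have 1: "runs (clear ?X) \<sigma> ?\<sigma>1" by (rule runs_clear) auto
  let ?A = "\<lambda>r. case r of
            Cur i \<Rightarrow> if i \<le> last_tape N \<and> i \<notin> {1..arity N} then Push (Gam (blank N)) else Keep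
          | Label \<Rightarrow> Push (Lab (initial_label N))
          | _ \<Rightarrow> Keep"
  let ?\<sigma>2 = "\<lambda>r. act (?A r) (?\<sigma>1 r)"
  have b: "i \<le> index_bound" if "i \<le> Suc (last_tape N)" for i using that by (intro index_bound_tapes) simp
  have 2: "runs (Par ?A) ?\<sigma>1 ?\<sigma>2"
  proof (rule runs_Par)
    show "?A r = Keep" if "r \<notin> registers" for r
      using that b by (cases r) auto
    have "initial_label N \<in> labels N" using N by (simp add: generalized_TM_def)
    then show "s \<in> symbols" if "?A r = Push s" for r s
      using that blank_gamma by (cases r) (auto split: if_splits)
  qed simp
  \<comment> \<open>the store after the first \<open>k\<close> inputs have been loaded\<close>
  define \<rho> where "\<rho> = (\<lambda>k r. case r of
      Cur i \<Rightarrow> if 1 \<le> i \<and> i \<le> k then Tag # map Letter (map (x (i - 1)) [0..<t]) else ?\<sigma>2 r | _ \<Rightarrow> ?\<sigma>2 r)"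
  have \<rho>0: "\<rho> 0 = ?\<sigma>2" by (auto simp: \<rho>_def fun_eq_iff split: reg.splits)
  have 3: "runs (Seqs (map (\<lambda>j. Seq (copy_rev Tmp (Prefix j) (Cur (Suc j))) (push (Cur (Suc j)) Tag)) [0..<arity N]))
      (\<rho> 0) (\<rho> (arity N))"
  proof (rule runs_Seqs_upt)
    fix j assume j: "j < arity N"
    have bj: "j \<le> index_bound" "Suc j \<le> index_bound" using b j arity_bound by auto
    have e: "\<rho> j (Cur (Suc j)) = []" using bj j by (simp add: \<rho>_def)
    have p: "\<rho> j (Prefix j) = rev (map Letter (map (x j) [0..<t]))"
      using assms j by (simp add: \<rho>_def stage_inv_def)
    let ?\<rho>1 = "(\<rho> j)(Cur (Suc j) := rev (\<rho> j (Prefix j)) @ \<rho> j (Cur (Suc j)))"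
    have "runs (copy_rev Tmp (Prefix j) (Cur (Suc j))) (\<rho> j) ?\<rho>1"
      by (rule runs_copy_rev) (use bj p in \<open>auto simp: \<rho>_def\<close>)
    moreover have "runs (push (Cur (Suc j)) Tag) ?\<rho>1 (?\<rho>1(Cur (Suc j) := Tag # ?\<rho>1 (Cur (Suc j))))"
      by (rule runs_push) (use bj in auto)
    moreover have "?\<rho>1(Cur (Suc j) := Tag # ?\<rho>1 (Cur (Suc j))) = \<rho> (Suc j)"
      using p e by (auto simp: fun_eq_iff \<rho>_def le_Suc_eq split: reg.splits)
    ultimately show "runs (Seq (copy_rev Tmp (Prefix j) (Cur (Suc j))) (push (Cur (Suc j)) Tag)) (\<rho> j) (\<rho> (Suc j))"
      using runs_Seq by metis
  qed
  let ?\<sigma>3 = "\<rho> (arity N)"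
  let ?\<sigma>4 = "?\<sigma>3(Fuel := ?\<sigma>3 Clock @ ?\<sigma>3 Fuel)"
  have 4: "runs (copy Tmp Clock Fuel) ?\<sigma>3 ?\<sigma>4"
    by (rule runs_copy) (use S in \<open>auto simp: \<rho>_def\<close>)
  have run: "runs load_program \<sigma> ?\<sigma>4"
    unfolding load_program_def using 1 2 3[unfolded \<rho>0] 4 by (intro runs_Seq)
  have t: "length (\<sigma> Clock) = t" using assms by (simp add: stage_inv_def)
  have tape: "holds_tape i (snd (start x t) i) ?\<sigma>4" if i: "i \<le> last_tape N" for i
  proof -
    let ?\<alpha> = "\<lambda>z::int. if 1 \<le> i \<and> i \<le> arity N \<and> z = 0 then Inl (map (x (i - 1)) [0..<t]) else Inr (blank N)"
    have "holds_tape i (?\<alpha>, 0) ?\<sigma>4"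
    proof (rule holds_tapeI)
      show "?\<sigma>4 (Cur i) = encode_cell (?\<alpha> 0)"
        using i b[of i] by (auto simp: \<rho>_def)
      show "?\<sigma>4 (Lft i) = encode_cells []" "?\<sigma>4 (Rgt i) = encode_cells []"
        using b[of i] i by (simp_all add: \<rho>_def)
    qed (auto simp: half_Nil)
    then show ?thesis by (simp add: start_def initial_config_def truncated_def cong: if_cong)
  qed
  have "?\<sigma>4 Tmp = []" "length (?\<sigma>4 Clock) = t" "?\<sigma>4 Label = [Lab (initial_label N)]" "?\<sigma>4 Moves = []"
    "length (?\<sigma>4 Fuel) = t"
    using t by (simp_all add: \<rho>_def)
  moreover have "ok ?\<sigma>4" using runs_ok[OF run ok] .
  moreover have "\<forall>r. persistent r \<longrightarrow> ?\<sigma>4 r = \<sigma> r"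
  proof (intro allI impI)
    fix r assume "persistent r" then show "?\<sigma>4 r = \<sigma> r" by (cases r) (simp_all add: \<rho>_def)
  qed
  moreover have "fst (start x t) = initial_label N" "snd (snd (start x t) 0) = 0"
    by (simp_all add: start_def initial_config_def truncated_def)
  ultimately have "holds t (start x t) ?\<sigma>4" using tape by (simp add: holds_def)
  then show ?thesis
    using run \<open>length (?\<sigma>4 Fuel) = t\<close> \<open>\<forall>r. persistent r \<longrightarrow> ?\<sigma>4 r = \<sigma> r\<close> by blast
qed

lemma related_args_available:
  assumes "related R \<kappa> \<kappa>'" "gtm_step N \<kappa> \<kappa>1"
  shows "args_available \<kappa>'"
proof -
  obtain l T where \<kappa>: "\<kappa> = (l, T)" by (cases \<kappa>)
  obtain T' where \<kappa>': "\<kappa>' = (l, T')" using assms(1) \<kappa> by (cases \<kappa>') (auto simp: related_def)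
  have "\<exists>w. cell T' i = Inl w" if "cell T i = Inl y" for i y
    using related_cell[OF assms(1)[unfolded \<kappa> \<kappa>'], of i] that by (cases "cell T' i") auto
  then show ?thesis
    using assms(2) \<kappa> \<kappa>' by (cases "statement N l") (auto simp: args_available_def gtm_step_def apply_fun_def)
qed

text \<open>
  Whatever a stage emits is correct because the computation on words follows the given computation of
  \<open>N\<close> as long as it lasts; it may break off early at an undecided test or for lack of fuel, and then
  the stage emits nothing.
\<close>

lemma exec_stage:
  assumes run: "(gtm_step N ^^ m) (initial_config N x) \<kappa>" and acc: "accepting_config N \<kappa> y"
    and inv: "stage_inv x t u \<sigma>" and u: "approximates 0 y u"
  shows "\<exists>\<sigma>' u'. exc x stage (\<sigma>, t, u) (\<sigma>', Suc t, u') \<and> stage_inv x (Suc t) u' \<sigma>' \<and> approximates 0 y u' \<and>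
     caught_up x (Suc t) u'"
proof -
  let ?t = "Suc t"
  \<comment> \<open>the word computation is accompanied by the given one and reaches the final label only with it\<close>
  have shadow: "\<exists>\<kappa>i. related (approximates 0) \<kappa>i \<kappa>' \<and> (fst \<kappa>' \<noteq> final_label N \<longrightarrow> (\<exists>\<kappa>1. gtm_step N \<kappa>i \<kappa>1) \<and> fst \<kappa>' \<in> labels N) \<and>
      (fst \<kappa>' = final_label N \<longrightarrow> \<kappa>i = \<kappa>)" if d: "(gtm_step (truncated ?t) ^^ d) (start x ?t) \<kappa>'" for d \<kappa>'
  proof -
    have fin: "fst \<kappa> = final_label N" using acc by (simp add: accepting_config_def)
    have rel: "related (approximates 0) \<kappa>i \<kappa>''"
      if "(gtm_step N ^^ i) (initial_config N x) \<kappa>i" "(gtm_step (truncated ?t) ^^ i) (start x ?t) \<kappa>''" for i \<kappa>i \<kappa>''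
      by (rule truncated_sound[OF that])
    have "d \<le> m"
    proof (rule ccontr)
      assume "\<not> d \<le> m"
      then obtain \<kappa>'' \<kappa>1 where "(gtm_step (truncated ?t) ^^ m) (start x ?t) \<kappa>''" "gtm_step (truncated ?t) \<kappa>'' \<kappa>1"
        using relpowp_initial_segment[OF d, of m] by (metis less_imp_le not_le)
      then show False
        using rel[OF run] fin no_truncated_step_final[of \<kappa>'' ?t \<kappa>1] by (auto simp: related_def)
    qed
    then obtain \<kappa>i where \<kappa>i: "(gtm_step N ^^ d) (initial_config N x) \<kappa>i" "d < m \<Longrightarrow> \<exists>\<kappa>1. gtm_step N \<kappa>i \<kappa>1" "d = m \<Longrightarrow> \<kappa>i = \<kappa>"
      by (rule relpowp_initial_segment[OF run]) blast
    have r: "related (approximates 0) \<kappa>i \<kappa>'" by (rule rel[OF \<kappa>i(1) d])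
    then have lab: "fst \<kappa>i = fst \<kappa>'" by (simp add: related_def)
    show ?thesis
    proof (cases "d = m")
      case True
      then show ?thesis using r \<kappa>i(3) fin lab by (intro exI[of _ \<kappa>i]) simp
    next
      case False
      then obtain \<kappa>1 where s: "gtm_step N \<kappa>i \<kappa>1" using \<kappa>i(2) \<open>d \<le> m\<close> by auto
      then have "fst \<kappa>' \<noteq> final_label N" using no_step_final lab by metis
      moreover have "fst \<kappa>' \<in> labels N" using run_labels[OF N \<kappa>i(1)] lab by simp
      ultimately show ?thesis using r s by blast
    qed
  qed
  have avail: "fst \<kappa>' \<in> labels N \<and> args_available \<kappa>'"
    if "(gtm_step (truncated ?t) ^^ d) (start x ?t) \<kappa>'" "fst \<kappa>' \<noteq> final_label N" for d \<kappa>'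
    using shadow[OF that(1)] that(2) related_args_available by blast
  have final: "\<exists>w. fst (snd \<kappa>' 0) 0 = Inl w \<and> approximates 0 y w"
    if "(gtm_step (truncated ?t) ^^ d) (start x ?t) \<kappa>'" "fst \<kappa>' = final_label N" for d \<kappa>'
  proof -
    have "related (approximates 0) \<kappa> \<kappa>'" using shadow[OF that(1)] that(2) by blast
    then have "rel_sum (approximates 0) (=) (fst (snd \<kappa> 0) 0) (fst (snd \<kappa>' 0) 0)" by (simp add: related_def)
    then show ?thesis using acc by (cases "fst (snd \<kappa>' 0) 0") (auto simp: accepting_config_def)
  qed
  obtain \<sigma>1 where 1: "exc x read_program (\<sigma>, t, u) (\<sigma>1, ?t, u)" and inv1: "stage_inv x ?t u \<sigma>1"
    using exec_read_program[OF inv] by blast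
  obtain \<sigma>2 where 2: "runs load_program \<sigma>1 \<sigma>2" "holds ?t (start x ?t) \<sigma>2" "length (\<sigma>2 Fuel) = ?t"
    "\<forall>r. persistent r \<longrightarrow> \<sigma>2 r = \<sigma>1 r" using runs_load_program[OF inv1] by blast
  obtain \<sigma>3 where 3: "runs run_program \<sigma>2 \<sigma>3" "outcome ?t ?t (start x ?t) \<sigma>3" "\<forall>r. persistent r \<longrightarrow> \<sigma>3 r = \<sigma>2 r"
    using runs_run_program[of ?t "start x ?t" \<sigma>2 ?t] avail 2(2,3) by blast
  have ok3: "ok \<sigma>3" using runs_ok[OF 3(1)] 2(2) by (simp add: holds_def)
  have inv3: "stage_inv x ?t u \<sigma>3" using inv1 ok3 2(4) 3(3) by (simp add: stage_inv_def)
  have "\<exists>\<sigma>' u'. exc x finish_program (\<sigma>3, ?t, u) (\<sigma>', ?t, u') \<and> stage_inv x ?t u' \<sigma>' \<and> approximates 0 y u' \<and>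
     caught_up x (Suc t) u'"
    using 3(2) unfolding outcome_def
  proof (elim disjE exE conjE)
    fix d \<kappa>' assume d: "(gtm_step (truncated ?t) ^^ d) (start x ?t) \<kappa>'" and fin: "fst \<kappa>' = final_label N" and h: "holds ?t \<kappa>' \<sigma>3"
    obtain w where w: "fst (snd \<kappa>' 0) 0 = Inl w" "approximates 0 y w" using final[OF d fin] by blast
    have "holds_tape 0 (fst (snd \<kappa>' 0), displacement (\<sigma>3 Moves)) \<sigma>3" using h by (simp add: holds_def)
    then obtain \<sigma>4 where 4: "runs unwind \<sigma>3 \<sigma>4" "\<sigma>4 (Cur 0) = encode_cell (fst (snd \<kappa>' 0) 0)"
      "\<forall>r. r \<notin> {Moves, Cur 0, Lft 0, Rgt 0} \<longrightarrow> \<sigma>4 r = \<sigma>3 r"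
      using runs_unwind[OF ok3] by blast
    have e4: "length (\<sigma>4 Emitted) = length u" using 4(3) inv3 by (simp add: stage_inv_def)
    have tmp4: "\<sigma>4 Tmp = []" using 4(3) h by (simp add: holds_def)
    have c4: "\<sigma>4 (Cur 0) = Tag # map Letter w" using 4(2) w by simp
    let ?u' = "u @ drop (length u) w"
    obtain \<sigma>5 where 5: "exc x emit_new (\<sigma>4, ?t, u) (\<sigma>5, ?t, ?u')" "length (\<sigma>5 Emitted) = length ?u'"
      "\<forall>r. r \<notin> {Cur 0, Tmp, Emitted} \<longrightarrow> \<sigma>5 r = \<sigma>4 r"
      using exec_emit_new[OF runs_ok[OF 4(1) ok3] c4 tmp4 e4] by blast
    have "\<sigma>3 Label = [Lab (final_label N)]" using h fin by (simp add: holds_def)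
    then have run5: "exc x finish_program (\<sigma>3, ?t, u) (\<sigma>5, ?t, ?u')"
      unfolding finish_program_def
      by (intro exec.Case) (use runs_exec[OF 4(1)] 5(1) in \<open>auto simp: tops_Cons intro: exec.Seq\<close>)
    have "ok \<sigma>5" using exec_ok[OF run5] ok3 by simp
    then have "stage_inv x ?t ?u' \<sigma>5" using inv3 4(3) 5(2,3) by (simp add: stage_inv_def)
    moreover have "approximates 0 y ?u'"
      using u w(2) by (auto simp: approximates_def nth_append)
    moreover have "length w' \<le> length ?u'"
      if d': "(gtm_step (truncated ?t) ^^ d') (start x ?t) \<kappa>''" "fst \<kappa>'' = final_label N" "fst (snd \<kappa>'' 0) 0 = Inl w'"
      for d' \<kappa>'' w'
    proof -
      have "\<kappa>'' = \<kappa>'"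
        by (rule relpowp_end_unique[OF gtm_step_det d'(1) d]) (use d'(2) fin no_truncated_step_final in auto)
      then show ?thesis using w d'(3) by simp
    qed
    ultimately show ?thesis using run5 unfolding caught_up_def by blast
  next
    assume n: "tops \<sigma>3 Label \<noteq> Some (Lab (final_label N))"
      "\<nexists>d \<kappa>'. d \<le> ?t \<and> (gtm_step (truncated ?t) ^^ d) (start x ?t) \<kappa>' \<and> fst \<kappa>' = final_label N"
    have "exc x finish_program (\<sigma>3, ?t, u) (\<sigma>3, ?t, u)"
      unfolding finish_program_def by (rule exec.Case) (use n(1) runs_exec[OF runs_skip] in simp)
    then show ?thesis using inv3 u n(2) unfolding caught_up_def by blast
  qed
  then obtain \<sigma>4 u' where 4: "exc x finish_program (\<sigma>3, ?t, u) (\<sigma>4, ?t, u')" "stage_inv x ?t u' \<sigma>4" "approximates 0 y u'"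
    "caught_up x ?t u'"
    by blast
  have "exc x stage (\<sigma>, t, u) (\<sigma>4, ?t, u')"
    unfolding stage_def using 1 runs_exec[OF 2(1)] runs_exec[OF 3(1)] 4(1) by (blast intro: exec.Seq)
  then show ?thesis using 4 by blast
qed

text \<open>
  The outputs at the ends of the stages are prefixes of \<open>y\<close>.  They become arbitrarily long: for large
  \<open>t\<close> the final label is reached, in as many steps as in the given computation, with a word of any
  prescribed length.
\<close>

theorem gtm_fun_computable: "computable_pfun t2_outputs_seq (arity N) (gtm_fun N)"
proof -
  obtain M :: "'a t2m" where M: "type2_machine M" "t2_inputs M = arity N" and
    out: "\<And>x y st. st 0 = (\<lambda>_. [], 0, []) \<Longrightarrow> (\<And>t. exc x stage (st t) (st (Suc t))) \<Longrightarrow>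
        (\<And>t. snd (snd (st t)) = map y [0..<length (snd (snd (st t)))]) \<Longrightarrow>
        (\<And>m. \<exists>t. m \<le> length (snd (snd (st t)))) \<Longrightarrow> t2_outputs_seq M x y"
    using stack_program_computable[OF finite_R finite_symbols, of "arity N" stage] by blast
  show ?thesis
  proof (rule computable_pfunI[OF M])
    show "dom (gtm_fun N) \<subseteq> (\<Pi>\<^sub>E j\<in>{..<arity N}. UNIV)"
      using dom_gtm_fun[of N] by (auto simp: PiE_def)
  next
    fix x y assume "gtm_fun N x = Some y"
    then obtain m \<kappa> where run: "(gtm_step N ^^ m) (initial_config N x) \<kappa>" and acc: "accepting_config N \<kappa> y"
      by (rule gtm_fun_run)
    let ?P = "\<lambda>t (st :: (reg \<Rightarrow> ('l, 'g, 'a) sym list) \<times> nat \<times> 'a list).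
      stage_inv x t (snd (snd st)) (fst st) \<and> fst (snd st) = t \<and> approximates 0 y (snd (snd st))"
    let ?Q = "\<lambda>t (st :: (reg \<Rightarrow> ('l, 'g, 'a) sym list) \<times> nat \<times> 'a list) st'. exc x stage st st' \<and>
      caught_up x (Suc t) (snd (snd st'))"
    have step: "\<exists>st'. ?P (Suc t) st' \<and> ?Q t st st'" if P0: "?P t st" for t st
    proof -
      obtain \<sigma> u where st: "st = (\<sigma>, t, u)" using P0 by (cases st) auto
      have "stage_inv x t u \<sigma>" "approximates 0 y u" using P0 st by auto
      from exec_stage[OF run acc this] obtain \<sigma>' u' where
        "exc x stage (\<sigma>, t, u) (\<sigma>', Suc t, u')" "stage_inv x (Suc t) u' \<sigma>'" "approximates 0 y u'"
        "caught_up x (Suc t) u'" by blast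
      then show ?thesis unfolding st by (intro exI[of _ "(\<sigma>', Suc t, u')"]) simp
    qed
    define st where "st = rec_nat (\<lambda>_. [], 0, []) (\<lambda>t s. SOME s'. ?P (Suc t) s' \<and> ?Q t s s')"
    have st0: "st 0 = (\<lambda>_. [], 0, [])" by (simp add: st_def)
    have stS: "st (Suc t) = (SOME s'. ?P (Suc t) s' \<and> ?Q t (st t) s')" for t by (simp add: st_def)
    have P: "?P t (st t)" for t
    proof (induction t)
      case 0
      show ?case unfolding st0 by (simp add: stage_inv_def ok_def approximates_def)
    next
      case (Suc t)
      show ?case using someI_ex[OF step[OF Suc]] unfolding stS by blast
    qed
    have Q: "?Q t (st t) (st (Suc t))" for t
      using someI_ex[OF step[OF P[of t]]] unfolding stS by blast
    show "t2_outputs_seq M x y"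
    proof (rule out[of st, OF st0])
      show "exc x stage (st t) (st (Suc t))" for t using Q by blast
      show "snd (snd (st t)) = map y [0..<length (snd (snd (st t)))]" for t
        using P[of t] by (intro nth_equalityI) (auto simp: approximates_def)
      show "\<exists>t. n \<le> length (snd (snd (st t)))" for n
      proof -
        obtain k1 where k1: "\<forall>t\<ge>k1. \<exists>\<kappa>'. (gtm_step (truncated t) ^^ m) (start x t) \<kappa>'"
          using truncated_progress[OF run] by blast
        obtain k2 where k2: "\<forall>t \<kappa>'. k2 \<le> t \<longrightarrow> (gtm_step (truncated t) ^^ m) (start x t) \<kappa>' \<longrightarrow> related (approximates n) \<kappa> \<kappa>'"
          using truncated_close[OF run] by blast
        \<comment> \<open>the stage must also allow the \<open>m\<close> steps of the given computation; stages count from 1\<close>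
        let ?t = "Suc (max m (max k1 k2))"
        have le: "m \<le> ?t" "k1 \<le> ?t" "k2 \<le> ?t" by (simp_all add: le_max_iff_disj le_SucI)
        obtain \<kappa>' where \<kappa>': "(gtm_step (truncated ?t) ^^ m) (start x ?t) \<kappa>'" using k1[rule_format, OF le(2)] by blast
        then have rel: "related (approximates n) \<kappa> \<kappa>'" using k2[rule_format, OF le(3)] by blast
        then have "rel_sum (approximates n) (=) (fst (snd \<kappa> 0) 0) (fst (snd \<kappa>' 0) 0)" by (simp add: related_def)
        then obtain w where w: "fst (snd \<kappa>' 0) 0 = Inl w" "approximates n y w"
          using acc by (cases "fst (snd \<kappa>' 0) 0") (auto simp: accepting_config_def)
        have "fst \<kappa>' = final_label N" using rel acc by (simp add: related_def accepting_config_def)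
        then have "length w \<le> length (snd (snd (st ?t)))"
          using Q[of "max m (max k1 k2)"] \<kappa>' w(1) le(1) unfolding caught_up_def by blast
        then show ?thesis using w(2) by (intro exI[of _ ?t]) (simp add: approximates_def)
      qed
    qed
  qed
qed

end

section \<open>The theorem for generalized Turing machines\<close>

lemma trivial_machine: "type2_machine \<lparr>t2_inputs = 0, t2_works = 0, t2_states = {0}, t2_start = 0, t2_halt = 0,
    t2_symbols = {0}, t2_blank = 0, t2_delta = \<lambda>_ _ _. (0, [], [], None)\<rparr>"
  by (simp add: type2_machine_def)

lemma computable_pfun_machine:
  assumes "computable_pfun outputs n f"
  obtains M where "type2_machine M" "t2_inputs M = n"
    "\<And>y v. y \<in> extensional {..<n} \<Longrightarrow> f y = Some v \<Longrightarrow> outputs M y v"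
proof -
  obtain g where g: "turing_computable outputs n g" "f \<subseteq>\<^sub>m g" using assms unfolding computable_pfun_def by blast
  then obtain M where M: "type2_machine M" "t2_inputs M = n"
    "\<forall>x \<in> (\<Pi>\<^sub>E j\<in>{..<n}. UNIV). \<forall>y. g x = Some y \<longleftrightarrow> outputs M x y"
    unfolding turing_computable_def by blast
  have "outputs M y v" if "y \<in> extensional {..<n}" "f y = Some v" for y v
  proof -
    have "g y = Some v" using g(2) that(2) by (metis domI map_le_def)
    then show ?thesis using M(3) that(1) by (simp add: PiE_def)
  qed
  then show thesis using that M by blast
qed

theorem theorem5p7:
  fixes N :: "('l, 'g, 'a::{finite, zero_neq_one} word, 'a) gtm"
  assumes "generalized_TM N"
    and "\<forall>i \<le> last_tape N. cell_set N i = UNIV"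
  shows "(all_functions N (\<lambda>n. continuous_pfun n cantor_topology)
                          (\<lambda>n. continuous_pfun n (discrete_topology UNIV)) \<longrightarrow>
            continuous_pfun (arity N) cantor_topology (gtm_fun N)) \<and>
         (all_functions N (computable_pfun t2_outputs_seq)
                          (computable_pfun t2_outputs_word) \<longrightarrow>
            computable_pfun t2_outputs_seq (arity N) (gtm_fun N))"
proof (intro conjI impI)
  assume "all_functions N (\<lambda>n. continuous_pfun n cantor_topology)
                          (\<lambda>n. continuous_pfun n (discrete_topology UNIV))"
  then show "continuous_pfun (arity N) cantor_topology (gtm_fun N)"
    by (rule gtm_fun_continuous[OF assms])
next
  assume fs: "all_functions N (computable_pfun t2_outputs_seq) (computable_pfun t2_outputs_word)"
  let ?good = "\<lambda>l (M :: 'a t2m). type2_machine M \<and> (l \<in> labels N - {final_label N} \<longrightarrow>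
    (case statement N l of
       Assign i f js l' \<Rightarrow> t2_inputs M = length js \<and>
         (\<forall>y v. y \<in> extensional {..<length js} \<longrightarrow> f y = Some v \<longrightarrow> t2_outputs_seq M y v)
     | Test f js l' l'' \<Rightarrow> t2_inputs M = length js \<and>
         (\<forall>y v. y \<in> extensional {..<length js} \<longrightarrow> f y = Some v \<longrightarrow> v \<in> {[0], [1]} \<and> t2_outputs_word M y v)
     | _ \<Rightarrow> True))"
  have "\<exists>M. ?good l M" for l
  proof (cases "l \<in> labels N - {final_label N}")
    case True
    note f = bspec[OF fs[unfolded all_functions_def] True]
    have wf: "wf_stmt N (statement N l)" using assms(1) True by (simp add: generalized_TM_def)
    show ?thesis
    proof (cases "statement N l")
      case (Assign i f js l')
      then have "computable_pfun t2_outputs_seq (length js) f" using f by simp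
      then obtain M where "type2_machine M" "t2_inputs M = length js"
        "\<And>y v. y \<in> extensional {..<length js} \<Longrightarrow> f y = Some v \<Longrightarrow> t2_outputs_seq M y v"
        by (rule computable_pfun_machine) blast
      then show ?thesis using Assign by (intro exI[of _ M]) simp
    next
      case (Test f js l' l'')
      then have "computable_pfun t2_outputs_word (length js) f" using f by simp
      then obtain M where "type2_machine M" "t2_inputs M = length js"
        "\<And>y v. y \<in> extensional {..<length js} \<Longrightarrow> f y = Some v \<Longrightarrow> t2_outputs_word M y v"
        by (rule computable_pfun_machine) blast
      moreover have "v \<in> {[0], [1]}" if "f y = Some v" for y v
        using wf Test ranI[of f y v] that by (auto simp: wf_stmt_def)
      ultimately show ?thesis using Test by (intro exI[of _ M]) simp
    qed (use trivial_machine in auto)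
  qed (use trivial_machine in blast)
  then have "\<forall>l. \<exists>M. ?good l M" ..
  from choice[OF this] obtain Mc where Mc: "\<forall>l. ?good l (Mc l)" ..
  interpret simulation N Mc
  proof
    show "generalized_TM N" by (rule assms(1))
    show "type2_machine (Mc l)" for l using Mc[rule_format, of l] by simp
  next
    fix l i f js l' assume "l \<in> labels N - {final_label N}" "statement N l = Assign i f js l'"
    then show "t2_inputs (Mc l) = length js \<and>
      (\<forall>y v. y \<in> extensional {..<length js} \<longrightarrow> f y = Some v \<longrightarrow> t2_outputs_seq (Mc l) y v)"
      using Mc[rule_format, of l] by simp
  next
    fix l f js l' l'' assume "l \<in> labels N - {final_label N}" "statement N l = Test f js l' l''"
    then show "t2_inputs (Mc l) = length js \<and>
      (\<forall>y v. y \<in> extensional {..<length js} \<longrightarrow> f y = Some v \<longrightarrow>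
         v \<in> {[0], [1]} \<and> t2_outputs_word (Mc l) y v)"
      using Mc[rule_format, of l] by simp
  qed
  show "computable_pfun t2_outputs_seq (arity N) (gtm_fun N)" by (rule gtm_fun_computable)
qed

end
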